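(* Let $n\ge3$. Then for every $\alpha>-1$ and every $\Lambda\in(0,\Lambda_1)$ there exists a solution $u$ of problem (P0) with $\int_{\mathbb{R}^n}|x|^{n\alpha}e^{nu}dx=\Lambda$.
   Context: Throughout, $n\ge 2$ is an integer, $|S^n|$ is the volume of the unit $n$-sphere, $\gamma_n:=\frac{(n-1)!}{2}|S^n|$ and $\Lambda_1:=(n-1)!\,|S^n|$. For $s>0$, $L_s(\mathbb{R}^n):=\{w\in L^1_{loc}(\mathbb{R}^n):\int_{\mathbb{R}^n}\frac{|w(x)|}{1+|x|^{n+2s}}dx<\infty\}$. For a Schwartz function $\varphi$, $(-\Delta)^{s}\varphi:=\mathcal F^{-1}(|\xi|^{2s}\mathcal F\varphi)$. Given $m\ge1$ and a tempered distribution $f$, $u$ solves $(-\Delta)^{m/2}u=f$ in $\mathbb{R}^n$ if: for $m$ even, $u\in L^1_{loc}$ and $\int u(-\Delta)^{m/2}\varphi\,dx=\langle f,\varphi\rangle$ for all $\varphi\in C_c^\infty$; for $m$ odd, $u\in L_{m/2}$ and the identity holds for all Schwartz $\varphi$. Problem (P0), for $\alpha>-1$: $u$ solves $(-\Delta)^{n/2}u=|x|^{n\alpha}e^{nu}$ on $\mathbb{R}^n$ in this sense and $\Lambda:=\int_{\mathbb{R}^n}|x|^{n\alpha}e^{nu}dx<\infty$. *)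

theory Defs
  imports "HOL-Analysis.Analysis"
begin

fun iter_pderiv :: "(real^'n) list \<Rightarrow> (real^'n \<Rightarrow> real) \<Rightarrow> real^'n \<Rightarrow> real" where
  "iter_pderiv [] f = f"
| "iter_pderiv (v # vs) f = (\<lambda>x. frechet_derivative (iter_pderiv vs f) (at x) v)"

definition smooth_fun :: "(real^'n \<Rightarrow> real) \<Rightarrow> bool" where
  "smooth_fun f \<longleftrightarrow> (\<forall>vs. set vs \<subseteq> Basis \<longrightarrow> (\<forall>x. iter_pderiv vs f differentiable (at x)))"

definition test_fun :: "(real^'n \<Rightarrow> real) \<Rightarrow> bool" where
  "test_fun f \<longleftrightarrow> smooth_fun f \<and> compact (closure {x. f x \<noteq> 0})"

definition schwartz_fun :: "(real^'n \<Rightarrow> real) \<Rightarrow> bool" where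
  "schwartz_fun f \<longleftrightarrow> smooth_fun f \<and>
     (\<forall>vs k. set vs \<subseteq> Basis \<longrightarrow> bounded (range (\<lambda>x. norm x ^ k * iter_pderiv vs f x)))"

definition fourier :: "(real^'n \<Rightarrow> complex) \<Rightarrow> real^'n \<Rightarrow> complex" where
  "fourier g \<xi> = (LINT x|lborel. g x * cis (- (x \<bullet> \<xi>)))"

definition inv_fourier :: "(real^'n \<Rightarrow> complex) \<Rightarrow> real^'n \<Rightarrow> complex" where
  "inv_fourier g x = complex_of_real (1 / (2 * pi) ^ CARD('n)) * (LINT \<xi>|lborel. g \<xi> * cis (x \<bullet> \<xi>))"

definition frac_lap :: "real \<Rightarrow> (real^'n \<Rightarrow> real) \<Rightarrow> real^'n \<Rightarrow> real" where
  "frac_lap s \<phi> x = Re (inv_fourier (\<lambda>\<xi>. complex_of_real (norm \<xi> powr (2 * s)) * fourier (\<lambda>y. complex_of_real (\<phi> y)) \<xi>) x)"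

definition loc_integrable :: "(real^'n \<Rightarrow> real) \<Rightarrow> bool" where
  "loc_integrable u \<longleftrightarrow> u \<in> borel_measurable lborel \<and> (\<forall>K. compact K \<longrightarrow> set_integrable lborel K u)"

definition L_space :: "real \<Rightarrow> (real^'n \<Rightarrow> real) \<Rightarrow> bool" where
  "L_space s u \<longleftrightarrow> loc_integrable u \<and>
     integrable lborel (\<lambda>x. \<bar>u x\<bar> / (1 + norm x powr (real CARD('n) + 2 * s)))"

text \<open>u solves (-\<Delta>)^(m/2) u = f in R^n (f a locally integrable function, acting by integration).\<close>
definition solves_frac :: "nat \<Rightarrow> (real^'n \<Rightarrow> real) \<Rightarrow> (real^'n \<Rightarrow> real) \<Rightarrow> bool" where
  "solves_frac m u f \<longleftrightarrow>
     (if even m then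
        loc_integrable u \<and>
        (\<forall>\<phi>. test_fun \<phi> \<longrightarrow>
           integrable lborel (\<lambda>x. u x * frac_lap (real m / 2) \<phi> x) \<and>
           (LINT x|lborel. u x * frac_lap (real m / 2) \<phi> x) = (LINT x|lborel. f x * \<phi> x))
      else
        L_space (real m / 2) u \<and>
        (\<forall>\<phi>. schwartz_fun \<phi> \<longrightarrow>
           integrable lborel (\<lambda>x. u x * frac_lap (real m / 2) \<phi> x) \<and>
           (LINT x|lborel. u x * frac_lap (real m / 2) \<phi> x) = (LINT x|lborel. f x * \<phi> x)))"

text \<open>Volume of the unit n-sphere S^n in R^(n+1).\<close>
definition sphere_vol :: "nat \<Rightarrow> real" where
  "sphere_vol n = 2 * pi powr ((real n + 1) / 2) / Gamma ((real n + 1) / 2)"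

definition Lambda1 :: "nat \<Rightarrow> real" where
  "Lambda1 n = fact (n - 1) * sphere_vol n"

definition P0 :: "real \<Rightarrow> (real^'n \<Rightarrow> real) \<Rightarrow> bool" where
  "P0 \<alpha> u \<longleftrightarrow>
     solves_frac CARD('n) u (\<lambda>x. norm x powr (real CARD('n) * \<alpha>) * exp (real CARD('n) * u x)) \<and>
     integrable lborel (\<lambda>x. norm x powr (real CARD('n) * \<alpha>) * exp (real CARD('n) * u x))"

end

theory Submission
  imports Defs "HOL-Probability.Probability" "HOL-Complex_Analysis.Great_Picard"
begin

text \<open>
  We look for \<open>u = -(\<Lambda>/\<gamma>) \<psi> - l |x - p|\<^sup>2 + c\<close>, where \<open>\<gamma> = \<Lambda>\<^sub>1/2\<close> and \<open>\<psi>\<close> is the logarithmic potential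
  of a probability density \<open>\<rho>\<close>. Since \<open>-ln|x|/\<gamma>\<close> is a fundamental solution of \<open>(-\<Delta>)\<close> to the power \<open>n/2\<close> and
  quadratic polynomials are annihilated (\<open>n \<ge> 3\<close>), the problem becomes the fixed point equation
  \<open>\<rho> = K exp(-2\<beta>\<psi>)/Z\<close> with \<open>\<beta> = n\<Lambda>/\<Lambda>\<^sub>1 < n\<close> and \<open>K = |x| powr (n\<alpha>) exp(-n l |x - p|\<^sup>2)\<close>.
  This is the Euler--Lagrange equation of the free energy
  \<open>F(\<rho>) = \<integral>\<rho> ln(\<rho>/K) + \<beta> \<integral>\<integral>\<rho>(x)\<rho>(y) ln|x - y|\<close>, which the Gibbs inequality bounds from below for
  \<open>\<beta> < n\<close> as long as \<open>\<rho>\<close> puts little mass near the origin, where \<open>K\<close> may be singular; placing the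
  centre \<open>p\<close> away from the origin and taking \<open>l\<close> large creates an energy barrier that enforces this.
  The logarithmic kernel is conditionally negative definite, so replacing the interaction by its
  linearisation majorises \<open>F\<close>: iterating \<open>\<rho> \<mapsto> K exp(-2\<beta>\<psi>)/Z\<close> decreases \<open>F\<close> along the whole segment,
  hence never crosses the barrier, and the decrements control the distance of successive iterates.
  Uniform Hoelder bounds for the potentials then yield a limit, which is a fixed point.
\<close>

section \<open>Integrability and the logarithmic kernel\<close>

text \<open>The Gaussian factor confines the gas: for \<alpha> > -1 the power |x| powr (n\<alpha>)
  alone is not integrable at infinity. The threshold on \<Lambda> is one of local integrability. The
  Gibbs inequality with test function -b ln|x - y| needs b < n, while coercivity needs b > \<beta>;
  both can be met exactly when \<beta> < n. For \<alpha> < 0 and y at the origin the admissible b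
  drops below n(1 + \<alpha>), which by itself would reach only \<Lambda> < (1 + \<alpha>)
  \<open>Lambda1\<close>. Near the origin a small exponent is used instead, and the loss is
  affordable because little mass sits there; this is why the barrier is needed.

  Iterating rather than minimising avoids lower semicontinuity and the derivation of an
  Euler-Lagrange equation: the limit satisfies the fixed point equation at every point.

  One identity serves both the gas and the equation: ln r is the integral over s > 0 of
  (exp(-1/(4s)) - exp(-r^2/(4s)))/(2s). Against mean-zero densities it gives the sign of the
  interaction; against the fractional Laplacian of a test function it yields heat flows whose
  superposition reproduces that function.\<close>

lemma pair_integrableI:
  fixes F :: "'a \<times> 'b \<Rightarrow> 'c::{banach, second_countable_topology}"
  assumes "sigma_finite_measure M1" "sigma_finite_measure M2"
    and [measurable]: "F \<in> borel_measurable (M1 \<Otimes>\<^sub>M M2)"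
    and fin: "(\<integral>\<^sup>+x. \<integral>\<^sup>+y. ennreal (norm (F (x, y))) \<partial>M2 \<partial>M1) < \<infinity>"
  shows "integrable (M1 \<Otimes>\<^sub>M M2) F"
proof -
  interpret M2: sigma_finite_measure M2 by fact
  show ?thesis
  proof (rule integrableI_bounded)
    have "(\<integral>\<^sup>+ p. ennreal (norm (F p)) \<partial>(M1 \<Otimes>\<^sub>M M2))
        = (\<integral>\<^sup>+x. \<integral>\<^sup>+y. ennreal (norm (F (x, y))) \<partial>M2 \<partial>M1)"
      by (rule M2.nn_integral_fst[symmetric]) measurable
    then show "(\<integral>\<^sup>+ p. ennreal (norm (F p)) \<partial>(M1 \<Otimes>\<^sub>M M2)) < \<infinity>"
      using fin by simp
  qed measurable
qed

lemma fubini_swap: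
  fixes f :: "'a \<Rightarrow> 'b \<Rightarrow> 'c::{banach, second_countable_topology}"
  assumes "sigma_finite_measure M1" "sigma_finite_measure M2"
    and meas: "case_prod f \<in> borel_measurable (M1 \<Otimes>\<^sub>M M2)"
    and fin: "(\<integral>\<^sup>+x. \<integral>\<^sup>+y. ennreal (norm (f x y)) \<partial>M2 \<partial>M1) < \<infinity>"
  shows "(LINT x|M1. LINT y|M2. f x y) = (LINT y|M2. LINT x|M1. f x y)"
    and "integrable M1 (\<lambda>x. LINT y|M2. f x y)"
    and "integrable M2 (\<lambda>y. LINT x|M1. f x y)"
proof -
  interpret pair_sigma_finite M1 M2
    using assms by (simp add: pair_sigma_finite_def)
  have int: "integrable (M1 \<Otimes>\<^sub>M M2) (case_prod f)"
    by (rule pair_integrableI) (use assms in auto)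
  show "(LINT x|M1. LINT y|M2. f x y) = (LINT y|M2. LINT x|M1. f x y)"
    using Fubini_integral[OF int] by simp
  show "integrable M1 (\<lambda>x. LINT y|M2. f x y)" "integrable M2 (\<lambda>y. LINT x|M1. f x y)"
    using integrable_fst[OF int] integrable_snd[OF int] by simp_all
qed

lemma integrable_nonneg_bound:
  fixes f g :: "'a \<Rightarrow> real"
  assumes "integrable M g" "f \<in> borel_measurable M" "\<And>x. 0 \<le> f x" "\<And>x. f x \<le> g x"
  shows "integrable M f"
proof (rule Bochner_Integration.integrable_bound[OF assms(1,2)])
  show "AE x in M. norm (f x) \<le> norm (g x)"
    using assms(3,4) by (intro always_eventually allI) (metis abs_of_nonneg order_trans real_norm_def)
qed

section \<open>Integrability of powers and Gaussians on Euclidean space\<close>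

lemma integrable_abs_powr_unit:
  fixes a :: real
  assumes "0 \<le> a" "a < 1"
  shows "integrable lborel (\<lambda>t::real. \<bar>t\<bar> powr (-a) * indicator {-1..1} t)"
proof -
  have *: "integrable lborel (\<lambda>t::real. indicator {0..1} t *\<^sub>R t powr (-a))"
  proof -
    have "((\<lambda>t::real. t powr (-a)) has_integral (1 powr (-a+1) / (-a+1))) {0..1}"
      by (rule has_integral_powr_from_0) (use assms in auto)
    then have "(\<lambda>t::real. t powr (-a)) absolutely_integrable_on {0..1}"
      by (intro nonnegative_absolutely_integrable_1) (auto simp: has_integral_integrable)
    then show ?thesis
      unfolding set_integrable_def using integrable_completion[of "\<lambda>t::real. indicator {0..1} t *\<^sub>R t powr (-a)" lborel]
      by (auto simp: borel_measurable_if)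
  qed
  have **: "integrable lborel (\<lambda>t::real. indicator {0..1} (-t) *\<^sub>R (-t) powr (-a))"
    using lborel_integrable_real_affine[OF *, of "-1" 0] by simp
  show ?thesis
  proof (rule Bochner_Integration.integrable_bound[OF Bochner_Integration.integrable_add[OF * **]])
    show "AE t in lborel. norm (\<bar>t\<bar> powr - a * indicator {- 1..1} t)
        \<le> norm (indicat_real {0..1} t *\<^sub>R t powr - a + indicat_real {0..1} (- t) *\<^sub>R (- t) powr - a)"
      by (intro always_eventually) (auto simp: indicator_def)
  qed measurable
qed

lemma integrable_powr_tail:
  fixes a :: real
  assumes "a > 1"
  shows "integrable lborel (\<lambda>t::real. indicator {1..} t *\<^sub>R t powr (-a))"
proof -
  have "((\<lambda>t::real. t powr (-a)) has_integral - (1 powr (-a + 1)) / (-a + 1)) {1..}"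
    by (rule has_integral_powr_to_inf) (use assms in auto)
  then have "(\<lambda>t::real. t powr (-a)) absolutely_integrable_on {1..}"
    by (intro nonnegative_absolutely_integrable_1) (auto simp: has_integral_integrable)
  then show ?thesis
    unfolding set_integrable_def using integrable_completion[of "\<lambda>t::real. indicator {1..} t *\<^sub>R t powr (-a)" lborel]
    by auto
qed

lemma integrable_one_plus_sq_powr:
  fixes a :: real
  assumes "a > 1/2"
  shows "integrable lborel (\<lambda>t::real. (1 + t\<^sup>2) powr (-a))"
proof -
  have *: "integrable lborel (\<lambda>t::real. indicator {1..} t *\<^sub>R t powr (-2*a))"
    using integrable_powr_tail[of "2 * a"] assms by simp
  have **: "integrable lborel (\<lambda>t::real. indicator {1..} (-t) *\<^sub>R (-t) powr (-2*a))"
    using lborel_integrable_real_affine[OF *, of "-1" 0] by simp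
  have ***: "integrable lborel (indicator {-1..1::real} :: real \<Rightarrow> real)"
    by (rule integrable_real_indicator) auto
  have le: "(1 + t\<^sup>2) powr (-a) \<le> \<bar>t\<bar> powr (-2*a)" if "\<bar>t\<bar> \<ge> 1" for t :: real
  proof -
    have "(1 + t\<^sup>2) powr (-a) \<le> (t\<^sup>2) powr (-a)"
      using that assms by (intro powr_mono2') auto
    also have "(t\<^sup>2) powr (-a) = (\<bar>t\<bar> powr 2) powr (-a)" using that by simp
    also have "\<dots> = \<bar>t\<bar> powr (-2*a)" unfolding powr_powr by simp
    finally show ?thesis .
  qed
  have le1: "(1 + t\<^sup>2) powr (-a) \<le> 1" for t :: real
    using powr_mono2'[of "-a" 1 "1 + t\<^sup>2"] assms by simp
  show ?thesis
  proof (rule Bochner_Integration.integrable_bound[OF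
        Bochner_Integration.integrable_add[OF Bochner_Integration.integrable_add[OF * **] ***]])
    show "AE t in lborel. norm ((1 + t\<^sup>2) powr - a)
        \<le> norm (indicat_real {1..} t *\<^sub>R t powr (- 2 * a) + indicat_real {1..} (- t) *\<^sub>R (- t) powr (- 2 * a) + indicat_real {- 1..1} t)"
    proof (intro always_eventually allI)
      fix t :: real
      consider "t \<ge> 1" | "t \<le> -1" | "\<bar>t\<bar> < 1" by linarith
      then show "norm ((1 + t\<^sup>2) powr - a)
        \<le> norm (indicat_real {1..} t *\<^sub>R t powr (- 2 * a) + indicat_real {1..} (- t) *\<^sub>R (- t) powr (- 2 * a) + indicat_real {- 1..1} t)"
        using le[of t] le1[of t] by cases (auto simp: indicator_def)
    qed
  qed measurable
qed

lemma integrable_lborel_prod: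
  fixes f :: "real \<Rightarrow> real"
  assumes f: "integrable lborel f" and nn: "\<And>t. 0 \<le> f t"
  shows "integrable lborel (\<lambda>x::'a::euclidean_space. \<Prod>b\<in>Basis. f (x \<bullet> b))"
proof (rule integrableI_bounded)
  have [measurable]: "f \<in> borel_measurable borel" using f by (simp add: borel_measurable_integrable)
  show "(\<lambda>x::'a. \<Prod>b\<in>Basis. f (x \<bullet> b)) \<in> borel_measurable lborel" by measurable
  have "(\<integral>\<^sup>+ x. ennreal (norm (\<Prod>b\<in>Basis. f ((x::'a) \<bullet> b))) \<partial>lborel)
     = (\<integral>\<^sup>+ x. (\<Prod>b\<in>Basis. ennreal (f ((x::'a) \<bullet> b))) \<partial>lborel)"
    by (intro nn_integral_cong) (simp add: prod_ennreal nn prod_nonneg)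
  also have "\<dots> = (\<Prod>b\<in>(Basis::'a set). (\<integral>\<^sup>+x. ennreal (f x) \<partial>lborel))"
    by (rule nn_integral_lborel_prod) auto
  also have "\<dots> < \<infinity>"
    using f nn by (simp add: nn_integral_eq_integral power_less_top_ennreal)
  finally show "(\<integral>\<^sup>+ x. ennreal (norm (\<Prod>b\<in>Basis. f ((x::'a) \<bullet> b))) \<partial>lborel) < \<infinity>" .
qed

lemma AE_all_components_nonzero:
  "AE x in lborel. \<forall>b\<in>Basis. (x::'a::euclidean_space) \<bullet> b \<noteq> 0"
proof -
  have "AE x in lborel. (x::'a) \<bullet> b \<noteq> 0" if "b \<in> Basis" for b
  proof -
    have "negligible {x::'a. x \<bullet> b = 0}"
      using negligible_standard_hyperplane[OF that] by simp
    moreover have "{x::'a. x \<bullet> b = 0} \<in> sets borel" by measurable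
    ultimately have "emeasure lborel {x::'a. x \<bullet> b = 0} = 0"
      by (simp add: negligible_iff_emeasure0 emeasure_completion)
    then show ?thesis
      by (intro AE_I[where N="{x::'a. x \<bullet> b = 0}"]) auto
  qed
  then show ?thesis by (simp add: AE_finite_all)
qed

text \<open>No polar coordinates: since |x . b| \<le> |x| for each basis vector b, splitting
  |x|^(-s) into n equal factors bounds it by the product of the |x . b|^(-s/n), and each exponent
  s/n is below 1.\<close>

lemma integrable_norm_powr_unit_ball:
  fixes s :: real
  assumes "0 \<le> s" "s < DIM('a)"
  shows "integrable lborel (\<lambda>x::'a::euclidean_space. norm x powr (-s) * indicator (ball 0 1) x)"
proof -
  define n where "n = real DIM('a)"
  have n: "n > 0" by (simp add: n_def)
  have [measurable]: "ball (0::'a) 1 \<in> sets borel" by simp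
  have "integrable lborel (\<lambda>x::'a. \<Prod>b\<in>Basis. \<bar>x \<bullet> b\<bar> powr (-(s/n)) * indicator {-1..1} (x \<bullet> b))"
    using n assms by (intro integrable_lborel_prod integrable_abs_powr_unit) (auto simp: n_def)
  then show ?thesis
  proof (rule Bochner_Integration.integrable_bound)
    show "AE x::'a in lborel. norm (norm x powr - s * indicat_real (ball 0 1) x)
      \<le> norm (\<Prod>b\<in>Basis. \<bar>x \<bullet> b\<bar> powr - (s / n) * indicat_real {- 1..1} (x \<bullet> b))"
      using AE_all_components_nonzero
    proof eventually_elim
      case (elim x)
      show ?case
      proof (cases "norm x < 1")
        case True
        have le: "\<bar>x \<bullet> b\<bar> \<le> norm x" if "b \<in> Basis" for b using Basis_le_norm[OF that] .
        have "x \<noteq> 0" using elim by (metis inner_zero_left SOME_Basis)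
        have "norm x powr - s = (\<Prod>b\<in>(Basis::'a set). norm x powr (-(s/n)))"
          using \<open>x \<noteq> 0\<close> n by (simp add: powr_powr n_def flip: powr_realpow)
        also have "\<dots> \<le> (\<Prod>b\<in>Basis. \<bar>x \<bullet> b\<bar> powr - (s / n) * indicat_real {- 1..1} (x \<bullet> b))"
        proof (intro prod_mono conjI)
          fix b :: 'a assume b: "b \<in> Basis"
          have "indicat_real {- 1..1} (x \<bullet> b) = 1" using le[OF b] True by (auto simp: indicator_def)
          moreover have "norm x powr - (s / n) \<le> \<bar>x \<bullet> b\<bar> powr - (s / n)"
            using elim b le[OF b] assms n by (intro powr_mono2') auto
          ultimately show "norm x powr - (s / n) \<le> \<bar>x \<bullet> b\<bar> powr - (s / n) * indicat_real {- 1..1} (x \<bullet> b)"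
            by simp
        qed auto
        finally have "norm x powr - s \<le> \<bar>\<Prod>b\<in>Basis. \<bar>x \<bullet> b\<bar> powr - (s / n) * indicat_real {- 1..1} (x \<bullet> b)\<bar>"
          by linarith
        then show ?thesis using True by simp
      qed (simp add: indicator_def)
    qed
  qed measurable
qed

text \<open>The same splitting at infinity: 1 + |x|^2 dominates each 1 + (x . b)^2, and the
  one-dimensional exponent q/n exceeds 1/2.\<close>

lemma integrable_one_plus_norm_sq_powr:
  fixes q :: real
  assumes "2 * q > DIM('a)"
  shows "integrable lborel (\<lambda>x::'a::euclidean_space. (1 + (norm x)\<^sup>2) powr (-q))"
proof -
  define n where "n = real DIM('a)"
  have n: "n > 0" by (simp add: n_def)
  have q: "q > 0" using assms n unfolding n_def by linarith
  have "integrable lborel (\<lambda>x::'a. \<Prod>b\<in>Basis. (1 + (x \<bullet> b)\<^sup>2) powr (-(q/n)))"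
    using n assms by (intro integrable_lborel_prod integrable_one_plus_sq_powr) (auto simp: n_def field_simps)
  then show ?thesis
  proof (rule Bochner_Integration.integrable_bound)
    show "AE x::'a in lborel. norm ((1 + (norm x)\<^sup>2) powr - q)
      \<le> norm (\<Prod>b\<in>Basis. (1 + (x \<bullet> b)\<^sup>2) powr - (q / n))"
    proof (intro always_eventually allI)
      fix x :: 'a
      have pos: "1 + t\<^sup>2 > 0" for t :: real by (simp add: add_pos_nonneg)
      have "(1 + (norm x)\<^sup>2) powr - q = (\<Prod>b\<in>(Basis::'a set). (1 + (norm x)\<^sup>2) powr (-(q/n)))"
        using n pos[of "norm x"] by (simp add: powr_powr n_def flip: powr_realpow)
      also have "\<dots> \<le> (\<Prod>b\<in>Basis. (1 + (x \<bullet> b)\<^sup>2) powr - (q / n))"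
      proof (intro prod_mono conjI)
        fix b :: 'a assume b: "b \<in> Basis"
        have "(x \<bullet> b)\<^sup>2 \<le> (norm x)\<^sup>2" using Basis_le_norm[OF b, of x] by (metis abs_norm_cancel abs_le_square_iff)
        then show "(1 + (norm x)\<^sup>2) powr - (q / n) \<le> (1 + (x \<bullet> b)\<^sup>2) powr - (q / n)"
          using pos q n by (intro powr_mono2') auto
      qed auto
      finally show "norm ((1 + (norm x)\<^sup>2) powr - q)
      \<le> norm (\<Prod>b\<in>Basis. (1 + (x \<bullet> b)\<^sup>2) powr - (q / n))" by simp
    qed
  qed measurable
qed

lemma norm_power_le_one_plus_sq: "norm x ^ k \<le> (1 + (norm x)\<^sup>2) ^ k"
proof (rule power_mono)
  show "norm x \<le> 1 + (norm x)\<^sup>2"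
    using sum_squares_bound[of "norm x" 1] zero_le_power2[of "norm x"] norm_ge_zero[of x]
    by (simp only: power_one)
qed simp

lemma norm_diff_sq_le:
  fixes x y :: "'a::real_normed_vector"
  shows "(norm (x - y))\<^sup>2 \<le> (2 + 2 * (norm y)\<^sup>2) * (1 + (norm x)\<^sup>2)"
proof -
  have "(norm (x - y))\<^sup>2 \<le> (norm x + norm y)\<^sup>2" by (intro power_mono norm_triangle_ineq4) auto
  also have "\<dots> \<le> 2 * (norm x)\<^sup>2 + 2 * (norm y)\<^sup>2"
    using sum_squares_bound[of "norm x" "norm y"] by (simp add: power2_sum)
  also have "\<dots> \<le> (2 + 2 * (norm y)\<^sup>2) * (1 + (norm x)\<^sup>2)"
  proof -
    have "(2 + 2 * (norm y)\<^sup>2) * (1 + (norm x)\<^sup>2)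
        = 2 + 2 * (norm x)\<^sup>2 + 2 * (norm y)\<^sup>2 + 2 * ((norm y)\<^sup>2 * (norm x)\<^sup>2)"
      by (simp add: algebra_simps)
    moreover have "(norm y)\<^sup>2 * (norm x)\<^sup>2 \<ge> 0" by simp
    ultimately show ?thesis by linarith
  qed
  finally show ?thesis .
qed

lemma AE_lborel_neq: "AE x in lborel. x \<noteq> (c::'a::euclidean_space)"
  by (rule AE_I[where N="{c}"]) auto

lemma one_plus_power_le_exp:
  fixes t s :: real
  assumes "t > 0" "s \<ge> 0"
  shows "(1 + s) ^ N \<le> (real (Suc N) / t) ^ N * exp t * exp (t * s)"
proof -
  \<comment> \<open>From y \<le> exp y comes y^N \<le> exp(N y), and N y \<le> t (1 + s). Dividing
    by \<open>Suc N\<close> instead of N keeps the case N = 0 meaningful.\<close>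
  define y where "y = t * (1 + s) / real (Suc N)"
  have y: "y \<ge> 0" using assms by (simp add: y_def)
  have "(1 + s) ^ N = (real (Suc N) / t) ^ N * y ^ N"
    using assms by (simp add: y_def power_divide power_mult_distrib)
  also have "y ^ N \<le> exp y ^ N"
    using y exp_ge_add_one_self[of y] by (intro power_mono) linarith+
  also have "exp y ^ N = exp (real N * y)" by (simp add: exp_of_nat_mult)
  also have "\<dots> \<le> exp (t * (1 + s))"
    using y assms by (simp add: y_def field_simps)
  also have "\<dots> = exp t * exp (t * s)" by (simp add: distrib_left exp_add)
  finally show ?thesis using assms by (simp add: mult_left_mono mult.assoc)
qed

lemma integrable_weighted_gaussian:
  fixes t :: real
  assumes t: "t > 0"
  shows "integrable lborel (\<lambda>x::'a::euclidean_space. (1 + (norm x)\<^sup>2) ^ j * exp (- t * (norm x)\<^sup>2))"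
proof -
  define n where "n = DIM('a)"
  have n: "n > 0" by (simp add: n_def)
  define C where "C = (real (Suc (j + n)) / t) ^ (j + n) * exp t"
  have "integrable lborel (\<lambda>x::'a. C * (1 + (norm x)\<^sup>2) powr (- real n))"
    using n by (intro integrable_mult_right integrable_one_plus_norm_sq_powr) (simp add: n_def)
  then show ?thesis
  proof (rule Bochner_Integration.integrable_bound)
    show "AE x::'a in lborel. norm ((1 + (norm x)\<^sup>2) ^ j * exp (- t * (norm x)\<^sup>2))
            \<le> norm (C * (1 + (norm x)\<^sup>2) powr - real n)"
    proof (intro always_eventually allI)
      fix x :: 'a
      define s where "s = (norm x)\<^sup>2"
      have s: "s \<ge> 0" by (simp add: s_def)
      have "(1 + s) ^ (j + n) \<le> C * exp (t * s)"
        using one_plus_power_le_exp[OF t s, of "j + n"] by (simp add: C_def)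
      then have "(1 + s) ^ (j + n) * exp (- t * s) \<le> C * exp (t * s) * exp (- t * s)"
        by (intro mult_right_mono) auto
      also have "\<dots> = C" by (simp add: mult.assoc flip: exp_add)
      finally have "(1 + s) ^ j * exp (- t * s) * (1 + s) ^ n \<le> C"
        by (simp add: power_add mult_ac)
      then have "(1 + s) ^ j * exp (- t * s) \<le> C * (1 + s) powr (- real n)"
        using s by (simp add: powr_minus powr_realpow field_simps)
      then show "norm ((1 + (norm x)\<^sup>2) ^ j * exp (- t * (norm x)\<^sup>2)) \<le> norm (C * (1 + (norm x)\<^sup>2) powr - real n)"
        using s t by (simp add: s_def C_def abs_mult)
    qed
  qed measurable
qed

lemma integrable_gaussian:
  "t > 0 \<Longrightarrow> integrable lborel (\<lambda>x::'a::euclidean_space. exp (- t * (norm x)\<^sup>2))"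
  using integrable_weighted_gaussian[of t 0, where 'a='a] by simp

lemma lborel_integral_shift:
  fixes f :: "'a::euclidean_space \<Rightarrow> 'b::{banach, second_countable_topology}"
  assumes [measurable]: "f \<in> borel_measurable borel"
  shows "(LINT x|lborel. f (x + c)) = (LINT x|lborel. f x)"
    and "integrable lborel (\<lambda>x. f (x + c)) \<longleftrightarrow> integrable lborel f"
proof -
  have d: "distr lborel borel (\<lambda>x::'a. x + c) = lborel"
    using lborel_distr_plus[of c] by (simp add: add.commute[of _ c])
  have "(LINT x|lborel. f x) = (LINT x|distr lborel borel (\<lambda>x. x + c). f x)" using d by simp
  also have "\<dots> = (LINT x|lborel. f (x + c))" by (rule integral_distr) auto
  finally show "(LINT x|lborel. f (x + c)) = (LINT x|lborel. f x)" by simp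
  have "integrable lborel f = integrable (distr lborel borel (\<lambda>x. x + c)) f" using d by simp
  also have "\<dots> = integrable lborel (\<lambda>x. f (x + c))" by (rule integrable_distr_eq) auto
  finally show "integrable lborel (\<lambda>x. f (x + c)) \<longleftrightarrow> integrable lborel f" by simp
qed

lemma lborel_nn_integral_shift:
  fixes f :: "'a::euclidean_space \<Rightarrow> ennreal"
  assumes [measurable]: "f \<in> borel_measurable borel"
  shows "(\<integral>\<^sup>+x. f (x + c) \<partial>lborel) = (\<integral>\<^sup>+x. f x \<partial>lborel)"
proof -
  have d: "distr lborel borel (\<lambda>x::'a. x + c) = lborel"
    using lborel_distr_plus[of c] by (simp add: add.commute[of _ c])
  have "(\<integral>\<^sup>+x. f x \<partial>lborel) = (\<integral>\<^sup>+x. f x \<partial>distr lborel borel (\<lambda>x. x + c))" using d by simp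
  also have "\<dots> = (\<integral>\<^sup>+x. f (x + c) \<partial>lborel)" by (rule nn_integral_distr) auto
  finally show ?thesis by simp
qed

lemma lborel_integral_reflect:
  fixes f :: "'a::euclidean_space \<Rightarrow> 'b::{banach, second_countable_topology}"
  assumes [measurable]: "f \<in> borel_measurable borel"
  shows "(LINT x|lborel. f (c - x)) = (LINT x|lborel. f x)"
    and "integrable lborel (\<lambda>x. f (c - x)) \<longleftrightarrow> integrable lborel f"
proof -
  have d: "distr lborel borel (\<lambda>x::'a. c - x) = lborel"
    using lborel_affine[of "-1" c] by (simp add: density_1)
  have "(LINT x|lborel. f x) = (LINT x|distr lborel borel (\<lambda>x. c - x). f x)" using d by simp
  also have "\<dots> = (LINT x|lborel. f (c - x))" by (rule integral_distr) auto
  finally show "(LINT x|lborel. f (c - x)) = (LINT x|lborel. f x)" by simp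
  have "integrable lborel f = integrable (distr lborel borel (\<lambda>x. c - x)) f" using d by simp
  also have "\<dots> = integrable lborel (\<lambda>x. f (c - x))" by (rule integrable_distr_eq) auto
  finally show "integrable lborel (\<lambda>x. f (c - x)) \<longleftrightarrow> integrable lborel f" by simp
qed

section \<open>The logarithm as a mixture of Gaussians\<close>

lemma nn_integral_exp_inverse:
  fixes u :: real
  assumes u: "u > 0"
  shows "(\<integral>\<^sup>+s. ennreal (exp (- u / s) / s\<^sup>2) * indicator {0..} s \<partial>lborel) = ennreal (1 / u)"
proof -
  \<comment> \<open>The antiderivative extended by 0, because the fundamental theorem is applied on
    the closed half-line. At s = 0 the integrand is 0 by the convention for division by zero, which
    agrees with the derivative 0 of \<open>F\<close> there.\<close>
  define F where "F s = (if s \<le> 0 then 0 else exp (- u / s) / u)" for s :: real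
  have der0: "(F has_real_derivative 0) (at 0)"
  proof -
    have "((\<lambda>h. (F (0 + h) - F 0) / h) \<longlongrightarrow> 0) (at_right 0)"
    proof (rule Lim_transform_eventually)
      show "((\<lambda>h. exp (- u / h) / u / h) \<longlongrightarrow> 0) (at_right 0)" using u by real_asymp
      show "\<forall>\<^sub>F h in at_right 0. exp (- u / h) / u / h = (F (0 + h) - F 0) / h"
        using eventually_at_right_less[of "0::real"] by eventually_elim (auto simp: F_def)
    qed
    moreover have "((\<lambda>h. (F (0 + h) - F 0) / h) \<longlongrightarrow> 0) (at_left 0)"
    proof (rule Lim_transform_eventually[OF tendsto_const])
      show "\<forall>\<^sub>F h in at_left 0. 0 = (F (0 + h) - F 0) / h"
      proof -
        have "\<forall>\<^sub>F h in at_left (0::real). h < 0" by (auto simp: eventually_at_filter)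
        then show ?thesis by eventually_elim (simp add: F_def)
      qed
    qed
    ultimately have "((\<lambda>h. (F (0 + h) - F 0) / h) \<longlongrightarrow> 0) (at 0)" by (simp add: filterlim_at_split)
    then show ?thesis by (simp add: DERIV_def)
  qed
  have der: "(F has_real_derivative (exp (- u / s) / s\<^sup>2)) (at s)" if "s \<ge> 0" for s
  proof (cases "s = 0")
    case False
    then have s: "s > 0" using that by simp
    have "((\<lambda>s. exp (- u / s) / u) has_real_derivative (exp (- u / s) / s\<^sup>2)) (at s)"
      using s u by (auto intro!: derivative_eq_intros simp: field_simps power2_eq_square)
    then show ?thesis
      by (rule has_field_derivative_transform_within_open[of _ _ _ "{0<..}"]) (use s in \<open>auto simp: F_def\<close>)
  qed (use der0 in simp)
  have lim: "(F \<longlongrightarrow> 1 / u) at_top"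
  proof (rule Lim_transform_eventually)
    have "((\<lambda>s. exp (- u / s) / u) \<longlongrightarrow> inverse u) at_top" using u by real_asymp
    then show "((\<lambda>s. exp (- u / s) / u) \<longlongrightarrow> 1 / u) at_top" by (simp add: inverse_eq_divide)
    show "\<forall>\<^sub>F s in at_top. exp (- u / s) / u = F s"
      using eventually_gt_at_top[of "0::real"] by eventually_elim (simp add: F_def)
  qed
  have "(\<integral>\<^sup>+s. ennreal (exp (- u / s) / s\<^sup>2) * indicator {0..} s \<partial>lborel) = ennreal (1 / u - F 0)"
    by (rule nn_integral_FTC_atLeast) (use der lim in auto)
  then show ?thesis by (simp add: F_def)
qed

text \<open>The difference quotient is the integral of exp(-u/s)/s^2 over u in [a, b]; exchanging
  the order leaves the integral of 1/u. Nonnegativity lets the exchange take place in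
  \<open>ennreal\<close>.\<close>

lemma frullani:
  fixes a b :: real
  assumes "0 < a" "a \<le> b"
  shows "has_bochner_integral lborel (\<lambda>s. indicator {0<..} s * ((exp (- a / s) - exp (- b / s)) / s)) (ln b - ln a)"
proof -
  let ?f = "\<lambda>s::real. indicator {0<..} s * ((exp (- a / s) - exp (- b / s)) / s)"
  have inner1: "(\<integral>\<^sup>+u. ennreal (exp (- u / s) / s\<^sup>2) * indicator {a..b} u \<partial>lborel) = ennreal ((exp (- a / s) - exp (- b / s)) / s)"
    if "s > 0" for s
  proof -
    have "(\<integral>\<^sup>+u. ennreal (exp (- u / s) / s\<^sup>2) * indicator {a..b} u \<partial>lborel)
        = ennreal (- exp (- b / s) / s - (- exp (- a / s) / s))"
      by (rule nn_integral_FTC_Icc) (use that assms in \<open>auto intro!: derivative_eq_intros simp: power2_eq_square\<close>)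
    then show ?thesis by (simp add: diff_divide_distrib)
  qed
  have nn: "0 \<le> ?f s" for s using assms by (auto simp: indicator_def divide_right_mono)
  have "(\<integral>\<^sup>+s. ennreal (?f s) \<partial>lborel)
      = (\<integral>\<^sup>+s. (\<integral>\<^sup>+u. ennreal (exp (- u / s) / s\<^sup>2) * indicator {a..b} u * indicator {0..} s \<partial>lborel) \<partial>lborel)"
  proof (rule nn_integral_cong_AE)
    show "AE s in lborel. ennreal (?f s) = (\<integral>\<^sup>+u. ennreal (exp (- u / s) / s\<^sup>2) * indicator {a..b} u * indicator {0..} s \<partial>lborel)"
      using AE_lborel_singleton[of "0::real"]
    proof eventually_elim
      case (elim s)
      show ?case
      proof (cases "s > 0")
        case True
        then show ?thesis using inner1[of s] by simp
      next
        case False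
        then show ?thesis using elim by simp
      qed
    qed
  qed
  also have "\<dots> = (\<integral>\<^sup>+u. (\<integral>\<^sup>+s. ennreal (exp (- u / s) / s\<^sup>2) * indicator {a..b} u * indicator {0..} s \<partial>lborel) \<partial>lborel)"
    by (rule lborel_pair.Fubini'[symmetric]) measurable
  also have "\<dots> = (\<integral>\<^sup>+u. ennreal (1 / u) * indicator {a..b} u \<partial>lborel)"
  proof (rule nn_integral_cong)
    fix u :: real
    show "(\<integral>\<^sup>+s. ennreal (exp (- u / s) / s\<^sup>2) * indicator {a..b} u * indicator {0..} s \<partial>lborel) = ennreal (1 / u) * indicator {a..b} u"
      using nn_integral_exp_inverse[of u] assms by (cases "u \<in> {a..b}") auto
  qed
  also have "\<dots> = ennreal (ln b - ln a)"
    by (rule nn_integral_FTC_Icc) (use assms in \<open>auto intro!: derivative_eq_intros simp: field_simps\<close>)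
  finally have "(\<integral>\<^sup>+s. ennreal (?f s) \<partial>lborel) = ennreal (ln b - ln a)" .
  then show ?thesis
    using assms nn by (intro has_bochner_integral_nn_integral) auto
qed

text \<open>The integrand that represents ln r over s > 0, namely Frullani with endpoints 1/4 and
  r^2/4, halved. The scaling 4s is that of the heat kernel at time s, so that integration against a
  function produces its heat flow.\<close>

definition logker :: "real \<Rightarrow> real \<Rightarrow> real" where
  "logker r s = indicator {0<..} s * ((exp (- (1 / (4 * s))) - exp (- (1 / (4 * s)) * r\<^sup>2)) / (2 * s))"

lemma measurable_logker[measurable]:
  "(\<lambda>x. logker (f x) (g x)) \<in> borel_measurable M" if [measurable]: "f \<in> borel_measurable M" "g \<in> borel_measurable M"
  unfolding logker_def by measurable

text \<open>For fixed r the integrand has one sign in s, that of ln r. Hence the absolute value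
  integrates to |ln r| as well, and Fubini costs no more than integrability of the
  logarithm.\<close>

lemma logker_integral:
  assumes "r > 0"
  shows "has_bochner_integral lborel (logker r) (ln r)"
    and "has_bochner_integral lborel (\<lambda>t. \<bar>logker r t\<bar>) \<bar>ln r\<bar>"
proof -
  have *: "has_bochner_integral lborel (logker r) (ln r) \<and> has_bochner_integral lborel (\<lambda>t. \<bar>logker r t\<bar>) \<bar>ln r\<bar>"
  proof (cases "r \<ge> 1")
    case True
    have l: "logker r t = 1/2 * (indicator {0<..} t * ((exp (- (1/4) / t) - exp (- (r\<^sup>2 / 4) / t)) / t))" for t
      by (simp add: logker_def)
    have nn: "\<bar>logker r t\<bar> = logker r t" for t
      unfolding l using True by (auto simp: indicator_def divide_right_mono)
    have "has_bochner_integral lborel (logker r) (1/2 * (ln (r\<^sup>2 / 4) - ln (1/4)))"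
      unfolding l using frullani[of "1/4" "r\<^sup>2 / 4"] True by (intro has_bochner_integral_mult_right) auto
    then have "has_bochner_integral lborel (logker r) (ln r)" using assms by (simp add: ln_realpow ln_div)
    then show ?thesis unfolding nn using True by (simp)
  next
    case False
    have l: "logker r t = - (1/2) * (indicator {0<..} t * ((exp (- (r\<^sup>2 / 4) / t) - exp (- (1/4) / t)) / t))" for t
      by (cases "t > 0") (simp_all add: logker_def field_simps)
    have r2: "r\<^sup>2 \<le> 1" "r\<^sup>2 > 0" using False assms by (auto simp: power_le_one)
    have nn: "\<bar>logker r t\<bar> = - logker r t" for t
      unfolding l using r2 by (auto simp: indicator_def divide_right_mono)
    have "has_bochner_integral lborel (logker r) (- (1/2) * (ln (1/4) - ln (r\<^sup>2 / 4)))"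
      unfolding l using frullani[of "r\<^sup>2 / 4" "1/4"] r2 by (intro has_bochner_integral_mult_right) auto
    then have h: "has_bochner_integral lborel (logker r) (ln r)" using assms by (simp add: ln_realpow ln_div)
    have "\<bar>ln r\<bar> = - ln r" using False assms by simp
    then show ?thesis unfolding nn using h has_bochner_integral_minus[OF h] by simp
  qed
  show "has_bochner_integral lborel (logker r) (ln r)"
    and "has_bochner_integral lborel (\<lambda>t. \<bar>logker r t\<bar>) \<bar>ln r\<bar>" using * by auto
qed

lemma nn_integral_abs_logker:
  "r > 0 \<Longrightarrow> (\<integral>\<^sup>+t. ennreal \<bar>logker r t\<bar> \<partial>lborel) = ennreal \<bar>ln r\<bar>"
  using logker_integral(2)[of r] by (simp add: has_bochner_integral_iff nn_integral_eq_integral)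

section \<open>Negativity of the logarithmic energy on mean-zero densities\<close>

lemma integrable_pair_mult:
  fixes f :: "'a \<Rightarrow> real" and g :: "'b \<Rightarrow> real"
  assumes "finite_measure M1" "finite_measure M2" and f: "integrable M1 f" and g: "integrable M2 g"
  shows "integrable (M1 \<Otimes>\<^sub>M M2) (\<lambda>p. f (fst p) * g (snd p))"
proof -
  interpret M1: finite_measure M1 by fact
  interpret M2: finite_measure M2 by fact
  note [measurable] = borel_measurable_integrable[OF f] borel_measurable_integrable[OF g]
  have "(\<integral>\<^sup>+x. \<integral>\<^sup>+y. ennreal (norm (f x * g y)) \<partial>M2 \<partial>M1)
      = (\<integral>\<^sup>+x. ennreal (norm (f x)) * (\<integral>\<^sup>+y. ennreal (norm (g y)) \<partial>M2) \<partial>M1)"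
    by (intro nn_integral_cong) (simp add: abs_mult ennreal_mult nn_integral_cmult)
  also have "\<dots> = (\<integral>\<^sup>+x. ennreal (norm (f x)) \<partial>M1) * (\<integral>\<^sup>+y. ennreal (norm (g y)) \<partial>M2)"
    by (simp add: nn_integral_multc)
  also have "\<dots> < \<infinity>"
    using f g by (simp add: integrable_iff_bounded ennreal_mult_less_top)
  finally show ?thesis
    by (intro pair_integrableI) (auto simp: M1.sigma_finite_measure_axioms M2.sigma_finite_measure_axioms)
qed

text \<open>The parallelogram identity: twice the squared distances of z to x and to y make |x -
  y|^2 plus four times the squared distance of z to the midpoint. The second factor therefore has an
  integral over z independent of x and y.\<close>

lemma gaussian_product:
  fixes x y z :: "'a::real_inner"
  shows "exp (- (2*t) * (norm (x - z))\<^sup>2) * exp (- (2*t) * (norm (y - z))\<^sup>2)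
       = exp (- t * (norm (x - y))\<^sup>2) * exp (- (4*t) * (norm (z + (- (x + y) /\<^sub>R 2)))\<^sup>2)"
proof -
  have "- (2*t) * (norm (x - z))\<^sup>2 + (- (2*t) * (norm (y - z))\<^sup>2)
       = - t * (norm (x - y))\<^sup>2 + (- (4*t) * (norm (z + (- (x + y) /\<^sub>R 2)))\<^sup>2)"
    by (simp add: power2_norm_eq_inner inner_diff_left inner_diff_right inner_add_left inner_add_right
        inner_commute field_simps)
  then show ?thesis by (simp flip: exp_add)
qed

text \<open>By \<open>gaussian_product\<close> the kernel is, up to the positive constant
  \<open>c\<close>, the integral over z of a product of a function of (x, z) with the same function
  of (y, z). The quadratic form becomes an integral of squares.\<close>

lemma gaussian_kernel_nonneg:
  fixes \<mu> :: "'a::euclidean_space measure" and g :: "'a \<Rightarrow> real"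
  assumes "finite_measure \<mu>" and sets: "sets \<mu> = sets borel" and g: "integrable \<mu> g" and t: "t > 0"
  shows "0 \<le> (LINT p|(\<mu> \<Otimes>\<^sub>M \<mu>). g (fst p) * g (snd p) * exp (- t * (norm (fst p - snd p))\<^sup>2))"
proof -
  interpret finite_measure \<mu> by fact
  interpret P: pair_sigma_finite \<mu> \<mu> ..
  note [measurable_cong] = sets
  have [measurable]: "g \<in> borel_measurable borel"
    using borel_measurable_integrable[OF g] by (simp add: measurable_def sets space_borel sets_eq_imp_space_eq[OF sets])
  define c where "c = (LINT z::'a|lborel. exp (- (4*t) * (norm z)\<^sup>2))"
  have c: "c > 0"
  proof -
    have i: "integrable lborel (\<lambda>z::'a. exp (- (4*t) * (norm z)\<^sup>2))" by (rule integrable_gaussian) (use t in simp)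
    have "c \<noteq> 0"
    proof
      assume "c = 0"
      then have "AE z::'a in lborel. exp (- (4*t) * (norm z)\<^sup>2) = 0"
        unfolding c_def by (subst (asm) integral_nonneg_eq_0_iff_AE[OF i]) auto
      then have "AE z::'a in lborel. False" by simp
      then show False by (simp add: AE_iff_measurable[OF _ refl] emeasure_lborel_UNIV)
    qed
    moreover have "c \<ge> 0" unfolding c_def by (rule integral_nonneg_AE) auto
    ultimately show ?thesis by simp
  qed
  let ?e = "\<lambda>x z::'a. exp (- (2*t) * (norm (x - z))\<^sup>2)"
  have gi: "(LINT z|lborel. ?e x z * ?e y z) = exp (- t * (norm (x - y))\<^sup>2) * c" for x y
    unfolding gaussian_product c_def
    by (subst integral_mult_right_zero, subst lborel_integral_shift(1)[where f="\<lambda>z. exp (- (4*t) * (norm z)\<^sup>2)"]) auto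
  have ii: "integrable lborel (\<lambda>z. ?e x z * ?e y z)" for x y
    unfolding gaussian_product
    by (intro integrable_mult_right, subst lborel_integral_shift(2)[where f="\<lambda>z. exp (- (4*t) * (norm z)\<^sup>2)"])
      (use t integrable_gaussian[of "4*t", where 'a='a] in auto)
  let ?F = "\<lambda>p z. g (fst p) * g (snd p) * (?e (fst p) z * ?e (snd p) z)"
  have gg: "integrable (\<mu> \<Otimes>\<^sub>M \<mu>) (\<lambda>p. g (fst p) * g (snd p))"
    using integrable_pair_mult[OF finite_measure_axioms finite_measure_axioms g g] by (simp add: case_prod_beta')
  have fin: "(\<integral>\<^sup>+p. \<integral>\<^sup>+z. ennreal (norm (?F p z)) \<partial>lborel \<partial>(\<mu> \<Otimes>\<^sub>M \<mu>)) < \<infinity>"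
  proof -
    have "(\<integral>\<^sup>+z. ennreal (norm (?F p z)) \<partial>lborel) \<le> ennreal (\<bar>g (fst p) * g (snd p)\<bar> * c)" for p
    proof -
      have "(\<integral>\<^sup>+z. ennreal (norm (?F p z)) \<partial>lborel)
         = ennreal \<bar>g (fst p) * g (snd p)\<bar> * (\<integral>\<^sup>+z. ennreal (?e (fst p) z * ?e (snd p) z) \<partial>lborel)"
        by (subst nn_integral_cmult[symmetric]) (auto simp: abs_mult ennreal_mult)
      also have "\<dots> = ennreal \<bar>g (fst p) * g (snd p)\<bar> * ennreal (exp (- t * (norm (fst p - snd p))\<^sup>2) * c)"
        using gi[of "fst p" "snd p"] by (subst nn_integral_eq_integral[OF ii]) auto
      also have "\<dots> \<le> ennreal (\<bar>g (fst p) * g (snd p)\<bar> * c)"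
        using c t by (subst ennreal_mult[symmetric]) (auto intro!: ennreal_leI mult_left_mono mult_left_le_one_le)
      finally show ?thesis .
    qed
    then have "(\<integral>\<^sup>+p. \<integral>\<^sup>+z. ennreal (norm (?F p z)) \<partial>lborel \<partial>(\<mu> \<Otimes>\<^sub>M \<mu>))
       \<le> (\<integral>\<^sup>+p. ennreal (\<bar>g (fst p) * g (snd p)\<bar> * c) \<partial>(\<mu> \<Otimes>\<^sub>M \<mu>))"
      by (intro nn_integral_mono)
    also have "\<dots> < \<infinity>"
      using c by (subst nn_integral_eq_integral) (auto intro!: integrable_mult_left integrable_abs gg)
    finally show ?thesis .
  qed
  have "c * (LINT p|(\<mu> \<Otimes>\<^sub>M \<mu>). g (fst p) * g (snd p) * exp (- t * (norm (fst p - snd p))\<^sup>2))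
     = (LINT p|(\<mu> \<Otimes>\<^sub>M \<mu>). LINT z|lborel. ?F p z)"
    by (subst integral_mult_right_zero[symmetric], intro Bochner_Integration.integral_cong refl)
       (subst integral_mult_right_zero, subst gi, simp)
  also have "\<dots> = (LINT z|lborel. LINT p|(\<mu> \<Otimes>\<^sub>M \<mu>). ?F p z)"
    by (rule fubini_swap(1)) (use fin in \<open>auto simp: P.sigma_finite_measure_axioms sigma_finite_lborel\<close>)
  also have "\<dots> = (LINT z|lborel. (LINT x|\<mu>. g x * ?e x z)\<^sup>2)"
  proof (rule Bochner_Integration.integral_cong[OF refl])
    fix z :: 'a
    have i: "integrable \<mu> (\<lambda>x. g x * ?e x z)"
      by (rule Bochner_Integration.integrable_bound[OF g]) (use t in \<open>auto simp: abs_mult mult_left_le\<close>)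
    have "(LINT p|(\<mu> \<Otimes>\<^sub>M \<mu>). ?F p z) = (LINT x|\<mu>. LINT y|\<mu>. (g x * ?e x z) * (g y * ?e y z))"
      using P.integral_fst'[OF integrable_pair_mult[OF finite_measure_axioms finite_measure_axioms i i], symmetric]
      by (simp add: mult_ac)
    then show "(LINT p|(\<mu> \<Otimes>\<^sub>M \<mu>). ?F p z) = (LINT x|\<mu>. g x * ?e x z)\<^sup>2"
      by (simp add: power2_eq_square)
  qed
  also have "\<dots> \<ge> 0" by (rule integral_nonneg_AE) auto
  finally show ?thesis using c by (simp add: zero_le_mult_iff)
qed

text \<open>For each s the kernel \<open>logker\<close> is a constant minus a Gaussian. The constant
  is annihilated by the zero mean of g, and the Gaussian part is nonnegative by
  \<open>gaussian_kernel_nonneg\<close>.\<close>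

lemma log_kernel_nonpos:
  fixes \<mu> :: "'a::euclidean_space measure" and g :: "'a \<Rightarrow> real"
  assumes "finite_measure \<mu>" and sets: "sets \<mu> = sets borel"
    and atomless: "\<And>x. emeasure \<mu> {x} = 0"
    and g: "integrable \<mu> g" and g0: "(LINT x|\<mu>. g x) = 0"
    and int: "integrable (\<mu> \<Otimes>\<^sub>M \<mu>) (\<lambda>p. g (fst p) * g (snd p) * ln (norm (fst p - snd p)))"
  shows "(LINT p|(\<mu> \<Otimes>\<^sub>M \<mu>). g (fst p) * g (snd p) * ln (norm (fst p - snd p))) \<le> 0"
proof -
  interpret finite_measure \<mu> by fact
  interpret P: pair_sigma_finite \<mu> \<mu> ..
  note [measurable_cong] = sets
  have [measurable]: "g \<in> borel_measurable borel"
    using borel_measurable_integrable[OF g] by (simp add: measurable_def sets space_borel sets_eq_imp_space_eq[OF sets])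
  have gg: "integrable (\<mu> \<Otimes>\<^sub>M \<mu>) (\<lambda>p. g (fst p) * g (snd p))"
    using integrable_pair_mult[OF finite_measure_axioms finite_measure_axioms g g] by (simp add: case_prod_beta')
  \<comment> \<open>On the diagonal \<open>ln 0 = 0\<close> disagrees with the divergent integral of
    \<open>logker 0\<close>; absence of atoms makes the diagonal a null set.\<close>
  have diag: "AE p in \<mu> \<Otimes>\<^sub>M \<mu>. fst p \<noteq> snd p"
  proof (rule P.AE_pair_measure)
    show "{p \<in> space (\<mu> \<Otimes>\<^sub>M \<mu>). fst p \<noteq> snd p} \<in> sets (\<mu> \<Otimes>\<^sub>M \<mu>)" by measurable
    show "AE x in \<mu>. AE y in \<mu>. fst (x, y) \<noteq> snd (x, y)"
    proof (rule AE_I2)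
      fix x
      show "AE y in \<mu>. fst (x, y) \<noteq> snd (x, y)"
        by (rule AE_I[where N="{x}"]) (auto simp: atomless sets)
    qed
  qed
  let ?F = "\<lambda>p t. g (fst p) * g (snd p) * logker (norm (fst p - snd p)) t"
  have fin: "(\<integral>\<^sup>+p. \<integral>\<^sup>+t. ennreal (norm (?F p t)) \<partial>lborel \<partial>(\<mu> \<Otimes>\<^sub>M \<mu>)) < \<infinity>"
  proof -
    have "(\<integral>\<^sup>+p. \<integral>\<^sup>+t. ennreal (norm (?F p t)) \<partial>lborel \<partial>(\<mu> \<Otimes>\<^sub>M \<mu>))
      = (\<integral>\<^sup>+p. ennreal (norm (g (fst p) * g (snd p) * ln (norm (fst p - snd p)))) \<partial>(\<mu> \<Otimes>\<^sub>M \<mu>))"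
      using diag
    proof (intro nn_integral_cong_AE, eventually_elim)
      case (elim p)
      have "(\<integral>\<^sup>+t. ennreal (norm (?F p t)) \<partial>lborel)
         = ennreal \<bar>g (fst p) * g (snd p)\<bar> * (\<integral>\<^sup>+t. ennreal \<bar>logker (norm (fst p - snd p)) t\<bar> \<partial>lborel)"
        by (subst nn_integral_cmult[symmetric]) (auto simp: abs_mult ennreal_mult)
      then show ?case using elim by (simp add: nn_integral_abs_logker abs_mult ennreal_mult)
    qed
    also have "\<dots> < \<infinity>" using int by (simp add: integrable_iff_bounded)
    finally show ?thesis .
  qed
  have "(LINT p|(\<mu> \<Otimes>\<^sub>M \<mu>). g (fst p) * g (snd p) * ln (norm (fst p - snd p)))
     = (LINT p|(\<mu> \<Otimes>\<^sub>M \<mu>). LINT t|lborel. ?F p t)"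
  proof (rule integral_cong_AE)
    show "AE p in \<mu> \<Otimes>\<^sub>M \<mu>. g (fst p) * g (snd p) * ln (norm (fst p - snd p)) = (LINT t|lborel. ?F p t)"
      using diag
    proof eventually_elim
      case (elim p)
      show ?case using logker_integral(1)[of "norm (fst p - snd p)"] elim
        by (simp add: has_bochner_integral_iff)
    qed
  qed measurable
  also have "\<dots> = (LINT t|lborel. LINT p|(\<mu> \<Otimes>\<^sub>M \<mu>). ?F p t)"
    by (rule fubini_swap(1)) (use fin in \<open>auto simp: P.sigma_finite_measure_axioms sigma_finite_lborel\<close>)
  also have "\<dots> \<le> 0"
  proof -
    have "(LINT p|(\<mu> \<Otimes>\<^sub>M \<mu>). ?F p t) \<le> 0" for t
    proof (cases "t > 0")
      case True
      have ie: "integrable (\<mu> \<Otimes>\<^sub>M \<mu>) (\<lambda>p. g (fst p) * g (snd p) * exp (- (1 / (4 * t)) * (norm (fst p - snd p))\<^sup>2))"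
        by (rule Bochner_Integration.integrable_bound[OF gg]) (use True in \<open>auto simp: abs_mult mult_left_le\<close>)
      have g2: "(LINT p|(\<mu> \<Otimes>\<^sub>M \<mu>). g (fst p) * g (snd p)) = 0"
        using P.integral_fst'[OF integrable_pair_mult[OF finite_measure_axioms finite_measure_axioms g g], symmetric]
        by (simp add: g0)
      have "(LINT p|(\<mu> \<Otimes>\<^sub>M \<mu>). ?F p t)
         = (LINT p|(\<mu> \<Otimes>\<^sub>M \<mu>). exp (- (1 / (4 * t))) / (2*t) * (g (fst p) * g (snd p)) - 1 / (2*t) * (g (fst p) * g (snd p) * exp (- (1 / (4 * t)) * (norm (fst p - snd p))\<^sup>2)))"
        using True by (intro Bochner_Integration.integral_cong) (auto simp: logker_def field_simps)
      also have "\<dots> = - (1 / (2*t) * (LINT p|(\<mu> \<Otimes>\<^sub>M \<mu>). g (fst p) * g (snd p) * exp (- (1 / (4 * t)) * (norm (fst p - snd p))\<^sup>2)))"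
        using gg ie g2 by simp
      also have "\<dots> \<le> 0"
        using True gaussian_kernel_nonneg[OF assms(1) sets g, of "1 / (4 * t)"] by simp
      finally show ?thesis .
    qed (simp add: logker_def)
    then have "0 \<le> (LINT t|lborel. - (LINT p|(\<mu> \<Otimes>\<^sub>M \<mu>). ?F p t))"
      by (intro integral_nonneg_AE) auto
    then show ?thesis by simp
  qed
  finally show ?thesis .
qed

section \<open>Equilibria of the logarithmic gas\<close>

text \<open>The tangent line at z lies below the convex function x ln x. The convention
  \<open>ln 0 = 0\<close> gives x ln x its correct value at 0.\<close>

lemma mult_ln_tangent:
  fixes x z :: real
  assumes "x \<ge> 0" "z > 0"
  shows "x * ln z + x - z \<le> x * ln x"
proof (cases "x = 0")
  case False
  then have "ln (z / x) \<le> z / x - 1" using assms by (intro ln_le_minus_one) auto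
  then have "x * (ln z - ln x) \<le> x * (z / x - 1)"
    using assms False by (intro mult_left_mono) (auto simp: ln_div)
  then show ?thesis using assms False by (simp add: algebra_simps)
qed (use assms in auto)

lemma mult_ln_convex:
  fixes a b t :: real
  assumes "a \<ge> 0" "b \<ge> 0" "0 \<le> t" "t \<le> 1"
  shows "((1 - t) * a + t * b) * ln ((1 - t) * a + t * b) \<le> (1 - t) * (a * ln a) + t * (b * ln b)"
proof -
  define z where "z = (1 - t) * a + t * b"
  have "z \<ge> 0" using assms by (simp add: z_def)
  show ?thesis
  proof (cases "z = 0")
    case True
    then have "(1 - t) * a = 0" "t * b = 0" using assms unfolding z_def
      by (metis add_nonneg_eq_0_iff diff_ge_0_iff_ge mult_nonneg_nonneg)+
    then have "(1 - t) * (a * ln a) = 0" "t * (b * ln b) = 0" by auto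
    moreover have "z * ln z = 0" using True by simp
    ultimately show ?thesis unfolding z_def[symmetric] by linarith
  next
    case False
    then have z: "z > 0" using \<open>z \<ge> 0\<close> by simp
    have "z * ln z = (1 - t) * (a * ln z + a - z) + t * (b * ln z + b - z)"
      by (simp add: z_def algebra_simps)
    also have "\<dots> \<le> (1 - t) * (a * ln a) + t * (b * ln b)"
      using assms mult_ln_tangent[OF assms(1) z] mult_ln_tangent[OF assms(2) z]
      by (intro add_mono mult_left_mono) auto
    finally show ?thesis by (simp add: z_def)
  qed
qed

lemma abs_mult_ln_le:
  fixes x :: real
  assumes "0 \<le> x" "x \<le> C"
  shows "\<bar>x * ln x\<bar> \<le> 1 + C\<^sup>2"
proof (cases "x \<le> 1")
  case True
  have "x * ln x \<le> 0" using True assms by (cases "x = 0") (auto simp: mult_nonneg_nonpos)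
  moreover have "x * ln x \<ge> x - 1" using mult_ln_tangent[of x 1] assms by simp
  ultimately have "\<bar>x * ln x\<bar> \<le> 1" using assms by simp
  then show ?thesis using zero_le_power2[of C] by linarith
next
  case False
  have "x * ln x \<le> x * x" using False ln_le_minus_one[of x] by (intro mult_left_mono) auto
  also have "\<dots> \<le> C * C" using False assms by (intro mult_mono) auto
  finally show ?thesis using False by (simp add: power2_eq_square)
qed

text \<open>The form \<open>exp (- \<eta> * ln r)\<close> stands for the power r^(-\<eta>). Unlike
  \<open>powr\<close> it equals 1 at r = 0, and it is literally the exponential of a multiple of the
  logarithm, which is the shape the Gibbs inequality requires.\<close>

lemma minus_ln_le_exp:
  fixes \<eta> r :: real
  assumes "\<eta> > 0"
  shows "- ln r \<le> exp (- \<eta> * ln r) / \<eta>"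
proof -
  have "- \<eta> * ln r \<le> exp (- \<eta> * ln r)" using exp_ge_add_one_self[of "- \<eta> * ln r"] by linarith
  then show ?thesis using assms by (simp add: field_simps)
qed

lemma abs_ln_le:
  fixes \<eta> r :: real
  assumes "\<eta> > 0" "r \<ge> 0"
  shows "\<bar>ln r\<bar> \<le> r + exp (- \<eta> * ln r) / \<eta>"
proof -
  have "ln r \<le> r" using assms ln_le_minus_one[of r] by (cases "r = 0") auto
  moreover have "exp (- \<eta> * ln r) / \<eta> \<ge> 0" using assms by simp
  ultimately show ?thesis using minus_ln_le_exp[OF assms(1), of r] assms by linarith
qed

lemma ln_one_plus_le_powr:
  fixes z \<eta> :: real
  assumes "z \<ge> 0" "0 < \<eta>" "\<eta> \<le> 1"
  shows "ln (1 + z) \<le> 2 / \<eta> * z powr \<eta>"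
proof (cases "z \<le> 1")
  case True
  have "ln (1 + z) \<le> z" using assms ln_add_one_self_le_self by auto
  also have "z \<le> z powr \<eta>"
  proof (cases "z = 0")
    case False
    then show ?thesis using powr_mono'[of \<eta> 1 z] True assms by simp
  qed simp
  also have "\<dots> \<le> 2 / \<eta> * z powr \<eta>" using assms by (simp add: field_simps mult_right_mono)
  finally show ?thesis .
next
  case False
  have w: "z powr \<eta> \<ge> 1" using False assms by (intro ge_one_powr_ge_zero) auto
  have "ln (1 + z) \<le> ln (2 * z)" using False by (subst ln_le_cancel_iff) auto
  also have "\<dots> = ln 2 + ln z" using False by (simp add: ln_mult)
  also have "ln z = ln (z powr \<eta>) / \<eta>" using False assms by (simp add: ln_powr)
  also have "ln 2 \<le> (1::real)" using ln_le_minus_one[of "2::real"] by simp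
  also have "ln (z powr \<eta>) / \<eta> \<le> (z powr \<eta> - 1) / \<eta>"
    using w assms by (intro divide_right_mono ln_le_minus_one) auto
  also have "1 + (z powr \<eta> - 1) / \<eta> \<le> 2 / \<eta> * z powr \<eta>"
  proof -
    have "1 \<le> 1 / \<eta>" "(z powr \<eta>) / \<eta> \<ge> 0" using assms by auto
    then show ?thesis by (simp add: diff_divide_distrib)
  qed
  finally show ?thesis by simp
qed

text \<open>With u the smaller and v the larger argument, ln v - ln u = ln(1 + (v - u)/u), and ln(1
  + z) is at most a multiple of z^\<eta>. Adding the term of the other argument makes the bound
  symmetric. It turns moments of the kernel into Hoelder bounds for potentials.\<close>

lemma ln_diff_le:
  fixes a b \<eta> :: real
  assumes "0 < a" "0 < b" "0 < \<eta>" "\<eta> \<le> 1"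
  shows "\<bar>ln a - ln b\<bar> \<le> 2 / \<eta> * \<bar>a - b\<bar> powr \<eta> * (exp (- \<eta> * ln a) + exp (- \<eta> * ln b))"
proof -
  have *: "ln v - ln u \<le> 2 / \<eta> * \<bar>v - u\<bar> powr \<eta> * exp (- \<eta> * ln u)" if "0 < u" "u \<le> v" for u v
  proof -
    have "ln v - ln u = ln (1 + (v - u) / u)" using that by (simp add: ln_div field_simps)
    also have "\<dots> \<le> 2 / \<eta> * ((v - u) / u) powr \<eta>" using that assms by (intro ln_one_plus_le_powr) auto
    also have "((v - u) / u) powr \<eta> = \<bar>v - u\<bar> powr \<eta> * exp (- \<eta> * ln u)"
    proof -
      have "((v - u) / u) powr \<eta> = (v - u) powr \<eta> / u powr \<eta>" using that by (simp add: powr_divide)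
      also have "u powr \<eta> = exp (\<eta> * ln u)" using that by (simp add: powr_def)
      finally show ?thesis using that by (simp add: exp_minus divide_inverse)
    qed
    finally show ?thesis by simp
  qed
  have nn: "2 / \<eta> * \<bar>a - b\<bar> powr \<eta> * exp (- \<eta> * ln u) \<ge> 0" for u using assms by simp
  show ?thesis
  proof (cases "a \<le> b")
    case True
    then have "\<bar>ln a - ln b\<bar> = ln b - ln a" using assms by simp
    then show ?thesis using *[of a b] nn[of b] True assms unfolding distrib_left abs_minus_commute[of a b] by linarith
  next
    case False
    then have "\<bar>ln a - ln b\<bar> = ln a - ln b" using assms by simp
    then show ?thesis using *[of b a] nn[of a] False assms unfolding distrib_left by linarith
  qed
qed

text \<open>This is ln t \<le> t - 1 at t = sqrt(s/f), multiplied by 2f. For densities of equal mass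
  the left side integrates to the squared Hellinger distance.\<close>

lemma kl_hellinger_pointwise:
  fixes f s :: real
  assumes "f \<ge> 0" "s > 0"
  shows "2 * f - 2 * sqrt (f * s) \<le> f * (ln f - ln s)"
proof (cases "f = 0")
  case False
  then have f: "f > 0" using assms by simp
  have "ln (sqrt (s / f)) \<le> sqrt (s / f) - 1" using assms f by (intro ln_le_minus_one) auto
  then have "(ln s - ln f) / 2 \<le> sqrt (s / f) - 1"
    using assms f by (simp add: ln_sqrt ln_div)
  then have "ln s - ln f \<le> 2 * (sqrt (s / f) - 1)" by simp
  then have "f * (ln s - ln f) \<le> f * (2 * (sqrt (s / f) - 1))"
    using f by (intro mult_left_mono) auto
  moreover have "f * sqrt (s / f) = sqrt (f * s)"
  proof -
    have "f * sqrt (s / f) = sqrt (f\<^sup>2) * sqrt (s / f)" using f by simp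
    also have "\<dots> = sqrt (f\<^sup>2 * (s / f))" by (rule real_sqrt_mult[symmetric])
    also have "f\<^sup>2 * (s / f) = f * s" using f by (simp add: power2_eq_square)
    finally show ?thesis .
  qed
  ultimately show ?thesis by (simp add: algebra_simps)
qed simp

section \<open>The logarithmic gas over a reference measure\<close>

text \<open>The measure \<mu> is to be K dx, and densities are taken relative to it, so that the
  relative entropy of \<rho> = K f is simply the integral of f ln f. The exponential moment controls
  the logarithm at infinity; the kernel moment of small order \<eta>, uniform over all x including
  the singular point of the weight, controls it locally.\<close>

locale log_gas =
  fixes \<mu> :: "'a::euclidean_space measure" and \<beta> \<eta> C2 :: real
  assumes fin: "finite_measure \<mu>" and sets_mu: "sets \<mu> = sets borel"
    and atomless: "\<And>x. emeasure \<mu> {x} = 0"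
    and nonzero: "measure \<mu> UNIV > 0"
    and beta: "\<beta> > 0" and eta: "0 < \<eta>" "\<eta> \<le> 1"
    and exp_moment: "integrable \<mu> (\<lambda>y. exp (norm y))"
    and ker_integrable: "\<And>x. integrable \<mu> (\<lambda>y. exp (- \<eta> * ln (norm (x - y))))"
    and ker_le: "\<And>x. (LINT y|\<mu>. exp (- \<eta> * ln (norm (x - y)))) \<le> C2"
begin

sublocale finite_measure \<mu> by (rule fin)
sublocale P: pair_sigma_finite \<mu> \<mu> ..

lemmas [measurable_cong] = sets_mu

lemma space_mu [simp]: "space \<mu> = UNIV"
  using sets_eq_imp_space_eq[OF sets_mu] by simp

definition bdd :: "('a \<Rightarrow> real) \<Rightarrow> bool" where
  "bdd f \<longleftrightarrow> f \<in> borel_measurable borel \<and> (\<exists>C. \<forall>x. \<bar>f x\<bar> \<le> C)"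

definition dens :: "('a \<Rightarrow> real) \<Rightarrow> bool" where
  "dens f \<longleftrightarrow> bdd f \<and> (\<forall>x. 0 \<le> f x) \<and> (LINT x|\<mu>. f x) = 1"

definition pot :: "('a \<Rightarrow> real) \<Rightarrow> 'a \<Rightarrow> real" where
  "pot f x = (LINT y|\<mu>. ln (norm (x - y)) * f y)"

definition ent :: "('a \<Rightarrow> real) \<Rightarrow> real" where
  "ent f = (LINT x|\<mu>. f x * ln (f x))"

definition en :: "('a \<Rightarrow> real) \<Rightarrow> ('a \<Rightarrow> real) \<Rightarrow> real" where
  "en f g = (LINT x|\<mu>. f x * pot g x)"

definition free :: "('a \<Rightarrow> real) \<Rightarrow> real" where
  "free f = ent f + \<beta> * en f f"

definition part :: "('a \<Rightarrow> real) \<Rightarrow> real" where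
  "part f = (LINT x|\<mu>. exp (- 2 * \<beta> * pot f x))"

definition step :: "('a \<Rightarrow> real) \<Rightarrow> 'a \<Rightarrow> real" where
  "step f x = exp (- 2 * \<beta> * pot f x) / part f"

text \<open>For a density f this is the Kullback-Leibler divergence of f from \<open>step f\<close>,
  written out with ln(\<open>step f\<close>) = -2\<beta> \<open>pot f\<close> -
  ln(\<open>part f\<close>).\<close>

definition kl :: "('a \<Rightarrow> real) \<Rightarrow> real" where
  "kl f = ent f + 2 * \<beta> * en f f + ln (part f)"

lemma dens_bdd: "dens f \<Longrightarrow> bdd f" by (simp add: dens_def)

lemma integrable_bdd: "bdd f \<Longrightarrow> integrable \<mu> f"
  unfolding bdd_def by (elim conjE exE, rule integrable_const_bound) auto

lemma integrable_bdd_mult: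
  assumes "bdd f" and g: "integrable \<mu> g"
  shows "integrable \<mu> (\<lambda>x. f x * g x)"
proof -
  obtain C where C: "\<And>x. \<bar>f x\<bar> \<le> C" using assms by (auto simp: bdd_def)
  have [measurable]: "f \<in> borel_measurable borel" using assms by (simp add: bdd_def)
  note [measurable] = borel_measurable_integrable[OF g]
  show ?thesis
    by (rule Bochner_Integration.integrable_bound[where f="\<lambda>x. C * g x"])
       (use g C in \<open>auto simp: abs_mult intro!: mult_mono order_trans[OF C abs_ge_self]\<close>)
qed

lemma bdd_lin: "bdd f \<Longrightarrow> bdd g \<Longrightarrow> bdd (\<lambda>x. a * f x + b * g x)"
proof -
  assume "bdd f" "bdd g"
  then obtain C D where C: "\<And>x. \<bar>f x\<bar> \<le> C" "\<And>x. \<bar>g x\<bar> \<le> D"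
    and [measurable]: "f \<in> borel_measurable borel" "g \<in> borel_measurable borel"
    by (auto simp: bdd_def)
  have "\<bar>a * f x + b * g x\<bar> \<le> \<bar>a\<bar> * C + \<bar>b\<bar> * D" for x
    by (rule order_trans[OF abs_triangle_ineq]) (auto simp: abs_mult intro!: add_mono mult_left_mono C)
  then show ?thesis unfolding bdd_def by auto
qed

lemma ln_integrable: "integrable \<mu> (\<lambda>y. ln (norm (x - y)))"
proof (rule Bochner_Integration.integrable_bound)
  show "integrable \<mu> (\<lambda>y. (norm x + exp (norm y)) + exp (- \<eta> * ln (norm (x - y))) / \<eta>)"
    by (intro Bochner_Integration.integrable_add integrable_divide ker_integrable exp_moment) auto
  show "AE y in \<mu>. norm (ln (norm (x - y))) \<le> norm (norm x + exp (norm y) + exp (- \<eta> * ln (norm (x - y))) / \<eta>)"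
  proof (intro always_eventually allI)
    fix y
    have "norm (x - y) \<le> norm x + exp (norm y)"
      using norm_triangle_ineq4[of x y] exp_ge_add_one_self[of "norm y"] by linarith
    then show "norm (ln (norm (x - y))) \<le> norm (norm x + exp (norm y) + exp (- \<eta> * ln (norm (x - y))) / \<eta>)"
      using abs_ln_le[OF eta(1), of "norm (x - y)"] by simp
  qed
qed measurable

definition A0 :: real where
  "A0 = measure \<mu> UNIV + (LINT y|\<mu>. exp (norm y)) + C2 / \<eta>"

lemma C2_nonneg: "C2 \<ge> 0"
proof -
  have "0 \<le> (LINT y|\<mu>. exp (- \<eta> * ln (norm (0 - y))))" by (rule integral_nonneg_AE) auto
  then show ?thesis using ker_le[of 0] by linarith
qed

text \<open>Far away |ln r| \<le> r \<le> |x| + exp |y|, which uses the exponential moment; near the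
  singularity the kernel moment takes over. The growth in x is only linear, so potentials are
  \<mu>-integrable.\<close>

lemma ln_abs_integral_le: "(LINT y|\<mu>. \<bar>ln (norm (x - y))\<bar>) \<le> A0 * (1 + norm x)"
proof -
  have "(LINT y|\<mu>. \<bar>ln (norm (x - y))\<bar>) \<le> (LINT y|\<mu>. (norm x + exp (norm y)) + exp (- \<eta> * ln (norm (x - y))) / \<eta>)"
  proof (rule integral_mono)
    fix y
    have "norm (x - y) \<le> norm x + exp (norm y)"
      using norm_triangle_ineq4[of x y] exp_ge_add_one_self[of "norm y"] by linarith
    then show "\<bar>ln (norm (x - y))\<bar> \<le> (norm x + exp (norm y)) + exp (- \<eta> * ln (norm (x - y))) / \<eta>"
      using abs_ln_le[OF eta(1), of "norm (x - y)"] by simp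
  qed (intro Bochner_Integration.integrable_add integrable_divide ker_integrable exp_moment ln_integrable integrable_abs integrable_const)+
  also have "\<dots> = norm x * measure \<mu> UNIV + (LINT y|\<mu>. exp (norm y)) + (LINT y|\<mu>. exp (- \<eta> * ln (norm (x - y)))) / \<eta>"
    using ker_integrable[of x] exp_moment by simp
  also have "\<dots> \<le> norm x * measure \<mu> UNIV + (LINT y|\<mu>. exp (norm y)) + C2 / \<eta>"
    using ker_le[of x] eta by (intro add_left_mono divide_right_mono) auto
  also have "\<dots> \<le> A0 * (1 + norm x)"
  proof -
    have "(LINT y|\<mu>. exp (norm y)) \<ge> 0" by (rule integral_nonneg_AE) auto
    moreover have "C2 / \<eta> \<ge> 0" using C2_nonneg eta by simp
    ultimately have "norm x * ((LINT y|\<mu>. exp (norm y)) + C2 / \<eta>) \<ge> 0" by simp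
    then show ?thesis using nonzero unfolding A0_def by (simp add: algebra_simps)
  qed
  finally show ?thesis .
qed

lemma A0_nonneg: "A0 \<ge> 0"
proof -
  have "(LINT y|\<mu>. exp (norm y)) \<ge> 0" by (rule integral_nonneg_AE) auto
  then show ?thesis unfolding A0_def using C2_nonneg eta by simp
qed

lemma pot_integrable: "bdd f \<Longrightarrow> integrable \<mu> (\<lambda>y. ln (norm (x - y)) * f y)"
  using integrable_bdd_mult[OF _ ln_integrable] by (simp add: mult.commute)

lemma pot_abs_le:
  assumes "bdd f" "\<And>x. \<bar>f x\<bar> \<le> C"
  shows "\<bar>pot f x\<bar> \<le> C * (A0 * (1 + norm x))"
proof -
  have "C \<ge> 0" using assms(2)[of 0] by linarith
  have "\<bar>pot f x\<bar> \<le> (LINT y|\<mu>. \<bar>ln (norm (x - y)) * f y\<bar>)"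
    unfolding pot_def using integral_norm_bound[of \<mu> "\<lambda>y. ln (norm (x - y)) * f y"] by simp
  also have "\<dots> \<le> (LINT y|\<mu>. C * \<bar>ln (norm (x - y))\<bar>)"
    using assms by (intro integral_mono integrable_abs pot_integrable integrable_mult_right ln_integrable)
       (auto simp: abs_mult mult.commute[of C] intro!: mult_left_mono)
  also have "\<dots> \<le> C * (A0 * (1 + norm x))"
    using ln_abs_integral_le[of x] \<open>C \<ge> 0\<close> by (simp add: mult_left_mono)
  finally show ?thesis .
qed

lemma pot_measurable [measurable]:
  assumes [measurable]: "f \<in> borel_measurable borel"
  shows "pot f \<in> borel_measurable borel"
  unfolding pot_def by measurable

lemma integrable_growth: "integrable \<mu> (\<lambda>x. 1 + norm x)"
proof (rule Bochner_Integration.integrable_bound[OF exp_moment])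
  show "AE x in \<mu>. norm (1 + norm x) \<le> norm (exp (norm x))"
    by (intro always_eventually) (use exp_ge_add_one_self in auto)
qed measurable

lemma integrable_pot:
  assumes "bdd g"
  shows "integrable \<mu> (pot g)"
proof -
  obtain C where C: "\<And>x. \<bar>g x\<bar> \<le> C" using assms by (auto simp: bdd_def)
  have [measurable]: "g \<in> borel_measurable borel" using assms by (simp add: bdd_def)
  show ?thesis
    by (rule Bochner_Integration.integrable_bound[where f="\<lambda>x. C * (A0 * (1 + norm x))"])
      (use pot_abs_le[OF assms C] in \<open>auto intro!: integrable_mult_right integrable_growth order_trans[OF _ abs_ge_self]\<close>)
qed

lemma en_integrable: "bdd f \<Longrightarrow> bdd g \<Longrightarrow> integrable \<mu> (\<lambda>x. f x * pot g x)"
  by (intro integrable_bdd_mult integrable_pot)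

lemma pair_log_integrable:
  assumes "bdd f" "bdd g"
  shows "integrable (\<mu> \<Otimes>\<^sub>M \<mu>) (\<lambda>p. f (fst p) * g (snd p) * ln (norm (fst p - snd p)))"
proof -
  obtain C D where C: "\<And>x. \<bar>f x\<bar> \<le> C" "\<And>x. \<bar>g x\<bar> \<le> D"
    and [measurable]: "f \<in> borel_measurable borel" "g \<in> borel_measurable borel"
    using assms by (auto simp: bdd_def)
  have CD: "C \<ge> 0" "D \<ge> 0" using C[of 0] by linarith+
  have "(\<integral>\<^sup>+x. \<integral>\<^sup>+y. ennreal (norm (f x * g y * ln (norm (x - y)))) \<partial>\<mu> \<partial>\<mu>)
     \<le> (\<integral>\<^sup>+x. ennreal (C * D * (A0 * (1 + norm x))) \<partial>\<mu>)"
  proof (rule nn_integral_mono)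
    fix x
    have "(\<integral>\<^sup>+y. ennreal (norm (f x * g y * ln (norm (x - y)))) \<partial>\<mu>)
       \<le> (\<integral>\<^sup>+y. ennreal (C * D * \<bar>ln (norm (x - y))\<bar>) \<partial>\<mu>)"
      using C CD by (intro nn_integral_mono ennreal_leI) (auto simp: abs_mult intro!: mult_right_mono mult_mono)
    also have "\<dots> = ennreal (LINT y|\<mu>. C * D * \<bar>ln (norm (x - y))\<bar>)"
      using CD by (intro nn_integral_eq_integral integrable_mult_right integrable_abs ln_integrable) auto
    also have "\<dots> \<le> ennreal (C * D * (A0 * (1 + norm x)))"
      using ln_abs_integral_le[of x] CD by (intro ennreal_leI) (simp add: mult_left_mono)
    finally show "(\<integral>\<^sup>+y. ennreal (norm (f x * g y * ln (norm (x - y)))) \<partial>\<mu>) \<le> ennreal (C * D * (A0 * (1 + norm x)))" .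
  qed
  also have "\<dots> < \<infinity>"
    using CD A0_nonneg integrable_growth by (subst nn_integral_eq_integral) (auto simp: add_nonneg_nonneg)
  finally show ?thesis
    by (intro pair_integrableI) (auto simp: sigma_finite_measure_axioms)
qed

lemma en_pair:
  assumes "bdd f" "bdd g"
  shows "en f g = (LINT p|(\<mu> \<Otimes>\<^sub>M \<mu>). f (fst p) * g (snd p) * ln (norm (fst p - snd p)))"
proof -
  have "(LINT p|(\<mu> \<Otimes>\<^sub>M \<mu>). f (fst p) * g (snd p) * ln (norm (fst p - snd p)))
     = (LINT x|\<mu>. LINT y|\<mu>. f x * g y * ln (norm (x - y)))"
    using P.integral_fst'[OF pair_log_integrable[OF assms]] by simp
  also have "\<dots> = en f g"
    unfolding en_def pot_def
    by (intro Bochner_Integration.integral_cong refl, subst integral_mult_right_zero[symmetric])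
       (simp add: mult_ac)
  finally show ?thesis by simp
qed

lemma en_sym:
  assumes "bdd f" "bdd g"
  shows "en f g = en g f"
proof -
  have "en f g = (LINT x|\<mu>. LINT y|\<mu>. f x * g y * ln (norm (x - y)))"
    using P.integral_fst'[OF pair_log_integrable[OF assms]] en_pair[OF assms] by simp
  also have "\<dots> = (LINT y|\<mu>. LINT x|\<mu>. f x * g y * ln (norm (x - y)))"
    using P.Fubini_integral[of "\<lambda>x y. f x * g y * ln (norm (x - y))"] pair_log_integrable[OF assms]
    by (simp add: case_prod_beta')
  also have "\<dots> = (LINT y|\<mu>. LINT x|\<mu>. g y * f x * ln (norm (y - x)))"
    by (simp add: mult_ac norm_minus_commute)
  also have "\<dots> = en g f"
    using P.integral_fst'[OF pair_log_integrable[OF assms(2,1)]] en_pair[OF assms(2,1)] by simp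
  finally show ?thesis .
qed

lemma en_lin_left:
  assumes "bdd f" "bdd g" "bdd h"
  shows "en (\<lambda>x. a * f x + b * g x) h = a * en f h + b * en g h"
proof -
  have "en (\<lambda>x. a * f x + b * g x) h = (LINT x|\<mu>. a * (f x * pot h x) + b * (g x * pot h x))"
    unfolding en_def by (intro Bochner_Integration.integral_cong) (auto simp: algebra_simps)
  also have "\<dots> = a * en f h + b * en g h"
    unfolding en_def using en_integrable[OF assms(1,3)] en_integrable[OF assms(2,3)] by simp
  finally show ?thesis .
qed

lemma en_lin_right:
  assumes "bdd f" "bdd g" "bdd h"
  shows "en h (\<lambda>x. a * f x + b * g x) = a * en h f + b * en h g"
  using en_lin_left[OF assms] en_sym[OF bdd_lin[OF assms(1,2)] assms(3)] en_sym[OF assms(1,3)] en_sym[OF assms(2,3)]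
  by simp

lemma en_nonpos:
  assumes "bdd g" "(LINT x|\<mu>. g x) = 0"
  shows "en g g \<le> 0"
  unfolding en_pair[OF assms(1,1)]
  by (rule log_kernel_nonpos) (use fin sets_mu atomless assms integrable_bdd pair_log_integrable in auto)

lemma ent_integrable:
  assumes "dens f"
  shows "integrable \<mu> (\<lambda>x. f x * ln (f x))"
proof -
  obtain C where C: "\<And>x. \<bar>f x\<bar> \<le> C" using assms unfolding dens_def bdd_def by blast
  have [measurable]: "f \<in> borel_measurable borel" using assms by (auto simp: dens_def bdd_def)
  have "\<bar>f x * ln (f x)\<bar> \<le> 1 + C\<^sup>2" for x
    using C[of x] assms by (intro abs_mult_ln_le) (auto simp: dens_def)
  then show ?thesis by (intro integrable_const_bound[where B="1 + C\<^sup>2"]) auto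
qed

lemma integrable_mass:
  assumes "dens f" "B \<in> sets borel"
  shows "integrable \<mu> (\<lambda>x. f x * indicator B x)"
proof -
  have "emeasure \<mu> B < \<infinity>" using emeasure_finite[of B] unfolding infinity_ennreal_def top.not_eq_extremum[symmetric] .
  then have "integrable \<mu> (indicator B :: 'a \<Rightarrow> real)"
    using assms by (intro integrable_real_indicator) (auto simp: sets_mu)
  then show ?thesis using assms by (intro integrable_bdd_mult dens_bdd)
qed

lemma exp_integral_pos:
  assumes "integrable \<mu> (\<lambda>x. exp (h x))"
  shows "(LINT x|\<mu>. exp (h x :: real)) > 0"
proof -
  have "(LINT x|\<mu>. exp (h x)) \<noteq> 0"
  proof
    assume "(LINT x|\<mu>. exp (h x)) = 0"
    then have "AE x in \<mu>. exp (h x) = 0"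
      by (subst (asm) integral_nonneg_eq_0_iff_AE[OF assms]) auto
    then have "AE x in \<mu>. False" by simp
    then have "emeasure \<mu> UNIV = 0" by (simp add: AE_iff_measurable[OF _ refl] sets_mu)
    then show False using nonzero by (simp add: measure_def)
  qed
  moreover have "(LINT x|\<mu>. exp (h x)) \<ge> 0" by (rule integral_nonneg_AE) auto
  ultimately show ?thesis by linarith
qed

section \<open>The Gibbs inequality and bounds for potentials\<close>

text \<open>The tangent bound for f ln f at the point exp(h)/Z, integrated. The bounds below for
  potentials, for the entropy and for the mass of a set are instances with suitably chosen
  h.\<close>

lemma gibbs:
  assumes f: "dens f" and fh: "integrable \<mu> (\<lambda>x. f x * h x)" and eh: "integrable \<mu> (\<lambda>x. exp (h x))"
  shows "(LINT x|\<mu>. f x * h x) \<le> ent f + ln (LINT x|\<mu>. exp (h x))"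
proof -
  define Z where "Z = (LINT x|\<mu>. exp (h x))"
  have Z: "Z > 0" unfolding Z_def by (rule exp_integral_pos[OF eh])
  have fi: "integrable \<mu> f" by (rule integrable_bdd[OF dens_bdd[OF f]])
  have pt: "f x * h x - ln Z * f x + f x - exp (h x) / Z \<le> f x * ln (f x)" for x
    using mult_ln_tangent[of "f x" "exp (h x) / Z"] f Z
    by (simp add: dens_def ln_div algebra_simps)
  have "(LINT x|\<mu>. f x * h x - ln Z * f x + f x - exp (h x) / Z) \<le> ent f"
    unfolding ent_def using fh eh fi ent_integrable[OF f] pt by (intro integral_mono) auto
  moreover have "(LINT x|\<mu>. f x * h x - ln Z * f x + f x - exp (h x) / Z) = (LINT x|\<mu>. f x * h x) - ln Z * 1 + 1 - Z / Z"
    using fh eh fi f by (simp add: dens_def Z_def)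
  ultimately show ?thesis using Z by (simp add: Z_def)
qed

text \<open>Gibbs with h = -b ln|y - x|. The larger b can be taken, the weaker the dependence of the
  potential on the entropy.\<close>

lemma gibbs_lower_log:
  assumes f: "dens f" and b: "b > 0"
    and i: "integrable \<mu> (\<lambda>x. exp (- b * ln (norm (y - x))))"
    and le: "ln (LINT x|\<mu>. exp (- b * ln (norm (y - x)))) \<le> L"
  shows "pot f y \<ge> - (ent f + L) / b"
proof -
  have "(LINT x|\<mu>. f x * (- b * ln (norm (y - x)))) \<le> ent f + ln (LINT x|\<mu>. exp (- b * ln (norm (y - x))))"
    by (rule gibbs[OF f _ i]) (intro integrable_bdd_mult integrable_mult_right ln_integrable dens_bdd f)
  also have "(LINT x|\<mu>. f x * (- b * ln (norm (y - x)))) = - b * pot f y"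
    unfolding pot_def by (subst integral_mult_right_zero[symmetric]) (simp add: mult_ac)
  finally show ?thesis using b le by (simp add: field_simps)
qed

lemma pot_lower:
  assumes "dens f"
  shows "pot f x \<ge> - (ent f + ln C2) / \<eta>"
  using exp_integral_pos[OF ker_integrable[of x]] ker_le[of x]
  by (intro gibbs_lower_log[OF assms eta(1) ker_integrable] ln_mono) auto

text \<open>Since ln|x - y| \<le> |x| + |y|, only the first moment of f is needed, and Gibbs with h
  = |y| bounds it by the entropy.\<close>

lemma pot_upper:
  assumes f: "dens f"
  shows "pot f x \<le> norm x + ent f + ln (LINT y|\<mu>. exp (norm y))"
proof -
  have fi: "integrable \<mu> f" by (rule integrable_bdd[OF dens_bdd[OF f]])
  have ni: "integrable \<mu> (\<lambda>y. f y * norm y)"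
  proof (rule integrable_bdd_mult[OF dens_bdd[OF f]])
    show "integrable \<mu> norm"
      by (rule Bochner_Integration.integrable_bound[OF integrable_growth]) auto
  qed
  have "pot f x \<le> (LINT y|\<mu>. norm x * f y + f y * norm y)"
    unfolding pot_def
  proof (rule integral_mono)
    fix y
    have "ln (norm (x - y)) \<le> norm (x - y)"
      using ln_le_minus_one[of "norm (x - y)"] by (cases "x = y") auto
    also have "\<dots> \<le> norm x + norm y" by (rule norm_triangle_ineq4)
    finally have "ln (norm (x - y)) * f y \<le> (norm x + norm y) * f y"
      using f by (intro mult_right_mono) (auto simp: dens_def)
    then show "ln (norm (x - y)) * f y \<le> norm x * f y + f y * norm y" by (simp add: algebra_simps)
  qed (use fi ni pot_integrable[OF dens_bdd[OF f]] in auto)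
  also have "\<dots> = norm x + (LINT y|\<mu>. f y * norm y)"
    using fi ni f by (simp add: dens_def)
  also have "(LINT y|\<mu>. f y * norm y) \<le> ent f + ln (LINT y|\<mu>. exp (norm y))"
    by (rule gibbs[OF f ni exp_moment])
  finally show ?thesis by simp
qed

lemma exp_pot:
  assumes "dens f"
  shows "bdd (\<lambda>x. exp (- 2 * \<beta> * pot f x))" "part f > 0"
proof -
  have [measurable]: "f \<in> borel_measurable borel" using assms by (simp add: dens_def bdd_def)
  have "\<bar>exp (- 2 * \<beta> * pot f x)\<bar> \<le> exp (2 * \<beta> * ((ent f + ln C2) / \<eta>))" for x
  proof -
    have "- pot f x \<le> (ent f + ln C2) / \<eta>"
      using pot_lower[OF assms, of x] unfolding minus_divide_left[symmetric] by linarith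
    then have "2 * \<beta> * - pot f x \<le> 2 * \<beta> * ((ent f + ln C2) / \<eta>)"
      using beta by (intro mult_left_mono) auto
    then show ?thesis by simp
  qed
  then show b: "bdd (\<lambda>x. exp (- 2 * \<beta> * pot f x))"
    unfolding bdd_def by auto
  show "part f > 0" unfolding part_def by (rule exp_integral_pos[OF integrable_bdd[OF b]])
qed

section \<open>The iteration and its energy descent\<close>

lemma step_dens:
  assumes "dens f"
  shows "dens (step f)"
proof -
  have "bdd (step f)" using bdd_lin[OF exp_pot(1)[OF assms] exp_pot(1)[OF assms], of "1 / part f" 0]
    by (simp add: step_def[abs_def])
  moreover have "(LINT x|\<mu>. step f x) = 1" using exp_pot(2)[OF assms]
    by (simp add: step_def part_def)
  ultimately show ?thesis using exp_pot(2)[OF assms] by (simp add: dens_def step_def)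
qed

lemma step_pos: "dens f \<Longrightarrow> step f x > 0"
  using exp_pot(2) by (simp add: step_def)

lemma ln_step: "dens f \<Longrightarrow> ln (step f x) = - 2 * \<beta> * pot f x - ln (part f)"
  using exp_pot(2)[of f] by (simp add: step_def ln_div)

text \<open>Along the segment from f to \<open>step f\<close> the entropy is convex, and the
  interaction is concave because its quadratic part is the energy of a mean-zero function. Replacing
  the interaction by its tangent gives a bound in which \<open>en s f\<close> cancels, leaving
  exactly t times \<open>kl f\<close> as decrement. The range of t matters: the iteration uses t =
  1, the barrier argument an intermediate t.\<close>

lemma descent:
  assumes f: "dens f" and t: "0 \<le> t" "t \<le> 1"
  shows "dens (\<lambda>x. (1 - t) * f x + t * step f x)"
    and "free (\<lambda>x. (1 - t) * f x + t * step f x) \<le> free f - t * kl f"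
proof -
  define s where "s = step f"
  define \<tau> where "\<tau> = (\<lambda>x. (1 - t) * f x + t * s x)"
  have s: "dens s" unfolding s_def by (rule step_dens[OF f])
  note bf = dens_bdd[OF f] and bs = dens_bdd[OF s]
  have \<tau>: "dens \<tau>"
    using f s t bdd_lin[OF bf bs] integrable_bdd[OF bf] integrable_bdd[OF bs]
    by (simp add: dens_def \<tau>_def)
  then show "dens (\<lambda>x. (1 - t) * f x + t * step f x)" by (simp add: \<tau>_def s_def)
  have "ent \<tau> \<le> (LINT x|\<mu>. (1 - t) * (f x * ln (f x)) + t * (s x * ln (s x)))"
    unfolding ent_def
  proof (rule integral_mono)
    show "\<tau> x * ln (\<tau> x) \<le> (1 - t) * (f x * ln (f x)) + t * (s x * ln (s x))" for x
      using f s t unfolding \<tau>_def by (intro mult_ln_convex) (auto simp: dens_def)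
  qed (use ent_integrable[OF f] ent_integrable[OF s] ent_integrable[OF \<tau>] in auto)
  also have "\<dots> = (1 - t) * ent f + t * ent s"
    using ent_integrable[OF f] ent_integrable[OF s] by (simp add: ent_def)
  finally have e1: "ent \<tau> \<le> (1 - t) * ent f + t * ent s" .
  have e2: "ent s = - 2 * \<beta> * en s f - ln (part f)"
  proof -
    have "ent s = (LINT x|\<mu>. - 2 * \<beta> * (s x * pot f x) - ln (part f) * s x)"
      unfolding ent_def by (intro Bochner_Integration.integral_cong refl)
        (simp add: s_def ln_step[OF f] algebra_simps)
    also have "\<dots> = - 2 * \<beta> * en s f - ln (part f)"
      using en_integrable[OF bs bf] integrable_bdd[OF bs] s by (simp add: en_def dens_def)
    finally show ?thesis .
  qed
  \<comment> \<open>The difference s - f, with coefficients spelled out to match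
    \<open>bdd_lin\<close> and \<open>en_lin_left\<close>.\<close>
  define d where "d = (\<lambda>x. 1 * s x + (-1) * f x)"
  have bd: "bdd d" unfolding d_def by (rule bdd_lin[OF bs bf])
  have d0: "(LINT x|\<mu>. d x) = 0"
    using integrable_bdd[OF bf] integrable_bdd[OF bs] f s by (simp add: d_def dens_def)
  have \<tau>d: "\<tau> = (\<lambda>x. 1 * f x + t * d x)" by (auto simp: \<tau>_def d_def algebra_simps)
  have "en \<tau> \<tau> = en f f + 2 * t * en d f + t\<^sup>2 * en d d"
    unfolding \<tau>d using bd bf bdd_lin[OF bf bd, of 1 t] en_sym[OF bf bd]
    by (simp only: en_lin_left en_lin_right) (simp add: algebra_simps power2_eq_square)
  also have "\<dots> \<le> en f f + 2 * t * en d f"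
    using en_nonpos[OF bd d0] by (simp add: mult_nonneg_nonpos)
  also have "en d f = en s f - en f f"
    unfolding d_def using en_lin_left[OF bs bf bf, of 1 "-1"] by simp
  finally have "\<beta> * en \<tau> \<tau> \<le> \<beta> * (en f f + 2 * t * (en s f - en f f))"
    using beta by simp
  then have "free \<tau> \<le> (1 - t) * ent f + t * (- 2 * \<beta> * en s f - ln (part f)) + \<beta> * (en f f + 2 * t * (en s f - en f f))"
    using e1 e2 unfolding free_def by simp
  also have "\<dots> = free f - t * kl f"
    by (simp add: free_def kl_def algebra_simps)
  finally show "free (\<lambda>x. (1 - t) * f x + t * step f x) \<le> free f - t * kl f"
    by (simp add: \<tau>_def s_def)
qed

lemma sqrt_bdd:
  assumes "bdd f" "bdd g" "\<And>x. f x \<ge> 0" "\<And>x. g x \<ge> 0"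
  shows "bdd (\<lambda>x. sqrt (f x * g x))"
proof -
  obtain C D where C: "\<And>x. \<bar>f x\<bar> \<le> C" "\<And>x. \<bar>g x\<bar> \<le> D"
    and [measurable]: "f \<in> borel_measurable borel" "g \<in> borel_measurable borel"
    using assms by (auto simp: bdd_def)
  have "sqrt (f x * g x) \<le> sqrt (C * D)" for x
    using C[of x] assms(3,4)[of x] by (intro real_sqrt_le_mono mult_mono) auto
  then have "\<bar>sqrt (f x * g x)\<bar> \<le> sqrt (C * D)" for x
    using assms(3,4)[of x] by simp
  then show ?thesis unfolding bdd_def by auto
qed

text \<open>As f and \<open>step f\<close> both have mass 1, the squared Hellinger distance is the
  integral of 2f - 2 sqrt(f s), to which the pointwise inequality applies. This is how small energy
  decrements control the distance between successive iterates.\<close>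

lemma kl_ge_hellinger:
  assumes f: "dens f"
  shows "integrable \<mu> (\<lambda>x. (sqrt (f x) - sqrt (step f x))\<^sup>2)"
    and "(LINT x|\<mu>. (sqrt (f x) - sqrt (step f x))\<^sup>2) \<le> kl f"
proof -
  define s where "s = step f"
  have s: "dens s" unfolding s_def by (rule step_dens[OF f])
  have pos: "f x \<ge> 0" "s x > 0" for x using f step_pos[OF f] by (auto simp: dens_def s_def)
  note bf = dens_bdd[OF f] and bs = dens_bdd[OF s]
  have bq: "bdd (\<lambda>x. sqrt (f x * s x))" using pos by (intro sqrt_bdd bf bs) (auto intro: less_imp_le)
  note i = integrable_bdd[OF bf] integrable_bdd[OF bs] integrable_bdd[OF bq]
  have sq: "(sqrt (f x) - sqrt (s x))\<^sup>2 = f x + s x - 2 * sqrt (f x * s x)" for x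
    using pos[of x] by (simp add: power2_diff real_sqrt_mult)
  show "integrable \<mu> (\<lambda>x. (sqrt (f x) - sqrt (step f x))\<^sup>2)"
    unfolding s_def[symmetric] sq using i by auto
  have "(LINT x|\<mu>. (sqrt (f x) - sqrt (s x))\<^sup>2) = (LINT x|\<mu>. 2 * f x - 2 * sqrt (f x * s x))"
    unfolding sq using i f s by (simp add: dens_def)
  also have "\<dots> \<le> (LINT x|\<mu>. f x * ln (f x) + 2 * \<beta> * (f x * pot f x) + ln (part f) * f x)"
  proof (rule integral_mono)
    fix x
    show "2 * f x - 2 * sqrt (f x * s x) \<le> f x * ln (f x) + 2 * \<beta> * (f x * pot f x) + ln (part f) * f x"
      using kl_hellinger_pointwise[OF pos(1)[of x] pos(2)[of x]] ln_step[OF f, of x]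
      by (simp add: s_def algebra_simps)
  qed (use i ent_integrable[OF f] en_integrable[OF bf bf] in auto)
  also have "\<dots> = kl f"
    using i ent_integrable[OF f] en_integrable[OF bf bf] f by (simp add: kl_def ent_def en_def dens_def)
  finally show "(LINT x|\<mu>. (sqrt (f x) - sqrt (step f x))\<^sup>2) \<le> kl f" by (simp add: s_def)
qed

lemma kl_nonneg: "dens f \<Longrightarrow> kl f \<ge> 0"
proof -
  assume f: "dens f"
  have "0 \<le> (LINT x|\<mu>. (sqrt (f x) - sqrt (step f x))\<^sup>2)" by (rule integral_nonneg_AE) auto
  then show ?thesis using kl_ge_hellinger(2)[OF f] by linarith
qed

text \<open>The modulus of continuity involves f only through its supremum, hence is common to all
  iterates once these are uniformly bounded.\<close>

lemma pot_hoelder: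
  assumes "bdd f" "\<And>x. \<bar>f x\<bar> \<le> M"
  shows "\<bar>pot f x - pot f x'\<bar> \<le> M * (4 * C2 / \<eta>) * norm (x - x') powr \<eta>"
proof -
  have M: "M \<ge> 0" using assms(2)[of 0] by linarith
  let ?k = "\<lambda>x y. exp (- \<eta> * ln (norm (x - y)))"
  let ?c = "2 / \<eta> * norm (x - x') powr \<eta>"
  have "\<bar>pot f x - pot f x'\<bar> = \<bar>LINT y|\<mu>. ln (norm (x - y)) * f y - ln (norm (x' - y)) * f y\<bar>"
    unfolding pot_def using pot_integrable[OF assms(1)] by simp
  also have "\<dots> \<le> (LINT y|\<mu>. \<bar>ln (norm (x - y)) * f y - ln (norm (x' - y)) * f y\<bar>)"
    using integral_norm_bound[of \<mu> "\<lambda>y. ln (norm (x - y)) * f y - ln (norm (x' - y)) * f y"] by simp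
  also have "\<dots> \<le> (LINT y|\<mu>. M * (?c * (?k x y + ?k x' y)))"
  proof (rule integral_mono_AE)
    have "AE y in \<mu>. y \<noteq> x" by (rule AE_I[where N="{x}"]) (auto simp: atomless sets_mu)
    moreover have "AE y in \<mu>. y \<noteq> x'" by (rule AE_I[where N="{x'}"]) (auto simp: atomless sets_mu)
    ultimately show "AE y in \<mu>. \<bar>ln (norm (x - y)) * f y - ln (norm (x' - y)) * f y\<bar> \<le> M * (?c * (?k x y + ?k x' y))"
    proof eventually_elim
      case (elim y)
      have "\<bar>norm (x - y) - norm (x' - y)\<bar> \<le> norm (x - x')"
        using norm_triangle_ineq3[of "x - y" "x' - y"] by simp
      then have pw: "\<bar>norm (x - y) - norm (x' - y)\<bar> powr \<eta> \<le> norm (x - x') powr \<eta>"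
        using eta by (intro powr_mono2) auto
      have "\<bar>ln (norm (x - y)) - ln (norm (x' - y))\<bar>
         \<le> 2 / \<eta> * \<bar>norm (x - y) - norm (x' - y)\<bar> powr \<eta> * (?k x y + ?k x' y)"
        using elim eta by (intro ln_diff_le) auto
      also have "\<dots> \<le> ?c * (?k x y + ?k x' y)"
        using pw eta by (intro mult_right_mono mult_left_mono) (auto simp: add_nonneg_nonneg)
      finally have "\<bar>ln (norm (x - y)) - ln (norm (x' - y))\<bar> * \<bar>f y\<bar> \<le> (?c * (?k x y + ?k x' y)) * M"
        using assms(2)[of y] eta by (intro mult_mono) (auto simp: add_nonneg_nonneg)
      moreover have "\<bar>ln (norm (x - y)) * f y - ln (norm (x' - y)) * f y\<bar> = \<bar>ln (norm (x - y)) - ln (norm (x' - y))\<bar> * \<bar>f y\<bar>"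
        by (simp add: left_diff_distrib[symmetric] abs_mult)
      ultimately show ?case by (simp add: mult.commute[of M])
    qed
  qed (use pot_integrable[OF assms(1)] ker_integrable in auto)
  also have "\<dots> = M * (?c * ((LINT y|\<mu>. ?k x y) + (LINT y|\<mu>. ?k x' y)))"
    using ker_integrable by simp
  also have "\<dots> \<le> M * (?c * (C2 + C2))"
    using M eta by (intro mult_left_mono add_mono ker_le) auto
  finally show ?thesis by (simp add: field_simps)
qed

end

section \<open>Compactness and passage to a fixed point\<close>

text \<open>A diagonal subsequence converges on a countable dense set, and the common Hoelder bound
  carries the Cauchy property to every other point. Division by 1 + |x| provides the bound uniform
  in x that the diagonal argument expects.\<close>

lemma equicontinuous_subsequence:
  fixes F :: "nat \<Rightarrow> 'a::euclidean_space \<Rightarrow> real"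
  assumes bd: "\<And>k x. \<bar>F k x\<bar> \<le> A * (1 + norm x)"
    and hoelder: "\<And>k x y. \<bar>F k x - F k y\<bar> \<le> B * norm (x - y) powr \<eta>" and "\<eta> > 0"
  obtains r G where "strict_mono (r::nat\<Rightarrow>nat)" "\<And>x. (\<lambda>k. F (r k) x) \<longlonglongrightarrow> G x"
proof -
  obtain D :: "'a set" where D: "countable D" "\<And>X. open X \<Longrightarrow> X \<noteq> {} \<Longrightarrow> \<exists>d\<in>D. d \<in> X"
    by (rule countable_dense_setE) blast
  have "norm (F k x / (1 + norm x)) \<le> A" for k x
  proof -
    have "1 + norm x > 0" by (simp add: add_pos_nonneg)
    then show ?thesis using bd[of k x] by (simp add: field_simps abs_divide)
  qed
  then obtain r where r: "strict_mono (r::nat\<Rightarrow>nat)"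
    and lim: "\<And>x. x \<in> D \<Longrightarrow> \<exists>l. (\<lambda>k. F (r k) x / (1 + norm x)) \<longlonglongrightarrow> l"
    using function_convergent_subsequence[OF D(1), of "\<lambda>k x. F k x / (1 + norm x)" A] by metis
  have "\<exists>l. (\<lambda>k. F (r k) x) \<longlonglongrightarrow> l" for x
  proof -
    have "Cauchy (\<lambda>k. F (r k) x)"
    proof (rule CauchyI)
      fix e :: real assume e: "e > 0"
      \<comment> \<open>\<open>B\<close> carries no sign hypothesis, hence the absolute
        value.\<close>
      have "((\<lambda>y. \<bar>B\<bar> * norm (x - y) powr \<eta>) \<longlongrightarrow> \<bar>B\<bar> * norm (x - x) powr \<eta>) (nhds x)"
        using \<open>\<eta> > 0\<close> by (intro tendsto_intros) (auto intro!: always_eventually filterlim_ident)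
      then have "eventually (\<lambda>y. \<bar>B\<bar> * norm (x - y) powr \<eta> < e / 3) (nhds x)"
        using e \<open>\<eta> > 0\<close> by (intro order_tendstoD(2)) auto
      then obtain S where S: "open S" "x \<in> S" "\<And>y. y \<in> S \<Longrightarrow> \<bar>B\<bar> * norm (x - y) powr \<eta> < e / 3"
        unfolding eventually_nhds by blast
      then obtain d where d: "d \<in> D" "\<bar>B\<bar> * norm (x - d) powr \<eta> < e / 3" using D(2)[of S] by blast
      have close: "\<bar>F k x - F k d\<bar> < e / 3" for k
      proof -
        have "B * norm (x - d) powr \<eta> \<le> \<bar>B\<bar> * norm (x - d) powr \<eta>" by (intro mult_right_mono) auto
        then show ?thesis using hoelder[of k x d] d(2) by linarith
      qed
      obtain l where l: "(\<lambda>k. F (r k) d / (1 + norm d)) \<longlonglongrightarrow> l" using lim[OF d(1)] by blast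
      have "1 + norm d \<noteq> 0" using norm_ge_zero[of d] by linarith
      then have "(\<lambda>k. F (r k) d) \<longlonglongrightarrow> l * (1 + norm d)"
        using tendsto_mult_right[OF l, of "1 + norm d"] by (simp add: mult.commute)
      then have "Cauchy (\<lambda>k. F (r k) d)" by (rule LIMSEQ_imp_Cauchy)
      then obtain N where N: "\<And>m n. m \<ge> N \<Longrightarrow> n \<ge> N \<Longrightarrow> \<bar>F (r m) d - F (r n) d\<bar> < e / 3"
        using CauchyD[of "\<lambda>k. F (r k) d" "e / 3"] e by auto
      show "\<exists>M. \<forall>m\<ge>M. \<forall>n\<ge>M. norm (F (r m) x - F (r n) x) < e"
      proof (intro exI allI impI)
        fix m n assume "N \<le> m" "N \<le> n"
        then have "\<bar>F (r m) d - F (r n) d\<bar> < e / 3" by (rule N)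
        then show "norm (F (r m) x - F (r n) x) < e"
          using close[of "r m"] close[of "r n"] unfolding real_norm_def by linarith
      qed
    qed
    then show ?thesis using Cauchy_convergent_iff convergent_def by blast
  qed
  then obtain G where "\<And>x. (\<lambda>k. F (r k) x) \<longlonglongrightarrow> G x" by metis
  then show ?thesis using r that by blast
qed

context log_gas
begin

text \<open>Convergence of the potentials makes the images \<open>step (h k)\<close> converge
  everywhere, and the vanishing Hellinger integrand drags h k to the same limit almost everywhere.
  Dominated convergence then identifies \<psi> as the potential of that limit. Defining f by the
  formula in \<psi>, not as an almost-everywhere limit, makes the fixed point equation hold at every
  point.\<close>

lemma fixed_point_of_limit:
  assumes h: "\<And>k. dens (h k)" and M: "\<And>k x. h k x \<le> M"
    and lo: "\<And>k x. lo \<le> pot (h k) x"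
    and lim: "\<And>x. (\<lambda>k. pot (h k) x) \<longlonglongrightarrow> \<psi> x"
    and ae: "AE x in \<mu>. (\<lambda>k. (sqrt (h k x) - sqrt (step (h k) x))\<^sup>2) \<longlonglongrightarrow> 0"
  shows "\<exists>f. dens f \<and> (\<forall>x. f x = step f x)"
proof -
  have hm[measurable]: "h k \<in> borel_measurable borel" for k using h[of k] by (simp add: dens_def bdd_def)
  have h0: "0 \<le> h k x" for k x using h[of k] by (simp add: dens_def)
  have pm[measurable]: "\<psi> \<in> borel_measurable borel"
    by (rule borel_measurable_LIMSEQ_real[where u="\<lambda>k. pot (h k)"]) (use lim in auto)
  define W where "W = exp (- 2 * \<beta> * lo)"
  have eb: "exp (- 2 * \<beta> * pot (h k) x) \<le> W" for k x
    using lo[of k x] beta by (simp add: W_def)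
  have lim_exp: "(\<lambda>k. exp (- 2 * \<beta> * pot (h k) x)) \<longlonglongrightarrow> exp (- 2 * \<beta> * \<psi> x)" for x
    by (intro tendsto_intros lim)
  have eb': "exp (- 2 * \<beta> * \<psi> x) \<le> W" for x
    by (rule LIMSEQ_le_const2[OF lim_exp]) (use eb in auto)
  define Z where "Z = (LINT x|\<mu>. exp (- 2 * \<beta> * \<psi> x))"
  have Zi: "integrable \<mu> (\<lambda>x. exp (- 2 * \<beta> * \<psi> x))"
    by (rule integrable_const_bound[where B=W]) (use eb' in auto)
  have Z: "Z > 0" unfolding Z_def by (rule exp_integral_pos[OF Zi])
  have limZ: "(\<lambda>k. part (h k)) \<longlonglongrightarrow> Z"
    unfolding part_def Z_def
    by (rule integral_dominated_convergence[where w="\<lambda>_. W"]) (use lim_exp eb in auto)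
  define f where "f = (\<lambda>x. exp (- 2 * \<beta> * \<psi> x) / Z)"
  have lim_step: "(\<lambda>k. step (h k) x) \<longlonglongrightarrow> f x" for x
    unfolding step_def f_def using Z by (intro tendsto_divide lim_exp limZ) auto
  have f0: "f x \<ge> 0" for x using Z by (simp add: f_def)
  have fb: "bdd f"
  proof -
    have "\<bar>f x\<bar> \<le> W / Z" for x using eb'[of x] Z by (simp add: f_def divide_right_mono)
    then show ?thesis unfolding bdd_def by (auto simp: f_def)
  qed
  have "(LINT x|\<mu>. f x) = 1" using Z by (simp add: f_def Z_def)
  then have fd: "dens f" using fb f0 by (simp add: dens_def)
  have ae2: "AE x in \<mu>. (\<lambda>k. h k x) \<longlonglongrightarrow> f x"
    using ae
  proof eventually_elim
    case (elim x)
    have "(\<lambda>k. sqrt ((sqrt (h k x) - sqrt (step (h k) x))\<^sup>2)) \<longlonglongrightarrow> sqrt 0"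
      by (intro tendsto_real_sqrt elim)
    then have "(\<lambda>k. sqrt (h k x) - sqrt (step (h k) x)) \<longlonglongrightarrow> 0"
      by (simp add: tendsto_rabs_zero_iff)
    from tendsto_add[OF this tendsto_real_sqrt[OF lim_step[of x]]]
    have "(\<lambda>k. sqrt (h k x)) \<longlonglongrightarrow> sqrt (f x)" by simp
    from tendsto_power[OF this, of 2] show ?case using h0 f0 by simp
  qed
  have "\<psi> x = pot f x" for x
  proof -
    have "(\<lambda>k. pot (h k) x) \<longlonglongrightarrow> pot f x"
      unfolding pot_def
    proof (rule integral_dominated_convergence[where w="\<lambda>y. M * \<bar>ln (norm (x - y))\<bar>"])
      show "AE y in \<mu>. (\<lambda>k. ln (norm (x - y)) * h k y) \<longlonglongrightarrow> ln (norm (x - y)) * f y"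
        using ae2 by eventually_elim (intro tendsto_intros)
      show "integrable \<mu> (\<lambda>y. M * \<bar>ln (norm (x - y))\<bar>)"
        by (intro integrable_mult_right integrable_abs ln_integrable)
      show "AE y in \<mu>. norm (ln (norm (x - y)) * h k y) \<le> M * \<bar>ln (norm (x - y))\<bar>" for k
        using h0 M by (intro always_eventually) (auto simp: abs_mult mult.commute[of M] intro!: mult_left_mono)
    qed (auto simp: f_def)
    then show ?thesis using lim LIMSEQ_unique by blast
  qed
  then have psi: "pot f = \<psi>" by auto
  have "f x = step f x" for x unfolding step_def part_def psi by (simp add: f_def Z_def)
  then show ?thesis using fd by blast
qed

text \<open>\<open>mass\<close> measures how much of f sits in the dangerous set B. Below mass
  \<delta> the energy controls the entropy (\<open>H0\<close>) and is bounded below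
  (\<open>F1\<close>); at mass exactly \<delta> it exceeds \<open>F0\<close>. Since mass is affine
  along segments while the energy never rises there, an iterate cannot jump across \<delta>.\<close>

theorem fixed_point_exists:
  fixes H0 F0 F1 \<delta> :: real and B :: "'a set"
  defines "mass f \<equiv> (LINT x|\<mu>. f x * indicator B x)"
  assumes B: "B \<in> sets borel"
    and bound: "\<And>f. dens f \<Longrightarrow> mass f \<le> \<delta> \<Longrightarrow> free f \<le> F0 \<Longrightarrow> ent f \<le> H0"
    and lower: "\<And>f. dens f \<Longrightarrow> mass f \<le> \<delta> \<Longrightarrow> F1 \<le> free f"
    and barrier: "\<And>f. dens f \<Longrightarrow> mass f = \<delta> \<Longrightarrow> free f > F0"
    and f0: "dens f0" "mass f0 < \<delta>" "free f0 \<le> F0"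
  shows "\<exists>f. dens f \<and> (\<forall>x. f x = step f x)"
proof -
  define good where "good = (\<lambda>f. dens f \<and> mass f < \<delta> \<and> free f \<le> F0)"
  have mass_lin: "mass (\<lambda>x. (1 - t) * f x + t * g x) = (1 - t) * mass f + t * mass g"
    if "dens f" "dens g" for f g t
  proof -
    have "integrable \<mu> (\<lambda>x. f x * indicator B x)" "integrable \<mu> (\<lambda>x. g x * indicator B x)"
      using that B by (auto intro: integrable_mass)
    then show ?thesis by (simp add: mass_def distrib_right mult.assoc)
  qed
  have free_step: "free (step f) \<le> free f - kl f" if "dens f" for f
    using descent(2)[OF that, of 1] by simp
  have good_step: "good (step f)" if g: "good f" for f
  proof -
    have f: "dens f" "mass f < \<delta>" "free f \<le> F0" using g by (auto simp: good_def)
    have "free (step f) \<le> F0" using free_step[OF f(1)] kl_nonneg[OF f(1)] f(3) by linarith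
    moreover have "mass (step f) < \<delta>"
    proof (rule ccontr)
      assume "\<not> mass (step f) < \<delta>"
      \<comment> \<open>The parameter at which the segment from f to \<open>step f\<close> has mass
        exactly \<delta>; there the barrier contradicts \<open>descent\<close>.\<close>
      define t where "t = (\<delta> - mass f) / (mass (step f) - mass f)"
      have t: "0 \<le> t" "t \<le> 1" using f(2) \<open>\<not> _\<close> by (auto simp: t_def field_simps)
      define \<tau> where "\<tau> = (\<lambda>x. (1 - t) * f x + t * step f x)"
      have "mass \<tau> = mass f + t * (mass (step f) - mass f)"
        unfolding \<tau>_def mass_lin[OF f(1) step_dens[OF f(1)]] by (simp add: algebra_simps)
      also have "\<dots> = \<delta>" using f(2) \<open>\<not> _\<close> by (simp add: t_def)
      finally have "free \<tau> > F0" using descent(1)[OF f(1) t] by (intro barrier) (auto simp: \<tau>_def)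
      moreover have "free \<tau> \<le> free f - t * kl f" unfolding \<tau>_def by (rule descent(2)[OF f(1) t])
      moreover have "t * kl f \<ge> 0" using t kl_nonneg[OF f(1)] by simp
      ultimately show False using f(3) by linarith
    qed
    ultimately show ?thesis using step_dens[OF f(1)] by (simp add: good_def)
  qed
  define s where "s k = (step ^^ k) f0" for k
  have s_Suc: "s (Suc k) = step (s k)" for k by (simp add: s_def)
  have sg: "good (s k)" for k
  proof (induction k)
    case 0
    then show ?case using f0 by (simp add: good_def s_def)
  next
    case (Suc k)
    then show ?case unfolding s_Suc by (rule good_step)
  qed
  have sd: "dens (s k)" for k using sg[of k] by (simp add: good_def)
  have ent_le: "ent (s k) \<le> H0" for k using sg[of k] bound by (auto simp: good_def)
  define lo where "lo = - (H0 + ln C2) / \<eta>"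
  define hi where "hi = H0 + ln (LINT y|\<mu>. exp (norm y))"
  have lo: "lo \<le> pot (s k) x" for k x
  proof -
    have "lo \<le> - (ent (s k) + ln C2) / \<eta>"
      unfolding lo_def using ent_le[of k] eta by (intro divide_right_mono) auto
    then show ?thesis using pot_lower[OF sd[of k], of x] by linarith
  qed
  have hi: "pot (s k) x \<le> norm x + hi" for k x
    using pot_upper[OF sd[of k], of x] ent_le[of k] by (simp add: hi_def)
  \<comment> \<open>A lower bound for all partition functions, from the upper bound on potentials.
    Together with \<open>lo\<close> it bounds every image under \<open>step\<close> by one constant
    \<open>M\<close>.\<close>
  define z0 where "z0 = (LINT x|\<mu>. exp (- 2 * \<beta> * (norm x + hi)))"
  have z0i: "integrable \<mu> (\<lambda>x. exp (- 2 * \<beta> * (norm x + hi)))"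
  proof (rule integrable_const_bound[where B="exp (- 2 * \<beta> * hi)"])
    show "AE x in \<mu>. norm (exp (- 2 * \<beta> * (norm x + hi))) \<le> exp (- 2 * \<beta> * hi)"
      using beta by (intro always_eventually) (auto simp: algebra_simps)
  qed measurable
  have z0: "z0 > 0" unfolding z0_def by (rule exp_integral_pos[OF z0i])
  have part_ge: "part (s k) \<ge> z0" for k
    unfolding part_def z0_def
  proof (rule integral_mono[OF z0i integrable_bdd[OF exp_pot(1)[OF sd]]])
    fix x
    have "2 * \<beta> * pot (s k) x \<le> 2 * \<beta> * (norm x + hi)"
      using hi[of k x] beta by (intro mult_left_mono) auto
    then show "exp (- 2 * \<beta> * (norm x + hi)) \<le> exp (- 2 * \<beta> * pot (s k) x)" by simp
  qed
  define M where "M = exp (- 2 * \<beta> * lo) / z0"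
  have sM: "s (Suc k) x \<le> M" for k x
    unfolding s_Suc step_def M_def
    using lo[of k x] beta z0 part_ge[of k] by (intro frac_le) auto
  \<comment> \<open>The sequence starts one step later because \<open>M\<close> bounds images under
    \<open>step\<close>; the starting density f0 need not satisfy that bound.\<close>
  define g where "g k = s (Suc k)" for k
  have gM: "\<bar>g k x\<bar> \<le> M" "g k x \<le> M" and gd: "dens (g k)" for k x
    using sM[of k x] sd[of "Suc k"] by (auto simp: g_def dens_def)
  obtain r \<psi> where r: "strict_mono (r::nat\<Rightarrow>nat)" and lim: "\<And>x. (\<lambda>k. pot (g (r k)) x) \<longlonglongrightarrow> \<psi> x"
  proof (rule equicontinuous_subsequence[of "\<lambda>k. pot (g k)" "M * A0" "M * (4 * C2 / \<eta>)" \<eta>])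
    show "\<bar>pot (g k) x\<bar> \<le> M * A0 * (1 + norm x)" for k x
      using pot_abs_le[OF dens_bdd[OF gd] gM(1), of k x] by (simp add: mult.assoc)
    show "\<bar>pot (g k) x - pot (g k) y\<bar> \<le> M * (4 * C2 / \<eta>) * norm (x - y) powr \<eta>" for k x y
      by (rule pot_hoelder[OF dens_bdd[OF gd] gM(1)])
  qed (use eta in auto)
  \<comment> \<open>The energies decrease and are bounded below, so consecutive differences tend to
    0, and these dominate \<open>kl\<close>.\<close>
  have kl_lim: "(\<lambda>k. kl (s k)) \<longlonglongrightarrow> 0"
  proof -
    have dec: "decseq (\<lambda>k. free (s k))"
    proof (rule decseq_SucI)
      show "free (s (Suc k)) \<le> free (s k)" for k
        using free_step[OF sd[of k]] kl_nonneg[OF sd[of k]] unfolding s_Suc by linarith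
    qed
    have "F1 \<le> free (s k)" for k using sg[of k] lower by (auto simp: good_def)
    then obtain L where L: "(\<lambda>k. free (s k)) \<longlonglongrightarrow> L"
      using decseq_convergent[OF dec] by blast
    have "(\<lambda>k. free (s k) - free (s (Suc k))) \<longlonglongrightarrow> L - L"
      by (intro tendsto_diff L LIMSEQ_Suc)
    then have L0: "(\<lambda>k. free (s k) - free (s (Suc k))) \<longlonglongrightarrow> 0" by simp
    show ?thesis
    proof (rule tendsto_sandwich[OF _ _ tendsto_const L0])
      show "eventually (\<lambda>k. 0 \<le> kl (s k)) sequentially" using kl_nonneg[OF sd] by simp
      have "kl (s k) \<le> free (s k) - free (s (Suc k))" for k
        using free_step[OF sd[of k]] unfolding s_Suc by linarith
      then show "eventually (\<lambda>k. kl (s k) \<le> free (s k) - free (s (Suc k))) sequentially" by simp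
    qed
  qed
  define u where "u k x = (sqrt (g (r k) x) - sqrt (step (g (r k)) x))\<^sup>2" for k x
  have ui: "integrable \<mu> (u k)" for k
    unfolding u_def using kl_ge_hellinger(1)[OF gd] .
  have u_lim: "(\<lambda>k. LINT x|\<mu>. norm (u k x)) \<longlonglongrightarrow> 0"
  proof (rule tendsto_sandwich[OF _ _ tendsto_const])
    show "(\<lambda>k. kl (g (r k))) \<longlonglongrightarrow> 0"
      using LIMSEQ_subseq_LIMSEQ[OF LIMSEQ_Suc[OF kl_lim] r] by (simp add: g_def o_def)
    show "eventually (\<lambda>k. (LINT x|\<mu>. norm (u k x)) \<le> kl (g (r k))) sequentially"
      using kl_ge_hellinger(2)[OF gd] by (intro always_eventually) (simp add: u_def)
    show "eventually (\<lambda>k. 0 \<le> (LINT x|\<mu>. norm (u k x))) sequentially"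
      by (intro always_eventually allI integral_nonneg_AE) auto
  qed
  \<comment> \<open>L1 convergence of the Hellinger integrands gives pointwise convergence only
    along a further subsequence.\<close>
  obtain r2 :: "nat \<Rightarrow> nat" where r2: "strict_mono r2" "AE x in \<mu>. (\<lambda>k. u (r2 k) x) \<longlonglongrightarrow> 0"
    using tendsto_L1_AE_subseq[OF ui u_lim] by blast
  define h where "h k = g (r (r2 k))" for k
  have h1: "(\<lambda>k. pot (h k) x) \<longlonglongrightarrow> \<psi> x" for x
    using LIMSEQ_subseq_LIMSEQ[OF lim[of x] r2(1)] unfolding o_def h_def .
  have h2: "AE x in \<mu>. (\<lambda>k. (sqrt (h k x) - sqrt (step (h k) x))\<^sup>2) \<longlonglongrightarrow> 0"
    using r2(2) unfolding u_def h_def .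
  have h3: "dens (h k)" for k unfolding h_def by (rule gd)
  have h4: "h k x \<le> M" "lo \<le> pot (h k) x" for k x
    using gM(2)[of "r (r2 k)" x] lo[of "Suc (r (r2 k))" x]
    unfolding h_def g_def by auto
  show ?thesis by (rule fixed_point_of_limit[of h M lo \<psi>, OF h3 h4 h1 h2])
qed

end

section \<open>Coercivity of the free energy and the cost of mass near the origin\<close>

context log_gas
begin

lemma ent_ge_total: "dens f \<Longrightarrow> ent f + ln (measure \<mu> UNIV) \<ge> 0"
  using gibbs[of f "\<lambda>_. 0"] by simp

text \<open>With H = \<open>ent f\<close> + L, potentials are at least -H/b outside B and lose a
  further H/\<eta> inside. Thus \<beta> \<open>en f f\<close> costs at most (\<beta>/b) H plus
  \<beta> H/\<eta> times the mass in B. The mass bound is chosen so that this second loss is half of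
  the gap (1 - \<beta>/b) H, and the other half survives.\<close>

lemma free_ge:
  assumes f: "dens f" and B: "B \<in> sets borel" and b: "b > \<beta>"
    and i: "\<And>y. y \<notin> B \<Longrightarrow> integrable \<mu> (\<lambda>x. exp (- b * ln (norm (y - x))))"
    and L1: "\<And>y. y \<notin> B \<Longrightarrow> ln (LINT x|\<mu>. exp (- b * ln (norm (y - x)))) \<le> L"
    and L2: "ln C2 \<le> L" and L3: "ln (measure \<mu> UNIV) \<le> L"
    and mass: "(LINT x|\<mu>. f x * indicator B x) \<le> (1 - \<beta> / b) * \<eta> / (2 * \<beta>)"
  shows "free f \<ge> (1 - \<beta> / b) / 2 * (ent f + L) - L" and "ent f + L \<ge> 0"
proof -
  define H where "H = ent f + L"
  define m where "m = (LINT x|\<mu>. f x * indicator B x)"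
  have b0: "b > 0" using b beta by simp
  show H0: "ent f + L \<ge> 0" using ent_ge_total[OF f] L3 by linarith
  have f0: "f x \<ge> 0" for x using f by (simp add: dens_def)
  have pot: "pot f y \<ge> - H / b - indicator B y * (H / \<eta>)" for y
  proof (cases "y \<in> B")
    case True
    have "pot f y \<ge> - (ent f + ln C2) / \<eta>" by (rule pot_lower[OF f])
    moreover have "- (ent f + ln C2) / \<eta> \<ge> - H / \<eta>" using L2 eta by (simp add: H_def divide_right_mono)
    moreover have "- H / b \<le> 0" using H0 b0 unfolding H_def[symmetric] by simp
    ultimately show ?thesis using True by simp
  next
    case False
    then show ?thesis using gibbs_lower_log[OF f b0 i[OF False] L1[OF False]] by (simp add: H_def)
  qed
  have fi: "integrable \<mu> f" by (rule integrable_bdd[OF dens_bdd[OF f]])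
  have mi: "integrable \<mu> (\<lambda>x. f x * indicator B x)" by (rule integrable_mass[OF f B])
  have "(LINT y|\<mu>. - H / b * f y - H / \<eta> * (f y * indicator B y)) \<le> en f f"
    unfolding en_def
  proof (rule integral_mono)
    show "- H / b * f y - H / \<eta> * (f y * indicator B y) \<le> f y * pot f y" for y
      using mult_left_mono[OF pot[of y] f0[of y]] by (simp add: algebra_simps)
  qed (use fi mi en_integrable[OF dens_bdd[OF f] dens_bdd[OF f]] in auto)
  moreover have "(LINT y|\<mu>. - H / b * f y - H / \<eta> * (f y * indicator B y)) = - H / b - H / \<eta> * m"
    using fi mi f by (simp add: dens_def m_def)
  ultimately have en: "en f f \<ge> - H / b - H / \<eta> * m" by simp
  have "H / \<eta> * m \<le> H / \<eta> * ((1 - \<beta> / b) * \<eta> / (2 * \<beta>))"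
    using mass H0 eta unfolding m_def H_def by (intro mult_left_mono) auto
  also have "\<dots> = H * (1 - \<beta> / b) / (2 * \<beta>)" using eta by simp
  finally have "en f f \<ge> - H / b - H * (1 - \<beta> / b) / (2 * \<beta>)" using en by linarith
  then have "\<beta> * en f f \<ge> \<beta> * (- H / b - H * (1 - \<beta> / b) / (2 * \<beta>))"
    using beta by (intro mult_left_mono) auto
  moreover have "\<beta> * (- H / b - H * (1 - \<beta> / b) / (2 * \<beta>)) = - (\<beta> / b) * H - H * (1 - \<beta> / b) / 2"
    using beta b0 by (simp add: field_simps)
  ultimately have "free f \<ge> H - L - (\<beta> / b) * H - H * (1 - \<beta> / b) / 2"
    unfolding free_def H_def by linarith
  also have "H - L - (\<beta> / b) * H - H * (1 - \<beta> / b) / 2 = (1 - \<beta> / b) / 2 * H - L"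
    by (simp add: algebra_simps diff_divide_distrib)
  finally show "free f \<ge> (1 - \<beta> / b) / 2 * (ent f + L) - L" by (simp add: H_def)
qed

text \<open>Gibbs with h = T on B and 0 elsewhere, where exp h \<le> 1 + exp T on B. If \<mu>(B) is
  of order exp(-T), charging B costs entropy T per unit of mass; this is the source of the
  barrier.\<close>

lemma ent_ge_mass:
  assumes f: "dens f" and B: "B \<in> sets borel"
  shows "ent f \<ge> T * (LINT x|\<mu>. f x * indicator B x) - ln (measure \<mu> UNIV + exp T * measure \<mu> B)"
proof -
  have bi: "integrable \<mu> (indicator B :: 'a \<Rightarrow> real)"
    using integrable_const_bound[of "indicator B :: 'a \<Rightarrow> real" 1] B by (auto simp: indicator_def)
  have fh: "integrable \<mu> (\<lambda>x. f x * (T * indicator B x))"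
    using integrable_mult_right[OF integrable_mass[OF f B], of T] by (simp add: mult_ac)
  have ei: "integrable \<mu> (\<lambda>x. exp (T * indicator B x))"
    by (rule integrable_const_bound[where B="max 1 (exp T)"]) (use B in \<open>auto simp: indicator_def\<close>)
  have le: "(LINT x|\<mu>. exp (T * indicator B x)) \<le> measure \<mu> UNIV + exp T * measure \<mu> B"
  proof -
    have ri: "integrable \<mu> (\<lambda>x. 1 + exp T * indicat_real B x)"
      by (intro Bochner_Integration.integrable_add integrable_mult_right bi) auto
    have "(LINT x|\<mu>. exp (T * indicator B x)) \<le> (LINT x|\<mu>. 1 + exp T * indicat_real B x)"
      by (rule integral_mono[OF ei ri]) (auto simp: indicator_def)
    then show ?thesis using bi by simp
  qed
  have "T * (LINT x|\<mu>. f x * indicator B x) = (LINT x|\<mu>. f x * (T * indicator B x))"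
    by (subst integral_mult_right_zero[symmetric]) (simp add: mult_ac)
  also have "\<dots> \<le> ent f + ln (LINT x|\<mu>. exp (T * indicator B x))"
    by (rule gibbs[OF f fh ei])
  also have "ln (LINT x|\<mu>. exp (T * indicator B x)) \<le> ln (measure \<mu> UNIV + exp T * measure \<mu> B)"
    using exp_integral_pos[OF ei] le by (intro ln_mono) auto
  finally show ?thesis by simp
qed

end

section \<open>Kernel moments for the singular Gaussian weight\<close>

definition truncpow :: "real \<Rightarrow> 'a::euclidean_space \<Rightarrow> real" where
  "truncpow s x = norm x powr (-s) * indicator (ball 0 1) x"

lemma truncpow_measurable [measurable]: "truncpow s \<in> borel_measurable (borel :: 'a::euclidean_space measure)"
proof -
  have [measurable]: "ball (0::'a) 1 \<in> sets borel" by simp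
  show ?thesis unfolding truncpow_def[abs_def] by measurable
qed

lemma truncpow_integrable:
  "0 \<le> (s::real) \<Longrightarrow> s < DIM('a) \<Longrightarrow> integrable lborel (truncpow s :: 'a::euclidean_space \<Rightarrow> real)"
  unfolding truncpow_def[abs_def] by (rule integrable_norm_powr_unit_ball)

lemma truncpow_shift:
  fixes y :: "'a::euclidean_space" and s :: real
  assumes "0 \<le> s" "s < DIM('a)"
  shows "integrable lborel (\<lambda>x. truncpow s (y - x))" "(LINT x|lborel. truncpow s (y - x)) = (LINT x|lborel. truncpow s (x::'a))"
  using truncpow_integrable[OF assms] lborel_integral_reflect[of "truncpow s" y] by auto

lemma truncpow_nonneg: "truncpow s x \<ge> 0" by (simp add: truncpow_def)

lemma exp_ln_le_truncpow:
  assumes "b \<ge> 0"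
  shows "exp (- b * ln (norm z)) \<le> 1 + truncpow b (z::'a::euclidean_space)"
proof -
  consider "z = 0" | "z \<noteq> 0" "norm z < 1" | "norm z \<ge> 1" by linarith
  then show ?thesis
  proof cases
    case 2
    then have "exp (- b * ln (norm z)) = truncpow b z" by (simp add: truncpow_def powr_def)
    then show ?thesis by simp
  next
    case 3
    then have "exp (- b * ln (norm z)) \<le> 1" using assms by simp
    then show ?thesis using truncpow_nonneg[of b z] by linarith
  qed (simp add: truncpow_def)
qed

text \<open>A model majorant for the weight that depends neither on l nor on the centre: a power
  singularity at the origin plus a decaying tail that is bounded by 1 and integrable.\<close>

definition domin :: "real \<Rightarrow> 'a::euclidean_space \<Rightarrow> real" where
  "domin s x = truncpow s x + (1 + (norm x)\<^sup>2) powr (- real DIM('a))"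

lemma domin_integrable:
  fixes s :: real
  assumes "0 \<le> s" "s < DIM('a)"
  shows "integrable lborel (domin s :: 'a::euclidean_space \<Rightarrow> real)"
  unfolding domin_def[abs_def]
  by (intro Bochner_Integration.integrable_add truncpow_integrable assms integrable_one_plus_norm_sq_powr) auto

lemma domin_measurable [measurable]: "domin s \<in> borel_measurable borel"
  unfolding domin_def[abs_def] by measurable

lemma domin_nonneg: "domin s x \<ge> 0"
  by (simp add: domin_def truncpow_nonneg)

lemma domin_tail_le_1: "(1 + (norm (x::'a::euclidean_space))\<^sup>2) powr (- real DIM('a)) \<le> 1"
  using powr_mono2'[of "- real DIM('a)" 1 "1 + (norm x)\<^sup>2"] by simp

text \<open>A product of two truncated powers is at most the power of exponent s + \<eta> of
  whichever argument is nearer to 0. Translation and reflection invariance make the resulting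
  integrals independent of y.\<close>

lemma domin_kernel_small:
  fixes s \<eta> :: real
  assumes s: "0 \<le> s" and e: "0 \<le> \<eta>" and se: "s + \<eta> < DIM('a)"
  shows "\<exists>C. \<forall>y::'a::euclidean_space. integrable lborel (\<lambda>x. domin s x * exp (- \<eta> * ln (norm (y - x))))
      \<and> (LINT x|lborel. domin s x * exp (- \<eta> * ln (norm (y - x)))) \<le> C"
proof -
  let ?R = "\<lambda>y x::'a. domin s x + (truncpow (s + \<eta>) x + truncpow (s + \<eta>) (y - x)) + truncpow \<eta> (y - x)"
  have pw: "domin s x * exp (- \<eta> * ln (norm (y - x))) \<le> ?R y x" for x y
  proof -
    have JJ: "truncpow s x * truncpow \<eta> z \<le> truncpow (s + \<eta>) x + truncpow (s + \<eta>) z" for z :: 'a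
    proof (cases "x = 0 \<or> z = 0 \<or> norm x \<ge> 1 \<or> norm z \<ge> 1")
      case True
      then have "truncpow s x * truncpow \<eta> z = 0" by (auto simp: truncpow_def)
      then show ?thesis using truncpow_nonneg[of "s+\<eta>" x] truncpow_nonneg[of "s+\<eta>" z] by linarith
    next
      case False
      show ?thesis
      proof (cases "norm x \<le> norm z")
        case True
        have "truncpow s x * truncpow \<eta> z = norm x powr (-s) * norm z powr (-\<eta>)" using False by (simp add: truncpow_def)
        also have "\<dots> \<le> norm x powr (-s) * norm x powr (-\<eta>)"
          using False True e by (intro mult_left_mono powr_mono2') auto
        also have "\<dots> = truncpow (s + \<eta>) x" using False by (simp add: truncpow_def flip: powr_add)
        finally show ?thesis using truncpow_nonneg[of "s+\<eta>" z] by linarith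
      next
        case F2: False
        have "truncpow s x * truncpow \<eta> z = norm x powr (-s) * norm z powr (-\<eta>)" using False by (simp add: truncpow_def)
        also have "\<dots> \<le> norm z powr (-s) * norm z powr (-\<eta>)"
          using False F2 s by (intro mult_right_mono powr_mono2') auto
        also have "\<dots> = truncpow (s + \<eta>) z" using False by (simp add: truncpow_def flip: powr_add)
        finally show ?thesis using truncpow_nonneg[of "s+\<eta>" x] by linarith
      qed
    qed
    have "domin s x * exp (- \<eta> * ln (norm (y - x))) \<le> domin s x * (1 + truncpow \<eta> (y - x))"
      by (intro mult_left_mono exp_ln_le_truncpow e domin_nonneg)
    also have "\<dots> = domin s x + truncpow s x * truncpow \<eta> (y - x) + (1 + (norm x)\<^sup>2) powr (- real DIM('a)) * truncpow \<eta> (y - x)"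
      by (simp add: domin_def algebra_simps)
    also have "\<dots> \<le> ?R y x"
      using JJ[of "y - x"] mult_right_mono[OF domin_tail_le_1[of x] truncpow_nonneg[of \<eta> "y - x"]] by simp
    finally show ?thesis .
  qed
  have Ri: "integrable lborel (?R y)" for y
    using s e se by (intro Bochner_Integration.integrable_add domin_integrable truncpow_integrable truncpow_shift) auto
  have Li: "integrable lborel (\<lambda>x. domin s x * exp (- \<eta> * ln (norm (y - x))))" for y :: 'a
    by (rule integrable_nonneg_bound[OF Ri[of y] _ _ pw]) (auto simp: domin_nonneg)
  have eq: "(LINT x|lborel. ?R y x) = (LINT x|lborel. ?R 0 x)" for y
    using s e se domin_integrable[of s, where 'a='a] truncpow_integrable[of "s+\<eta>", where 'a='a] truncpow_shift[of "s+\<eta>" y] truncpow_shift[of \<eta> y]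
      truncpow_shift[of "s+\<eta>" "0::'a"] truncpow_shift[of \<eta> "0::'a"] by simp
  have "(LINT x|lborel. domin s x * exp (- \<eta> * ln (norm (y - x)))) \<le> (LINT x|lborel. ?R 0 x)" for y :: 'a
    unfolding eq[of y, symmetric] by (rule integral_mono[OF Li Ri pw])
  then show ?thesis using Li by blast
qed

text \<open>If |y| \<ge> 1 the singularities 0 and y are separated, so every x is at distance at
  least 1/2 from one of them and that factor is bounded by 2^s or 2^b. Hence s and b need only be
  below n separately, whereas \<open>domin_kernel_small\<close> constrains their sum.\<close>

lemma domin_kernel_far:
  fixes s b :: real
  assumes s: "0 \<le> s" "s < DIM('a)" and b: "0 \<le> b" "b < DIM('a)"
  shows "\<exists>C. \<forall>y::'a::euclidean_space. norm y \<ge> 1 \<longrightarrow> integrable lborel (\<lambda>x. domin s x * exp (- b * ln (norm (y - x))))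
      \<and> (LINT x|lborel. domin s x * exp (- b * ln (norm (y - x)))) \<le> C"
proof -
  let ?R = "\<lambda>y x::'a. domin s x + (2 powr b * truncpow s x + 2 powr s * truncpow b (y - x)) + truncpow b (y - x)"
  have pw: "domin s x * exp (- b * ln (norm (y - x))) \<le> ?R y x" if y: "norm y \<ge> 1" for x y
  proof -
    have half: "norm z powr (- c) \<le> 2 powr c" if "norm z \<ge> 1/2" "c \<ge> 0" for z :: 'a and c
    proof -
      have "norm z powr (- c) \<le> (1/2) powr (- c)" using that by (intro powr_mono2') auto
      then show ?thesis by (simp add: powr_minus powr_divide)
    qed
    have truncpow_le: "truncpow c z \<le> norm z powr (- c)" for c and z :: 'a by (simp add: truncpow_def indicator_def)
    have JJ: "truncpow s x * truncpow b (y - x) \<le> 2 powr b * truncpow s x + 2 powr s * truncpow b (y - x)"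
    proof (cases "norm x \<ge> 1/2")
      case True
      have "truncpow s x \<le> 2 powr s" using truncpow_le[of s x] half[OF True s(1)] by linarith
      then have "truncpow s x * truncpow b (y - x) \<le> 2 powr s * truncpow b (y - x)" by (intro mult_right_mono truncpow_nonneg)
      moreover have "2 powr b * truncpow s x \<ge> 0" by (simp add: truncpow_nonneg)
      ultimately show ?thesis by linarith
    next
      case False
      then have "norm (y - x) \<ge> 1/2" using y norm_triangle_ineq2[of y x] by linarith
      then have "truncpow b (y - x) \<le> 2 powr b" using truncpow_le[of b "y - x"] half b(1) by fastforce
      then have "truncpow s x * truncpow b (y - x) \<le> truncpow s x * 2 powr b" by (intro mult_left_mono truncpow_nonneg)
      moreover have "2 powr s * truncpow b (y - x) \<ge> 0" by (simp add: truncpow_nonneg)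
      ultimately show ?thesis by (simp add: mult.commute)
    qed
    have "domin s x * exp (- b * ln (norm (y - x))) \<le> domin s x * (1 + truncpow b (y - x))"
      by (intro mult_left_mono exp_ln_le_truncpow b domin_nonneg)
    also have "\<dots> = domin s x + truncpow s x * truncpow b (y - x) + (1 + (norm x)\<^sup>2) powr (- real DIM('a)) * truncpow b (y - x)"
      by (simp add: domin_def algebra_simps)
    also have "\<dots> \<le> ?R y x"
      using JJ mult_right_mono[OF domin_tail_le_1[of x] truncpow_nonneg[of b "y - x"]] by simp
    finally show ?thesis .
  qed
  have Ri: "integrable lborel (?R y)" for y
    using s b by (intro Bochner_Integration.integrable_add integrable_mult_right domin_integrable truncpow_integrable truncpow_shift) auto
  have Li: "integrable lborel (\<lambda>x. domin s x * exp (- b * ln (norm (y - x))))" if "norm y \<ge> 1" for y :: 'a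
    by (rule integrable_nonneg_bound[OF Ri[of y] _ _ pw[OF that]]) (auto simp: domin_nonneg)
  have eq: "(LINT x|lborel. ?R y x) = (LINT x|lborel. ?R 0 x)" for y
    using s b domin_integrable[of s, where 'a='a] truncpow_integrable[of s, where 'a='a] truncpow_shift[of b y] truncpow_shift[of b "0::'a"] by simp
  have "(LINT x|lborel. domin s x * exp (- b * ln (norm (y - x)))) \<le> (LINT x|lborel. ?R 0 x)" if "norm y \<ge> 1" for y :: 'a
    unfolding eq[of y, symmetric] by (rule integral_mono[OF Li[OF that] Ri pw[OF that]])
  then show ?thesis using Li by blast
qed

definition weight :: "real \<Rightarrow> real \<Rightarrow> 'a::euclidean_space \<Rightarrow> 'a \<Rightarrow> real" where
  "weight \<alpha> l p x = norm x powr (real DIM('a) * \<alpha>) * exp (- (real DIM('a) * l * (norm (x - p))\<^sup>2))"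

lemma weight_measurable [measurable]: "weight \<alpha> l p \<in> borel_measurable borel"
  unfolding weight_def[abs_def] by measurable

lemma weight_nonneg: "weight \<alpha> l p x \<ge> 0" by (simp add: weight_def)

lemma weight_pos: "x \<noteq> 0 \<Longrightarrow> weight \<alpha> l p x > 0" by (simp add: weight_def)

lemma weight_mono: "1 \<le> l \<Longrightarrow> weight \<alpha> l p x \<le> weight \<alpha> 1 p x"
  unfolding weight_def by (intro mult_left_mono) (auto simp: mult_right_mono mult_left_mono)

text \<open>The singular exponent s is n max(-\<alpha>, 0), and the Gaussian absorbs the polynomial
  growth of the case \<alpha> > 0. The factor exp |x| is included to supply the exponential moment
  of the gas. Only l = 1 is treated, since the weight decreases in l.\<close>

lemma weight_le_domin:
  fixes p :: "'a::euclidean_space"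
  defines "N \<equiv> real DIM('a)"
  assumes s: "s = N * max (-\<alpha>) 0"
  shows "\<exists>C>0. \<forall>x. weight \<alpha> 1 p x * exp (norm x) \<le> C * domin s x"
proof -
  define k where "k = nat \<lceil>N * \<bar>\<alpha>\<bar>\<rceil>"
  have k: "N * \<bar>\<alpha>\<bar> \<le> real k" unfolding k_def by linarith
  have N: "N \<ge> 1" by (simp add: N_def Suc_leI)
  define C1 where "C1 = (real (Suc (k + DIM('a))) / (1/4)) ^ (k + DIM('a)) * exp (1/4)"
  have C1: "C1 > 0" by (simp add: C1_def)
  define C where "C = exp 1 + exp (N * (norm p)\<^sup>2 + 1) * C1"
  have "weight \<alpha> 1 p x * exp (norm x) \<le> C * domin s x" for x :: 'a
  proof (cases "norm x < 1")
    case True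
    have "norm x powr (N * \<alpha>) \<le> norm x powr (- s)"
    proof (cases "x = 0")
      case False
      have "N * \<alpha> \<ge> - s" using N by (cases "\<alpha> \<ge> 0") (auto simp: s max_def)
      then show ?thesis using True False by (intro powr_mono') auto
    qed simp
    moreover have "exp (- (N * (norm (x - p))\<^sup>2)) * exp (norm x) \<le> exp 1"
      using True N by (simp flip: exp_add) (smt (verit) zero_le_mult_iff zero_le_power2)
    ultimately have "weight \<alpha> 1 p x * exp (norm x) \<le> norm x powr (- s) * exp 1"
      unfolding weight_def N_def[symmetric] mult.assoc mult_1 mult_1_right by (intro mult_mono) (auto simp: mult_ac)
    also have "norm x powr (- s) = truncpow s x" using True by (simp add: truncpow_def)
    also have "truncpow s x * exp 1 \<le> domin s x * C"
      using C1 by (intro mult_mono) (auto simp: domin_def C_def truncpow_nonneg add_nonneg_nonneg)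
    finally show ?thesis by (simp add: mult.commute)
  next
    case False
    define q where "q = (norm x)\<^sup>2"
    have q: "q \<ge> 1" using False by (simp add: q_def)
    have x0: "norm x > 0" using False by linarith
    have e1: "norm x powr (N * \<alpha>) \<le> (1 + q) ^ k"
    proof -
      have "norm x powr (N * \<alpha>) \<le> norm x powr (real k)"
      proof (rule powr_mono)
        have "N * \<alpha> \<le> N * \<bar>\<alpha>\<bar>" using N by (intro mult_left_mono) auto
        then show "N * \<alpha> \<le> real k" using k by linarith
      qed (use False in auto)
      also have "\<dots> = norm x ^ k" using x0 by (simp add: powr_realpow)
      also have "\<dots> \<le> (1 + q) ^ k"
      proof (rule power_mono)
        have "norm x \<le> norm x * norm x" using False mult_left_mono[of 1 "norm x" "norm x"] by simp
        then show "norm x \<le> 1 + q" by (simp add: q_def power2_eq_square)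
      qed simp
      finally show ?thesis .
    qed
    \<comment> \<open>From q \<le> 2|x - p|^2 + 2|p|^2 the Gaussian leaves exp(-q/2). Half of that
      exponent pays for exp |x|, because |x| \<le> 1 + q/4.\<close>
    have e2: "exp (- (N * (norm (x - p))\<^sup>2)) * exp (norm x) \<le> exp (N * (norm p)\<^sup>2 + 1) * exp (- q / 4)"
    proof -
      have "q \<le> (norm (x - p) + norm p)\<^sup>2"
        unfolding q_def using norm_triangle_ineq[of "x - p" p] by (intro power_mono) auto
      also have "\<dots> \<le> 2 * (norm (x - p))\<^sup>2 + 2 * (norm p)\<^sup>2"
        using sum_squares_bound[of "norm (x - p)" "norm p"] by (simp add: power2_sum)
      finally have "N * (q / 2 - (norm p)\<^sup>2) \<le> N * (norm (x - p))\<^sup>2"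
        using N by (intro mult_left_mono) auto
      moreover have "q / 2 \<le> N * (q / 2)" using N q by simp
      moreover have "norm x \<le> 1 + q / 4"
        using zero_le_power2[of "norm x - 2"] by (simp add: q_def power2_eq_square algebra_simps)
      ultimately have "- (N * (norm (x - p))\<^sup>2) + norm x \<le> N * (norm p)\<^sup>2 + 1 + - q / 4"
        by (simp add: right_diff_distrib)
      then show ?thesis by (simp flip: exp_add)
    qed
    have e3: "(1 + q) ^ k * exp (- q / 4) \<le> C1 * (1 + q) powr (- N)"
    proof -
      have "(1 + q) ^ (k + DIM('a)) \<le> C1 * exp (1/4 * q)"
        using one_plus_power_le_exp[of "1/4" q "k + DIM('a)"] q by (simp add: C1_def)
      then have "(1 + q) ^ (k + DIM('a)) * exp (- q / 4) \<le> C1 * exp (1/4 * q) * exp (- q / 4)"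
        by (intro mult_right_mono) auto
      also have "\<dots> = C1" by (simp add: mult.assoc flip: exp_add)
      finally have "(1 + q) ^ k * exp (- q / 4) * (1 + q) ^ DIM('a) \<le> C1" by (simp add: power_add mult_ac)
      then show ?thesis using q by (simp add: N_def powr_minus powr_realpow field_simps)
    qed
    have "weight \<alpha> 1 p x * exp (norm x) = norm x powr (N * \<alpha>) * (exp (- (N * (norm (x - p))\<^sup>2)) * exp (norm x))"
      by (simp add: weight_def N_def)
    also have "\<dots> \<le> (1 + q) ^ k * (exp (N * (norm p)\<^sup>2 + 1) * exp (- q / 4))"
      using q by (intro mult_mono[OF e1 e2]) auto
    also have "\<dots> \<le> exp (N * (norm p)\<^sup>2 + 1) * (C1 * (1 + q) powr (- N))"
      using mult_left_mono[OF e3, of "exp (N * (norm p)\<^sup>2 + 1)"] by (simp add: mult_ac)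
    also have "\<dots> \<le> C * domin s x"
      unfolding mult.assoc[symmetric]
      by (intro mult_mono) (auto simp: C_def domin_def q_def N_def truncpow_nonneg C1 less_imp_le add_nonneg_nonneg)
    finally show ?thesis .
  qed
  moreover have "C > 0" using C1 by (simp add: C_def add_pos_nonneg)
  ultimately show ?thesis by blast
qed

text \<open>The constant is the one for l = 1, so all moment bounds are uniform in l and l can be
  fixed after every other constant.\<close>

lemma integrable_weight_mult:
  fixes p :: "'a::euclidean_space"
  assumes l: "l \<ge> 1" and C: "\<And>x. weight \<alpha> 1 p x * exp (norm x) \<le> C * domin s x"
    and [measurable]: "h \<in> borel_measurable borel" and h: "\<And>x. 0 \<le> h x"
    and i: "integrable lborel (\<lambda>x. domin s x * h x)"
  shows "integrable lborel (\<lambda>x. weight \<alpha> l p x * h x)"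
    and "(LINT x|lborel. weight \<alpha> l p x * h x) \<le> C * (LINT x|lborel. domin s x * h x)"
proof -
  have le: "weight \<alpha> l p x * h x \<le> C * (domin s x * h x)" for x
  proof -
    have "weight \<alpha> l p x \<le> weight \<alpha> 1 p x" by (rule weight_mono[OF l])
    also have "\<dots> \<le> weight \<alpha> 1 p x * exp (norm x)" using weight_nonneg[of \<alpha> 1 p x] by (simp add: mult_le_cancel_left1)
    also have "\<dots> \<le> C * domin s x" by (rule C)
    finally have "weight \<alpha> l p x * h x \<le> C * domin s x * h x" using h by (intro mult_right_mono)
    then show ?thesis by (simp add: mult.assoc)
  qed
  show w: "integrable lborel (\<lambda>x. weight \<alpha> l p x * h x)"
    by (rule integrable_nonneg_bound[OF integrable_mult_right[OF i, of C] _ _ le]) (auto simp: h weight_nonneg)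
  have "(LINT x|lborel. weight \<alpha> l p x * h x) \<le> (LINT x|lborel. C * (domin s x * h x))"
    by (rule integral_mono[OF w integrable_mult_right[OF i] le])
  then show "(LINT x|lborel. weight \<alpha> l p x * h x) \<le> C * (LINT x|lborel. domin s x * h x)" by simp
qed

section \<open>Choice of constants and existence of the equilibrium\<close>

text \<open>Everything up to \<kappa> and \<delta> is independent of l. At mass \<delta> in the unit
  ball the energy is at least \<kappa> N (l - 1) \<delta> - L, while a trial density concentrated in
  a ball of radius r about p costs at most c0 + N l r^2. With r^2 \<le> \<kappa>\<delta>/2 the
  barrier grows at least twice as fast in l, and a large l separates the two.\<close>

theorem gas_equilibrium_exists:
  fixes \<alpha> \<beta> :: real
  assumes \<alpha>: "\<alpha> > -1" and \<beta>: "0 < \<beta>" "\<beta> < DIM('a::euclidean_space)"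
  shows "\<exists>l (p::'a) \<rho> Z A. \<rho> \<in> borel_measurable borel \<and> (\<forall>x. 0 \<le> \<rho> x) \<and> integrable lborel \<rho> \<and>
     (LINT x|lborel. \<rho> x) = 1 \<and> Z > 0 \<and>
     (\<forall>x. \<rho> x = weight \<alpha> l p x * exp (- 2 * \<beta> * (LINT y|lborel. ln (norm (x - y)) * \<rho> y)) / Z) \<and>
     (\<forall>x. integrable lborel (\<lambda>y. ln (norm (x - y)) * \<rho> y)) \<and>
     (\<forall>x. (LINT y|lborel. \<bar>ln (norm (x - y)) * \<rho> y\<bar>) \<le> A * (1 + norm x))"
proof -
  define N where "N = real DIM('a)"
  have N: "N \<ge> 1" by (simp add: N_def Suc_leI)
  define s where "s = N * max (-\<alpha>) 0"
  have s: "0 \<le> s" "s < N" using N \<alpha> by (auto simp: s_def max_def)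
  define \<eta> where "\<eta> = min 1 ((N - s) / 2)"
  have eta: "0 < \<eta>" "\<eta> \<le> 1" "s + \<eta> < N" using s by (auto simp: \<eta>_def min_def field_simps)
  \<comment> \<open>Any exponent strictly between \<beta> and N serves: above \<beta> for
    coercivity, below N for integrability.\<close>
  define b where "b = (\<beta> + N) / 2"
  have b: "\<beta> < b" "b < N" using \<beta> by (auto simp: b_def N_def)
  obtain e :: 'a where e: "e \<in> Basis" using nonempty_Basis by blast
  \<comment> \<open>At distance 2 every point of the unit ball about 0 is at least 1 away from p,
    where the Gaussian suppresses the weight by a factor exp(-N(l - 1)) relative to l = 1.\<close>
  define p where "p = 2 *\<^sub>R e"
  have np: "norm p = 2" using e by (simp add: p_def)
  obtain C where C0: "C > 0" and C: "\<And>x. weight \<alpha> 1 p x * exp (norm x) \<le> C * domin s x"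
    using weight_le_domin[of s \<alpha> p] by (auto simp: s_def N_def)
  obtain Ds where Ds: "\<And>y::'a. integrable lborel (\<lambda>x. domin s x * exp (- \<eta> * ln (norm (y - x))))"
      "\<And>y::'a. (LINT x|lborel. domin s x * exp (- \<eta> * ln (norm (y - x)))) \<le> Ds"
    using domin_kernel_small[of s \<eta>, where 'a='a] s eta by (auto simp: N_def simp del: mult_minus_left)
  obtain Df where Df: "\<And>y::'a. norm y \<ge> 1 \<Longrightarrow> integrable lborel (\<lambda>x. domin s x * exp (- b * ln (norm (y - x))))"
      "\<And>y::'a. norm y \<ge> 1 \<Longrightarrow> (LINT x|lborel. domin s x * exp (- b * ln (norm (y - x)))) \<le> Df"
    using domin_kernel_far[of s b, where 'a='a] s b \<beta> by (auto simp: N_def simp del: mult_minus_left)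
  define V1 where "V1 = C * (LINT x|lborel. domin s (x::'a))"
  \<comment> \<open>One bound for the logarithms of all partition integrals that occur. The factor 2
    accommodates the total mass plus the amplified mass of the unit ball, each at most
    \<open>V1\<close>.\<close>
  define L where "L = max (ln (C * Ds)) (max (ln (C * Df)) (ln (2 * V1)))"
  define \<kappa> where "\<kappa> = (1 - \<beta> / b) / 2"
  have k: "\<kappa> > 0" using b \<beta> by (simp add: \<kappa>_def)
  define \<delta> where "\<delta> = (1 - \<beta> / b) * \<eta> / (2 * \<beta>)"
  have d: "\<delta> > 0" using b \<beta> eta by (simp add: \<delta>_def)
  \<comment> \<open>The bound 1/2 keeps the trial ball off the unit ball and its diameter at most 1;
    the square root keeps N l r^2 below half of the barrier slope N\<kappa>\<delta> l.\<close>
  define r where "r = min (1/2) (sqrt (\<kappa> * \<delta> / 2))"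
  have r: "0 < r" "r \<le> 1/2" using k d by (auto simp: r_def)
  have r2: "r\<^sup>2 \<le> \<kappa> * \<delta> / 2"
  proof -
    have "r\<^sup>2 \<le> (sqrt (\<kappa> * \<delta> / 2))\<^sup>2" using r by (intro power_mono) (auto simp: r_def)
    then show ?thesis using k d by simp
  qed
  define V where "V = measure lborel (ball p r)"
  have V: "V > 0" unfolding V_def using r content_ball_pos[of r p] by simp
  define c0 where "c0 = - ln V + N * \<bar>\<alpha>\<bar> * ln 3"
  \<comment> \<open>Solved from \<open>l2\<close>, the inequality by which the barrier clears the
    trial energy; the summand 1 makes it strict.\<close>
  define l where "l = max 1 (2 * (c0 + L + \<kappa> * N * \<delta> + 1) / (N * \<kappa> * \<delta>))"
  have l1: "l \<ge> 1" by (simp add: l_def)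
  have l2: "c0 + L + \<kappa> * N * \<delta> + 1 \<le> l * (N * \<kappa> * \<delta> / 2)"
  proof -
    have pos: "N * \<kappa> * \<delta> > 0" using N k d by simp
    have "2 * (c0 + L + \<kappa> * N * \<delta> + 1) / (N * \<kappa> * \<delta>) \<le> l" by (simp add: l_def)
    then show ?thesis using pos by (simp add: divide_le_eq mult.commute mult.left_commute)
  qed
  define K where "K = (weight \<alpha> l p :: 'a \<Rightarrow> real)"
  have [measurable]: "K \<in> borel_measurable borel" unfolding K_def by measurable
  have K0: "K x \<ge> 0" for x by (simp add: K_def weight_nonneg)
  have Kpos: "x \<noteq> 0 \<Longrightarrow> K x > 0" for x by (simp add: K_def weight_pos)
  note wi = integrable_weight_mult[OF l1 C, folded K_def]
  have di: "integrable lborel (domin s :: 'a \<Rightarrow> real)" using s by (intro domin_integrable) (auto simp: N_def)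
  have Ki: "integrable lborel K" and KV: "(LINT x|lborel. K x) \<le> V1"
    using wi[of "\<lambda>_. 1"] di by (auto simp: V1_def)
  define \<mu> where "\<mu> = density lborel (\<lambda>x. ennreal (K x))"
  have sets: "sets \<mu> = sets borel" by (simp add: \<mu>_def)
  have space: "space \<mu> = UNIV" by (simp add: \<mu>_def)
  note [measurable_cong] = sets
  have int_iff: "integrable \<mu> h \<longleftrightarrow> integrable lborel (\<lambda>x. K x * h x)" if "h \<in> borel_measurable borel" for h :: "'a \<Rightarrow> real"
    unfolding \<mu>_def using that K0 by (intro integrable_real_density) auto
  have int_eq: "(LINT x|\<mu>. h x) = (LINT x|lborel. K x * h x)" if "h \<in> borel_measurable borel" for h :: "'a \<Rightarrow> real"
    unfolding \<mu>_def using that K0 by (intro integral_real_density) auto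
  have eU: "emeasure \<mu> UNIV = ennreal (LINT x|lborel. K x)"
    unfolding \<mu>_def using Ki K0 by (subst emeasure_density) (auto simp: nn_integral_eq_integral)
  have mU: "measure \<mu> UNIV = (LINT x|lborel. K x)"
    unfolding measure_def eU by (simp add: integral_nonneg_AE K0)
  have fin: "finite_measure \<mu>" by (rule finite_measureI) (simp add: space eU)
  interpret fm: finite_measure \<mu> by (rule fin)
  have mpos: "measure \<mu> UNIV > 0"
  proof -
    have "(LINT x|lborel. K x) \<noteq> 0"
    proof
      assume "(LINT x|lborel. K x) = 0"
      then have "AE x in lborel. K x = 0" using K0 by (subst (asm) integral_nonneg_eq_0_iff_AE[OF Ki]) auto
      then have "AE x in (lborel::'a measure). False" using AE_lborel_neq[of "0::'a"]
        by eventually_elim (use Kpos in fastforce)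
      then show False by (simp add: AE_iff_measurable[OF _ refl] emeasure_lborel_UNIV)
    qed
    moreover have "(LINT x|lborel. K x) \<ge> 0" by (rule integral_nonneg_AE) (use K0 in auto)
    ultimately show ?thesis using mU by linarith
  qed
  interpret G: log_gas \<mu> \<beta> \<eta> "C * Ds"
  proof
    show "emeasure \<mu> {x} = 0" for x
    proof -
      have "(\<integral>\<^sup>+y. ennreal (K y) * indicator {x} y \<partial>lborel) = (\<integral>\<^sup>+(y::'a). 0 \<partial>lborel)"
      proof (rule nn_integral_cong_AE)
        show "AE y in lborel. ennreal (K y) * indicator {x} y = 0"
          using AE_lborel_neq[of x] by eventually_elim auto
      qed
      then show ?thesis unfolding \<mu>_def by (subst emeasure_density) auto
    qed
    show "integrable \<mu> (\<lambda>y. exp (norm y))"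
    proof (subst int_iff)
      have "weight \<alpha> l p x * exp (norm x) \<le> C * domin s x" for x
        by (rule order_trans[OF mult_right_mono[OF weight_mono[OF l1]] C]) simp
      then show "integrable lborel (\<lambda>x. K x * exp (norm x))"
        unfolding K_def
        by (intro integrable_nonneg_bound[OF integrable_mult_right[OF di, of C]]) (auto simp: weight_nonneg)
    qed auto
    show "integrable \<mu> (\<lambda>y. exp (- \<eta> * ln (norm (x - y))))" for x
      by (subst int_iff; (rule wi(1)[OF _ _ Ds(1)])?; simp)
    show "(LINT y|\<mu>. exp (- \<eta> * ln (norm (x - y)))) \<le> C * Ds" for x
    proof (subst int_eq)
      have "(LINT y|lborel. K y * exp (- \<eta> * ln (norm (x - y)))) \<le> C * (LINT y|lborel. domin s y * exp (- \<eta> * ln (norm (x - y))))"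
        by (rule wi(2)[OF _ _ Ds(1)]) simp_all
      also have "\<dots> \<le> C * Ds" using Ds(2)[of x] C0 by (intro mult_left_mono) auto
      finally show "(LINT y|lborel. K y * exp (- \<eta> * ln (norm (x - y)))) \<le> C * Ds" .
    qed auto
  qed (use fin sets mpos \<beta> eta fm.finite_emeasure_space in auto)
  define B where "B = ball (0::'a) 1"
  have B: "B \<in> sets borel" by (simp add: B_def)
  have far_i: "integrable \<mu> (\<lambda>x. exp (- b * ln (norm (y - x))))" if "y \<notin> B" for y
  proof -
    have "norm y \<ge> 1" using that by (simp add: B_def)
    note * = wi(1)[OF _ _ Df(1)[OF this]]
    show ?thesis by (subst int_iff, measurable, rule *) simp_all
  qed
  have far_le: "(LINT x|\<mu>. exp (- b * ln (norm (y - x)))) \<le> C * Df" if "y \<notin> B" for y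
  proof (subst int_eq)
    have y: "norm y \<ge> 1" using that by (simp add: B_def)
    have "(LINT x|lborel. K x * exp (- b * ln (norm (y - x)))) \<le> C * (LINT x|lborel. domin s x * exp (- b * ln (norm (y - x))))"
      by (rule wi(2)[OF _ _ Df(1)[OF y]]) simp_all
    also have "\<dots> \<le> C * Df" using Df(2)[of y] that C0 by (intro mult_left_mono) (auto simp: B_def)
    finally show "(LINT x|lborel. K x * exp (- b * ln (norm (y - x)))) \<le> C * Df" .
  qed auto
  have L1: "ln (LINT x|\<mu>. exp (- b * ln (norm (y - x)))) \<le> L" if "y \<notin> B" for y
  proof -
    have "ln (LINT x|\<mu>. exp (- b * ln (norm (y - x)))) \<le> ln (C * Df)"
      using far_le[OF that] G.exp_integral_pos[OF far_i[OF that]] by (intro ln_mono) auto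
    then show ?thesis by (simp add: L_def)
  qed
  have L2: "ln (C * Ds) \<le> L" by (simp add: L_def)
  have V1: "V1 > 0" using mpos KV mU by linarith
  have L3: "ln (measure \<mu> UNIV) \<le> L"
  proof -
    have "ln (measure \<mu> UNIV) \<le> ln (2 * V1)" using mpos KV mU V1 by (intro ln_mono) auto
    then show ?thesis by (simp add: L_def)
  qed
  have free_ge: "\<kappa> * (G.ent f + L) - L \<le> G.free f" "0 \<le> G.ent f + L"
    if "G.dens f" "(LINT x|\<mu>. f x * indicator B x) \<le> \<delta>" for f
    using G.free_ge[OF that(1) B b(1) far_i L1 L2 L3] that(2) unfolding \<delta>_def \<kappa>_def by auto
  \<comment> \<open>On B one has |x - p| \<ge> 1, so the factor exp(N(l - 1)) is absorbed when
    passing from the weight at l to the weight at 1.\<close>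
  have barB: "exp (N * (l - 1)) * measure \<mu> B \<le> V1"
  proof -
    have "measure \<mu> B = (LINT x|\<mu>. indicator B x)" using B by (simp add: sets)
    also have "\<dots> = (LINT x|lborel. K x * indicator B x)" using B by (intro int_eq) auto
    finally have "exp (N * (l - 1)) * measure \<mu> B = (LINT x|lborel. exp (N * (l - 1)) * (K x * indicator B x))" by simp
    also have "\<dots> \<le> (LINT x|lborel. C * domin s (x::'a))"
    proof (rule integral_mono)
      show "integrable lborel (\<lambda>x. exp (N * (l - 1)) * (K x * indicator B x))"
        using B by (intro integrable_mult_right integrable_nonneg_bound[OF Ki]) (auto simp: K0 indicator_def)
      show "integrable lborel (\<lambda>x::'a. C * domin s x)" using di by simp
      show "exp (N * (l - 1)) * (K x * indicator B x) \<le> C * domin s x" for x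
      proof (cases "x \<in> B")
        case True
        then have "norm x < 1" by (simp add: B_def)
        then have "norm (x - p) \<ge> 1" using np norm_triangle_ineq2[of p x] by (simp add: norm_minus_commute)
        then have "(norm (x - p))\<^sup>2 \<ge> 1" by simp
        then have "(l - 1) * 1 \<le> (l - 1) * (norm (x - p))\<^sup>2" using l1 by (intro mult_left_mono) auto
        then have "N * (l - 1) \<le> N * ((l - 1) * (norm (x - p))\<^sup>2)" using N by (intro mult_left_mono) auto
        then have "exp (N * (l - 1)) * exp (- (N * l * (norm (x - p))\<^sup>2)) \<le> exp (- (N * 1 * (norm (x - p))\<^sup>2))"
          by (simp add: algebra_simps flip: exp_add)
        from mult_left_mono[OF this, of "norm x powr (N * \<alpha>)"]
        have "exp (N * (l - 1)) * K x \<le> weight \<alpha> 1 p x"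
          by (simp add: K_def weight_def N_def mult_ac)
        also have "\<dots> \<le> weight \<alpha> 1 p x * exp (norm x)" using weight_nonneg[of \<alpha> 1 p x] by (simp add: mult_le_cancel_left1)
        also have "\<dots> \<le> C * domin s x" by (rule C)
        finally show ?thesis using True by simp
      qed (use C0 domin_nonneg[of s x] in simp)
    qed
    finally show ?thesis by (simp add: V1_def)
  qed
  define F0 where "F0 = c0 + N * l * r\<^sup>2"
  have barrier: "G.free f > F0" if f: "G.dens f" and m: "(LINT x|\<mu>. f x * indicator B x) = \<delta>" for f
  proof -
    have "G.ent f \<ge> N * (l - 1) * \<delta> - ln (measure \<mu> UNIV + exp (N * (l - 1)) * measure \<mu> B)"
      using G.ent_ge_mass[OF f B, of "N * (l - 1)"] m by simp
    moreover have "ln (measure \<mu> UNIV + exp (N * (l - 1)) * measure \<mu> B) \<le> ln (2 * V1)"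
      using barB KV mU mpos by (intro ln_mono) (auto simp: add_pos_nonneg)
    moreover have "ln (2 * V1) \<le> L" by (simp add: L_def)
    ultimately have "G.ent f + L \<ge> N * (l - 1) * \<delta>" by linarith
    then have "\<kappa> * (G.ent f + L) \<ge> \<kappa> * (N * (l - 1) * \<delta>)" using k by (intro mult_left_mono) auto
    moreover have "G.free f \<ge> \<kappa> * (G.ent f + L) - L" using m by (intro free_ge(1)[OF f]) auto
    ultimately have "G.free f \<ge> \<kappa> * (N * (l - 1) * \<delta>) - L" by linarith
    moreover define X where "X = l * (N * \<kappa> * \<delta> / 2)"
    moreover have "\<kappa> * (N * (l - 1) * \<delta>) = 2 * X - \<kappa> * N * \<delta>" by (simp add: X_def algebra_simps)
    moreover have "N * l * r\<^sup>2 \<le> X"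
    proof -
      have "N * l * r\<^sup>2 \<le> N * l * (\<kappa> * \<delta> / 2)" using r2 N l1 by (intro mult_left_mono) auto
      then show ?thesis by (simp add: X_def mult_ac)
    qed
    moreover have "c0 + L + \<kappa> * N * \<delta> + 1 \<le> X" unfolding X_def by (rule l2)
    ultimately show ?thesis unfolding F0_def by linarith
  qed
  have bsets: "ball p r \<in> sets borel" by simp
  \<comment> \<open>The uniform distribution on the trial ball, as a density relative to \<mu>. On
    that ball 1 \<le> |x| \<le> 3 bounds K from below and yields f0 \<le> exp F0, hence entropy at
    most \<open>F0\<close>.\<close>
  define f0 where "f0 x = indicator (ball p r) x / (V * K x)" for x
  have Kball: "K x \<ge> exp (- (N * \<bar>\<alpha>\<bar> * ln 3 + N * l * r\<^sup>2))" "x \<noteq> 0" if "x \<in> ball p r" for x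
  proof -
    have xp: "norm (x - p) < r" using that by (simp add: dist_norm norm_minus_commute)
    have n1: "norm x \<ge> 1" using xp r np norm_triangle_ineq2[of p "p - x"] by (simp add: norm_minus_commute)
    have n3: "norm x \<le> 3" using xp r np norm_triangle_ineq[of p "x - p"] by simp
    show x0: "x \<noteq> 0" using n1 by auto
    have "ln (norm x) \<le> ln 3" "0 \<le> ln (norm x)" using n1 n3 by (auto intro!: ln_mono)
    then have "\<bar>\<alpha> * ln (norm x)\<bar> \<le> \<bar>\<alpha>\<bar> * ln 3"
      unfolding abs_mult by (intro mult_left_mono) auto
    then have "- (\<bar>\<alpha>\<bar> * ln 3) \<le> \<alpha> * ln (norm x)" by linarith
    then have "N * - (\<bar>\<alpha>\<bar> * ln 3) \<le> N * (\<alpha> * ln (norm x))" using N by (intro mult_left_mono) auto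
    moreover have "N * l * (norm (x - p))\<^sup>2 \<le> N * l * r\<^sup>2"
      using xp N l1 by (intro mult_left_mono power_mono) auto
    ultimately have "- (N * \<bar>\<alpha>\<bar> * ln 3 + N * l * r\<^sup>2) \<le> N * \<alpha> * ln (norm x) + - (N * l * (norm (x - p))\<^sup>2)"
      by (simp add: algebra_simps)
    then have "exp (- (N * \<bar>\<alpha>\<bar> * ln 3 + N * l * r\<^sup>2)) \<le> exp (N * \<alpha> * ln (norm x)) * exp (- (N * l * (norm (x - p))\<^sup>2))"
      by (simp flip: exp_add)
    also have "exp (N * \<alpha> * ln (norm x)) = norm x powr (N * \<alpha>)" using x0 by (simp add: powr_def)
    finally show "K x \<ge> exp (- (N * \<bar>\<alpha>\<bar> * ln 3 + N * l * r\<^sup>2))" by (simp add: K_def weight_def N_def)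
  qed
  have f0m[measurable]: "f0 \<in> borel_measurable borel" unfolding f0_def[abs_def] using bsets by measurable
  have f0nn: "f0 x \<ge> 0" for x using V K0[of x] by (simp add: f0_def)
  have f0exp: "f0 x \<le> exp F0" for x
  proof (cases "x \<in> ball p r")
    case True
    have "f0 x = 1 / (V * K x)" using True by (simp add: f0_def)
    also have "\<dots> \<le> 1 / (V * exp (- (N * \<bar>\<alpha>\<bar> * ln 3 + N * l * r\<^sup>2)))"
      using V Kball[OF True] by (intro divide_left_mono mult_left_mono mult_pos_pos Kpos) auto
    also have "\<dots> = exp F0" using V by (simp add: F0_def c0_def exp_add exp_diff exp_minus field_simps)
    finally show ?thesis .
  qed (simp add: f0_def)
  have f0K: "K x * f0 x = indicator (ball p r) x / V" for x
    using Kball(2)[of x] Kpos[of x] V by (cases "x \<in> ball p r") (auto simp: f0_def)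
  have f0d: "G.dens f0"
    unfolding G.dens_def G.bdd_def
  proof (intro conjI allI exI)
    show "\<bar>f0 x\<bar> \<le> exp F0" for x using f0exp[of x] f0nn[of x] by simp
    have "(LINT x|\<mu>. f0 x) = (LINT x|lborel. indicator (ball p r) x / V)"
      by (simp add: int_eq f0K)
    also have "\<dots> = 1" using V by (simp add: V_def)
    finally show "(LINT x|\<mu>. f0 x) = 1" .
  qed (use f0nn in auto)
  have f0mass: "(LINT x|\<mu>. f0 x * indicator B x) < \<delta>"
  proof -
    have "f0 x * indicator B x = 0" for x
    proof (cases "x \<in> ball p r")
      case True
      then have "norm (x - p) < r" by (simp add: dist_norm norm_minus_commute)
      then have "norm x \<ge> 1" using r np norm_triangle_ineq2[of p "p - x"] by (simp add: norm_minus_commute)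
      then show ?thesis by (simp add: B_def)
    qed (simp add: f0_def)
    then have "(\<lambda>x. f0 x * indicator B x) = (\<lambda>x. 0)" by (rule ext)
    then show ?thesis using d by (simp only:) simp
  qed
  have f0free: "G.free f0 \<le> F0"
  proof -
    have "G.ent f0 \<le> (LINT x|\<mu>. F0 * f0 x)"
      unfolding G.ent_def
    proof (rule integral_mono[OF G.ent_integrable[OF f0d] integrable_mult_right[OF G.integrable_bdd[OF G.dens_bdd[OF f0d]]]])
      show "f0 x * ln (f0 x) \<le> F0 * f0 x" for x
      proof (cases "f0 x = 0")
        case False
        then have "ln (f0 x) \<le> F0" using f0exp[of x] f0nn[of x] ln_mono[of "f0 x" "exp F0"] by (simp add: less_le)
        then show ?thesis using f0nn[of x] by (simp add: mult.commute[of F0] mult_left_mono)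
      qed simp
    qed
    also have "\<dots> = F0" using f0d by (simp add: G.dens_def)
    finally have "G.ent f0 \<le> F0" .
    \<comment> \<open>Points of the trial ball are less than 1 apart, so the logarithm is
      nonpositive wherever f0 charges.\<close>
    moreover have "G.en f0 f0 \<le> 0"
    proof -
      have "0 \<le> (LINT x|\<mu>. - (f0 x * G.pot f0 x))"
      proof (intro integral_nonneg_AE always_eventually allI)
        fix x
        show "0 \<le> - (f0 x * G.pot f0 x)"
        proof (cases "x \<in> ball p r")
          case True
          have "0 \<le> (LINT y|\<mu>. - (ln (norm (x - y)) * f0 y))"
          proof (intro integral_nonneg_AE always_eventually allI)
            fix y
            show "0 \<le> - (ln (norm (x - y)) * f0 y)"
            proof (cases "y \<in> ball p r")
              case y: True
              have "norm (x - y) < 1"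
                using True y r norm_triangle_ineq4[of "x - p" "y - p"] by (simp add: dist_norm norm_minus_commute)
              then have "ln (norm (x - y)) \<le> 0" by (cases "x = y") auto
              then show ?thesis using f0nn[of y] by (simp add: mult_nonpos_nonneg)
            qed (simp add: f0_def)
          qed
          then have "G.pot f0 x \<le> 0" by (simp add: G.pot_def)
          then show ?thesis using f0nn[of x] by (simp add: mult_nonneg_nonpos)
        qed (simp add: f0_def)
      qed
      then show ?thesis by (simp add: G.en_def)
    qed
    ultimately show ?thesis unfolding G.free_def using \<beta> by (simp add: mult_nonneg_nonpos add_nonpos_nonpos add_decreasing2)
  qed
  have ex: "\<exists>f. G.dens f \<and> (\<forall>x. f x = G.step f x)"
  proof (rule G.fixed_point_exists[where B=B and \<delta>=\<delta> and ?F0.0=F0 and ?F1.0="- L" and ?H0.0="(F0 + L) / \<kappa> - L" and ?f0.0=f0])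
    fix f assume f: "G.dens f" and m: "(LINT x|\<mu>. f x * indicator B x) \<le> \<delta>"
    show "- L \<le> G.free f"
      using free_ge[OF f m] k mult_nonneg_nonneg[of \<kappa> "G.ent f + L"] by linarith
    assume "G.free f \<le> F0"
    then have "\<kappa> * (G.ent f + L) \<le> F0 + L" using free_ge(1)[OF f m] by linarith
    then show "G.ent f \<le> (F0 + L) / \<kappa> - L" using k by (simp add: field_simps)
  qed (use B barrier f0d f0mass f0free in auto)
  then obtain f where f: "G.dens f" and fs: "\<And>x. f x = G.step f x" by blast
  have fm[measurable]: "f \<in> borel_measurable borel" using f by (simp add: G.dens_def G.bdd_def)
  have fi: "integrable \<mu> f" by (rule G.integrable_bdd[OF G.dens_bdd[OF f]])
  obtain M where M: "\<And>x. \<bar>f x\<bar> \<le> M" using G.dens_bdd[OF f] by (auto simp: G.bdd_def)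
  define \<rho> where "\<rho> x = K x * f x" for x
  have pot: "G.pot f x = (LINT y|lborel. ln (norm (x - y)) * \<rho> y)" for x
    unfolding G.pot_def by (subst int_eq) (auto simp: \<rho>_def mult_ac)
  show ?thesis
  proof (rule exI[of _ l], rule exI[of _ p], rule exI[of _ \<rho>], rule exI[of _ "G.part f"], rule exI[of _ "M * G.A0"],
      intro conjI allI)
    show "\<rho> \<in> borel_measurable borel" unfolding \<rho>_def by measurable
    show "0 \<le> \<rho> x" for x using K0[of x] f by (simp add: \<rho>_def G.dens_def)
    show "integrable lborel \<rho>" using fi by (simp add: int_iff \<rho>_def[abs_def])
    have "(LINT x|\<mu>. f x) = (LINT x|lborel. K x * f x)" by (rule int_eq) simp
    then show "(LINT x|lborel. \<rho> x) = 1" using f by (simp add: \<rho>_def G.dens_def)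
    show "G.part f > 0" by (rule G.exp_pot(2)[OF f])
    show "\<rho> x = weight \<alpha> l p x * exp (- 2 * \<beta> * (LINT y|lborel. ln (norm (x - y)) * \<rho> y)) / G.part f" for x
      unfolding pot[symmetric] using fs[of x] by (simp add: \<rho>_def K_def G.step_def)
    show "integrable lborel (\<lambda>y. ln (norm (x - y)) * \<rho> y)" for x
      using G.pot_integrable[OF G.dens_bdd[OF f], of x] by (subst (asm) int_iff) (auto simp: \<rho>_def mult_ac)
    show "(LINT y|lborel. \<bar>ln (norm (x - y)) * \<rho> y\<bar>) \<le> M * G.A0 * (1 + norm x)" for x
    proof -
      have "(LINT y|lborel. \<bar>ln (norm (x - y)) * \<rho> y\<bar>) = (LINT y|\<mu>. \<bar>ln (norm (x - y)) * f y\<bar>)"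
        by (subst int_eq) (auto simp: \<rho>_def abs_mult K0 mult_ac)
      also have "\<dots> \<le> (LINT y|\<mu>. M * \<bar>ln (norm (x - y))\<bar>)"
        using M by (intro integral_mono integrable_abs G.pot_integrable G.dens_bdd f integrable_mult_right G.ln_integrable)
           (auto simp: abs_mult mult.commute[of M] intro!: mult_left_mono)
      also have "\<dots> \<le> M * (G.A0 * (1 + norm x))"
        using G.ln_abs_integral_le[of x] order_trans[OF abs_ge_zero M[of 0]] by (simp add: mult_left_mono)
      finally show ?thesis by (simp add: mult.assoc)
    qed
  qed
qed

section \<open>Gaussians, Fourier inversion and Schwartz functions\<close>

lemma lborel_integral_scale:
  fixes f :: "'a::euclidean_space \<Rightarrow> 'b::{banach, second_countable_topology}"
  assumes c: "c > 0" and [measurable]: "f \<in> borel_measurable borel"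
  shows "(LINT x|lborel. f x) = c ^ DIM('a) *\<^sub>R (LINT x|lborel. f (c *\<^sub>R x))"
    and "integrable lborel f \<longleftrightarrow> integrable lborel (\<lambda>x. f (c *\<^sub>R x))"
proof -
  have l: "lborel = density (distr lborel borel (\<lambda>x::'a. c *\<^sub>R x)) (\<lambda>_. ennreal (c ^ DIM('a)))"
    using lborel_affine[of c "0::'a"] c by simp
  show "(LINT x|lborel. f x) = c ^ DIM('a) *\<^sub>R (LINT x|lborel. f (c *\<^sub>R x))"
    using c by (subst l, subst integral_density) (auto simp: integral_distr)
  show "integrable lborel f \<longleftrightarrow> integrable lborel (\<lambda>x. f (c *\<^sub>R x))"
    using c integrable_scaleR_right[of "inverse (c ^ DIM('a))" lborel "\<lambda>x. c ^ DIM('a) *\<^sub>R f (c *\<^sub>R x)"]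
    by (subst l, subst integrable_density) (auto simp: integrable_distr_eq)
qed

lemma lborel_nn_integral_scale:
  fixes f :: "'a::euclidean_space \<Rightarrow> ennreal"
  assumes c: "c > 0" and [measurable]: "f \<in> borel_measurable borel"
  shows "(\<integral>\<^sup>+x. f x \<partial>lborel) = ennreal (c ^ DIM('a)) * (\<integral>\<^sup>+x. f (c *\<^sub>R x) \<partial>lborel)"
proof -
  have l: "lborel = density (distr lborel borel (\<lambda>x::'a. c *\<^sub>R x)) (\<lambda>_. ennreal (c ^ DIM('a)))"
    using lborel_affine[of c "0::'a"] c by simp
  show ?thesis
    using c by (subst l, subst nn_integral_density) (auto simp: nn_integral_distr nn_integral_cmult)
qed

lemma integral_lborel_prod:
  fixes f :: "'a::euclidean_space \<Rightarrow> real \<Rightarrow> 'b::{real_normed_field, banach, second_countable_topology}"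
  assumes f: "\<And>b. b \<in> Basis \<Longrightarrow> integrable lborel (f b)"
  shows "(LINT x::'a|lborel. (\<Prod>b\<in>Basis. f b (x \<bullet> b))) = (\<Prod>b\<in>Basis. LINT t|lborel. f b t)"
proof -
  interpret product_sigma_finite "\<lambda>_::'a. lborel :: real measure" by standard
  have [measurable]: "b \<in> Basis \<Longrightarrow> f b \<in> borel_measurable borel" for b
    using f[of b] by (simp add: borel_measurable_integrable)
  have "(LINT x::'a|lborel. (\<Prod>b\<in>Basis. f b (x \<bullet> b)))
      = (LINT g|(\<Pi>\<^sub>M b\<in>(Basis::'a set). lborel). (\<Prod>b\<in>Basis. f b ((\<Sum>b\<in>Basis. g b *\<^sub>R b) \<bullet> b)))"
    by (subst lborel_eq, subst integral_distr) auto
  also have "\<dots> = (LINT g|(\<Pi>\<^sub>M b\<in>(Basis::'a set). lborel). (\<Prod>b\<in>Basis. f b (g b)))"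
    by (intro Bochner_Integration.integral_cong refl prod.cong) simp
  also have "\<dots> = (\<Prod>b\<in>Basis. LINT t|lborel. f b t)"
    by (rule product_integral_prod) (use f in auto)
  finally show ?thesis .
qed

text \<open>A rescaling by sqrt(2t) of the characteristic function of the standard normal law,
  evaluated at u = s/sqrt(2t).\<close>

lemma gaussian_fourier_real:
  fixes t s :: real
  assumes t: "t > 0"
  shows "integrable lborel (\<lambda>x. exp (complex_of_real (- t * x\<^sup>2) + \<i> * complex_of_real (x * s)))"
    and "(LINT x|lborel. exp (complex_of_real (- t * x\<^sup>2) + \<i> * complex_of_real (x * s)))
       = complex_of_real (sqrt (pi / t) * exp (- s\<^sup>2 / (4 * t)))"
proof -
  let ?f = "\<lambda>x. exp (complex_of_real (- t * x\<^sup>2) + \<i> * complex_of_real (x * s))"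
  have ne: "norm (?f x) = exp (- t * x\<^sup>2)" for x by (simp add: norm_exp_eq_Re)
  have [measurable]: "?f \<in> borel_measurable borel"
    by (intro borel_measurable_continuous_onI continuous_intros)
  show "integrable lborel ?f"
    by (rule Bochner_Integration.integrable_bound[OF integrable_gaussian[OF t, where 'a=real]])
       (auto simp: ne)
  define u where "u = s / sqrt (2 * t)"
  have "complex_of_real (exp (- (u\<^sup>2) / 2)) = (CLINT x|std_normal_distribution. iexp (u * x))"
    using char_std_normal_distribution by (simp add: char_def fun_eq_iff)
  also have "\<dots> = (CLINT x|lborel. std_normal_density x *\<^sub>R iexp (u * x))"
    by (subst integral_density) (auto simp: normal_density_nonneg)
  also have "\<dots> = sqrt (2 * t) *\<^sub>R (CLINT x|lborel. std_normal_density (sqrt (2 * t) * x) *\<^sub>R iexp (u * (sqrt (2 * t) * x)))"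
    using lborel_integral_real_affine[of "sqrt (2 * t)" "\<lambda>x. std_normal_density x *\<^sub>R iexp (u * x)" 0] t by simp
  also have "(\<lambda>x. std_normal_density (sqrt (2 * t) * x) *\<^sub>R iexp (u * (sqrt (2 * t) * x))) = (\<lambda>x. (1 / sqrt (2 * pi)) *\<^sub>R ?f x)"
  proof
    fix x
    have "u * (sqrt (2 * t) * x) = x * s" using t by (simp add: u_def)
    moreover have "std_normal_density (sqrt (2 * t) * x) = 1 / sqrt (2 * pi) * exp (- t * x\<^sup>2)"
      using t by (simp add: std_normal_density_def power_mult_distrib)
    ultimately show "std_normal_density (sqrt (2 * t) * x) *\<^sub>R iexp (u * (sqrt (2 * t) * x)) = (1 / sqrt (2 * pi)) *\<^sub>R ?f x"
      by (simp only: exp_add) (simp add: scaleR_conv_of_real exp_of_real[symmetric] del: exp_of_real)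
  qed
  also have "sqrt (2 * t) *\<^sub>R (CLINT x|lborel. (1 / sqrt (2 * pi)) *\<^sub>R ?f x) = (sqrt (2 * t) / sqrt (2 * pi)) *\<^sub>R (CLINT x|lborel. ?f x)"
    by simp
  finally have "(sqrt (2 * t) / sqrt (2 * pi)) *\<^sub>R (CLINT x|lborel. ?f x) = complex_of_real (exp (- (u\<^sup>2) / 2))" by simp
  moreover have "sqrt (2 * t) / sqrt (2 * pi) = 1 / sqrt (pi / t)" using t by (simp add: real_sqrt_mult real_sqrt_divide)
  moreover have "- (u\<^sup>2) / 2 = - s\<^sup>2 / (4 * t)" using t by (simp add: u_def power_divide)
  ultimately have "(1 / sqrt (pi / t)) *\<^sub>R (CLINT x|lborel. ?f x) = complex_of_real (exp (- s\<^sup>2 / (4 * t)))" by simp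
  then have "sqrt (pi / t) *\<^sub>R (1 / sqrt (pi / t)) *\<^sub>R (CLINT x|lborel. ?f x) = sqrt (pi / t) *\<^sub>R complex_of_real (exp (- s\<^sup>2 / (4 * t)))"
    by simp
  then show "(LINT x|lborel. ?f x) = complex_of_real (sqrt (pi / t) * exp (- s\<^sup>2 / (4 * t)))"
    using t by (simp add: scaleR_conv_of_real)
qed

lemma gaussian_fourier:
  fixes \<xi> :: "'a::euclidean_space"
  assumes t: "t > 0"
  shows "(LINT x|lborel. complex_of_real (exp (- t * (norm x)\<^sup>2)) * cis (x \<bullet> \<xi>))
       = complex_of_real ((pi / t) powr (real DIM('a) / 2) * exp (- (norm \<xi>)\<^sup>2 / (4 * t)))"
proof -
  let ?f = "\<lambda>b x. exp (complex_of_real (- t * x\<^sup>2) + \<i> * complex_of_real (x * (\<xi> \<bullet> b)))"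
  have n2: "(norm y)\<^sup>2 = (\<Sum>b\<in>Basis. (y \<bullet> b)\<^sup>2)" for y :: 'a
    unfolding power2_norm_eq_inner by (subst euclidean_inner) (simp add: power2_eq_square)
  have "complex_of_real (exp (- t * (norm x)\<^sup>2)) * cis (x \<bullet> \<xi>) = (\<Prod>b\<in>Basis. ?f b (x \<bullet> b))" for x :: 'a
  proof -
    have "(\<Prod>b\<in>Basis. ?f b (x \<bullet> b)) = exp (\<Sum>b\<in>Basis. complex_of_real (- t * (x \<bullet> b)\<^sup>2) + \<i> * complex_of_real ((x \<bullet> b) * (\<xi> \<bullet> b)))"
      by (rule exp_sum[symmetric]) simp
    also have "(\<Sum>b\<in>Basis. complex_of_real (- t * (x \<bullet> b)\<^sup>2) + \<i> * complex_of_real ((x \<bullet> b) * (\<xi> \<bullet> b)))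
        = complex_of_real (- t * (norm x)\<^sup>2) + \<i> * complex_of_real (x \<bullet> \<xi>)"
      unfolding n2 euclidean_inner[of x \<xi>] by (simp add: sum.distrib sum_distrib_left of_real_sum sum_negf sum_subtractf)
    finally show ?thesis unfolding cis_conv_exp exp_of_real[symmetric] exp_add[symmetric] by (simp only:)
  qed
  then have "(LINT x|lborel. complex_of_real (exp (- t * (norm x)\<^sup>2)) * cis (x \<bullet> \<xi>)) = (LINT x::'a|lborel. (\<Prod>b\<in>Basis. ?f b (x \<bullet> b)))"
    by simp
  also have "\<dots> = (\<Prod>b\<in>(Basis::'a set). LINT x|lborel. ?f b x)"
    by (rule integral_lborel_prod) (rule gaussian_fourier_real(1)[OF t])
  also have "\<dots> = (\<Prod>b\<in>(Basis::'a set). complex_of_real (sqrt (pi / t) * exp (- (\<xi> \<bullet> b)\<^sup>2 / (4 * t))))"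
    by (simp only: gaussian_fourier_real(2)[OF t])
  also have "\<dots> = complex_of_real (sqrt (pi / t) ^ DIM('a) * (\<Prod>b\<in>(Basis::'a set). exp (- (\<xi> \<bullet> b)\<^sup>2 / (4 * t))))"
    by (simp only: of_real_prod[symmetric] prod.distrib prod_constant)
  also have "(\<Prod>b\<in>(Basis::'a set). exp (- (\<xi> \<bullet> b)\<^sup>2 / (4 * t))) = exp (- (norm \<xi>)\<^sup>2 / (4 * t))"
    by (subst exp_sum[symmetric]) (auto simp: n2 sum_divide_distrib sum_negf)
  also have "sqrt (pi / t) ^ DIM('a) = (pi / t) powr (real DIM('a) / 2)"
    using t by (simp add: powr_half_sqrt[symmetric] powr_realpow[symmetric] powr_powr)
  finally show ?thesis .
qed

definition heat :: "real \<Rightarrow> 'a::euclidean_space \<Rightarrow> real" where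
  "heat t z = (4 * pi * t) powr (- (real DIM('a) / 2)) * exp (- (norm z)\<^sup>2 / (4 * t))"

lemma heat_measurable [measurable]: "heat t \<in> borel_measurable borel"
  unfolding heat_def[abs_def] by measurable

lemma heat_nonneg: "heat t z \<ge> 0" by (simp add: heat_def)

lemma heat_integrable:
  assumes "t > 0"
  shows "integrable lborel (\<lambda>z::'a::euclidean_space. (1 + (norm z)\<^sup>2) ^ j * heat t z)"
proof -
  have "integrable lborel (\<lambda>z::'a. (4 * pi * t) powr (- (real DIM('a) / 2)) * ((1 + (norm z)\<^sup>2) ^ j * exp (- (1 / (4 * t)) * (norm z)\<^sup>2)))"
    using assms by (intro integrable_mult_right integrable_weighted_gaussian) auto
  then show ?thesis by (simp add: heat_def mult_ac)
qed

lemma heat_fourier: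
  fixes \<xi> :: "'a::euclidean_space"
  assumes t: "t > 0"
  shows "(LINT z|lborel. complex_of_real (heat t z) * cis (z \<bullet> \<xi>)) = complex_of_real (exp (- t * (norm \<xi>)\<^sup>2))"
proof -
  have "(LINT z|lborel. complex_of_real (heat t z) * cis (z \<bullet> \<xi>))
     = complex_of_real ((4 * pi * t) powr (- (real DIM('a) / 2))) * (LINT z|lborel. complex_of_real (exp (- (1 / (4 * t)) * (norm z)\<^sup>2)) * cis (z \<bullet> \<xi>))"
    by (subst integral_mult_right_zero[symmetric]) (simp add: heat_def mult_ac)
  also have "\<dots> = complex_of_real ((4 * pi * t) powr (- (real DIM('a) / 2)) * ((4 * pi * t) powr (real DIM('a) / 2) * exp (- t * (norm \<xi>)\<^sup>2)))"
    using t by (subst gaussian_fourier) (auto simp: mult_ac)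
  also have "\<dots> = complex_of_real (exp (- t * (norm \<xi>)\<^sup>2))"
    using t by (simp add: mult.assoc[symmetric] powr_minus)
  finally show ?thesis .
qed

lemma heat_total: "t > 0 \<Longrightarrow> (LINT z::'a::euclidean_space|lborel. heat t z) = 1"
proof -
  assume t: "t > 0"
  have "complex_of_real (LINT z::'a|lborel. heat t z) = (LINT z::'a|lborel. complex_of_real (heat t z))"
    by (rule integral_complex_of_real[symmetric])
  also have "\<dots> = 1" using heat_fourier[OF t, of "0::'a"] by simp
  finally show ?thesis using of_real_eq_1_iff by blast
qed

lemma heat_scale:
  assumes t: "t > 0"
  shows "sqrt t ^ DIM('a) * heat t (sqrt t *\<^sub>R w) = heat 1 (w::'a::euclidean_space)"
proof -
  have "sqrt t ^ DIM('a) = t powr (real DIM('a) / 2)"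
    using t by (simp add: powr_half_sqrt[symmetric] powr_realpow[symmetric] powr_powr)
  moreover have "(4 * pi * t) powr (- (real DIM('a) / 2)) = (4 * pi) powr (- (real DIM('a) / 2)) * t powr (- (real DIM('a) / 2))"
    using t by (subst powr_mult) auto
  moreover have "- (norm (sqrt t *\<^sub>R w))\<^sup>2 / (4 * t) = - (norm w)\<^sup>2 / (4 * 1)" using t by (simp add: power_mult_distrib)
  ultimately show ?thesis using t unfolding heat_def by (simp only: powr_minus) simp
qed

lemma cis_measurable [measurable]:
  "f \<in> borel_measurable M \<Longrightarrow> (\<lambda>x. cis (f x)) \<in> borel_measurable M"
  unfolding cis_conv_exp by measurable

lemma inv_fourier_measurable [measurable]:
  assumes [measurable]: "m \<in> borel_measurable borel"
  shows "inv_fourier m \<in> borel_measurable borel"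
  unfolding inv_fourier_def[abs_def] by measurable

lemma cis_integrable:
  fixes m :: "'a::euclidean_space \<Rightarrow> complex"
  assumes "integrable lborel m"
  shows "integrable lborel (\<lambda>\<xi>. m \<xi> * cis (x \<bullet> \<xi>))"
proof (rule Bochner_Integration.integrable_bound[OF assms])
  have [measurable]: "(\<lambda>\<xi>. cis (x \<bullet> \<xi>)) \<in> borel_measurable borel"
    by (intro borel_measurable_continuous_onI continuous_intros)
  show "(\<lambda>\<xi>. m \<xi> * cis (x \<bullet> \<xi>)) \<in> borel_measurable lborel"
    using borel_measurable_integrable[OF assms] by measurable
qed (auto simp: norm_mult)

lemma norm_inv_fourier_le:
  fixes m :: "real^'n \<Rightarrow> complex"
  assumes "integrable lborel m"
  shows "norm (inv_fourier m x) \<le> 1 / (2 * pi) ^ CARD('n) * (LINT \<xi>|lborel. norm (m \<xi>))"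
proof -
  have "norm (LINT \<xi>|lborel. m \<xi> * cis (x \<bullet> \<xi>)) \<le> (LINT \<xi>|lborel. norm (m \<xi>))"
    using integral_norm_bound[of lborel "\<lambda>\<xi>. m \<xi> * cis (x \<bullet> \<xi>)"] by (simp add: norm_mult)
  then show ?thesis unfolding inv_fourier_def norm_mult norm_of_real by (intro mult_mono) auto
qed

text \<open>Fubini and the transform of the heat kernel: a Gaussian factor on the symbol is a heat
  average of the inverse transform. Only integrability of m is used; the inverse transform itself
  need not be integrable.\<close>

lemma inv_fourier_heat:
  fixes m :: "real^'n \<Rightarrow> complex"
  assumes m: "integrable lborel m" and t: "t > 0"
  shows "(LINT y|lborel. complex_of_real (heat t (x - y)) * inv_fourier m y)
       = inv_fourier (\<lambda>\<xi>. complex_of_real (exp (- t * (norm \<xi>)\<^sup>2)) * m \<xi>) x"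
proof -
  define c where "c = complex_of_real (1 / (2 * pi) ^ CARD('n))"
  note [measurable] = borel_measurable_integrable[OF m, simplified]
  have hi: "integrable lborel (\<lambda>y. heat t (x - y))"
    using heat_integrable[OF t, of 0] lborel_integral_reflect(2)[of "heat t" x] by simp
  let ?F = "\<lambda>y \<xi>. complex_of_real (heat t (x - y)) * (m \<xi> * cis (y \<bullet> \<xi>))"
  have meas: "case_prod ?F \<in> borel_measurable (lborel \<Otimes>\<^sub>M lborel)"
    unfolding case_prod_beta' by measurable
  have fin: "(\<integral>\<^sup>+y. \<integral>\<^sup>+\<xi>. ennreal (norm (?F y \<xi>)) \<partial>lborel \<partial>lborel) < \<infinity>"
  proof -
    have "(\<integral>\<^sup>+y. \<integral>\<^sup>+\<xi>. ennreal (norm (?F y \<xi>)) \<partial>lborel \<partial>lborel)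
       = (\<integral>\<^sup>+y. ennreal (heat t (x - y)) * (\<integral>\<^sup>+\<xi>. ennreal (norm (m \<xi>)) \<partial>lborel) \<partial>lborel)"
      by (intro nn_integral_cong) (simp add: norm_mult heat_nonneg ennreal_mult nn_integral_cmult)
    also have "\<dots> = (\<integral>\<^sup>+y. ennreal (heat t (x - y)) \<partial>lborel) * (\<integral>\<^sup>+\<xi>. ennreal (norm (m \<xi>)) \<partial>lborel)"
      by (rule nn_integral_multc) measurable
    also have "\<dots> < \<infinity>"
      using m hi by (simp add: ennreal_mult_less_top nn_integral_eq_integral heat_nonneg)
    finally show ?thesis .
  qed
  have inner: "(LINT \<xi>|lborel. ?F y \<xi>) = complex_of_real (heat t (x - y)) * (LINT \<xi>|lborel. m \<xi> * cis (y \<bullet> \<xi>))" for y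
    by (rule integral_mult_right_zero)
  have "(LINT y|lborel. complex_of_real (heat t (x - y)) * inv_fourier m y) = (LINT y|lborel. c * (LINT \<xi>|lborel. ?F y \<xi>))"
    unfolding inv_fourier_def c_def[symmetric] inner by (simp only: mult.left_commute)
  also have "\<dots> = c * (LINT y|lborel. LINT \<xi>|lborel. ?F y \<xi>)" by (rule integral_mult_right_zero)
  also have "(LINT y|lborel. LINT \<xi>|lborel. ?F y \<xi>) = (LINT \<xi>|lborel. LINT y|lborel. ?F y \<xi>)"
    by (rule fubini_swap(1)[OF sigma_finite_lborel sigma_finite_lborel meas fin])
  also have "\<dots> = (LINT \<xi>|lborel. complex_of_real (exp (- t * (norm \<xi>)\<^sup>2)) * m \<xi> * cis (x \<bullet> \<xi>))"
  proof (rule Bochner_Integration.integral_cong[OF refl])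
    fix \<xi> :: "real^'n"
    have [measurable]: "(\<lambda>y. cis (y \<bullet> \<xi>)) \<in> borel_measurable borel" for \<xi> :: "real^'n"
      by (intro borel_measurable_continuous_onI continuous_intros)
    have "(LINT y|lborel. ?F y \<xi>) = m \<xi> * (LINT y|lborel. complex_of_real (heat t (x - y)) * cis (y \<bullet> \<xi>))"
      by (subst integral_mult_right_zero[symmetric]) (simp add: mult_ac)
    also have "(LINT y|lborel. complex_of_real (heat t (x - y)) * cis (y \<bullet> \<xi>))
        = (LINT z|lborel. complex_of_real (heat t (x - (x - z))) * cis ((x - z) \<bullet> \<xi>))"
      by (subst lborel_integral_reflect(1)[where c=x, symmetric]) auto
    also have "\<dots> = (LINT z|lborel. cis (x \<bullet> \<xi>) * (complex_of_real (heat t z) * cis (z \<bullet> (- \<xi>))))"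
    proof -
      have "cis ((x - z) \<bullet> \<xi>) = cis (x \<bullet> \<xi>) * cis (z \<bullet> - \<xi>)" for z by (simp add: inner_diff_left cis_mult)
      then show ?thesis by (simp only: diff_diff_eq2 add_diff_cancel_left' mult.left_commute)
    qed
    also have "\<dots> = cis (x \<bullet> \<xi>) * complex_of_real (exp (- t * (norm \<xi>)\<^sup>2))"
      by (subst integral_mult_right_zero, subst heat_fourier[OF t]) simp
    finally show "(LINT y|lborel. ?F y \<xi>) = complex_of_real (exp (- t * (norm \<xi>)\<^sup>2)) * m \<xi> * cis (x \<bullet> \<xi>)"
      by (simp add: mult_ac)
  qed
  finally show ?thesis by (simp add: inv_fourier_def c_def)
qed

lemma gaussian_const:
  assumes "t > 0"
  shows "1 / (2 * pi) ^ CARD('n::finite) * (pi / t) powr (real CARD('n) / 2) = (4 * pi * t) powr (- (real CARD('n) / 2))"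
proof -
  have "(2 * pi) ^ CARD('n) = ((2 * pi)\<^sup>2) powr (real CARD('n) / 2)"
    by (subst powr_numeral[symmetric], simp, subst powr_powr, simp add: powr_realpow)
  then have "1 / (2 * pi) ^ CARD('n) * (pi / t) powr (real CARD('n) / 2) = (pi / t / (2 * pi)\<^sup>2) powr (real CARD('n) / 2)"
    using assms by (simp add: powr_divide powr_mult)
  also have "pi / t / (2 * pi)\<^sup>2 = inverse (4 * pi * t)" by (simp add: power2_eq_square field_simps)
  also have "inverse (4 * pi * t) powr (real CARD('n) / 2) = (4 * pi * t) powr (- (real CARD('n) / 2))"
    using assms by (subst inverse_powr) (auto simp: powr_minus)
  finally show ?thesis .
qed

lemma fourier_measurable [measurable]:
  assumes [measurable]: "\<phi> \<in> borel_measurable borel"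
  shows "fourier \<phi> \<in> borel_measurable borel"
  unfolding fourier_def[abs_def] by measurable

lemma norm_fourier_le:
  assumes "integrable lborel \<phi>"
  shows "norm (fourier \<phi> \<xi>) \<le> (LINT x|lborel. norm (\<phi> x))"
  using integral_norm_bound[of lborel "\<lambda>x. \<phi> x * cis (- (x \<bullet> \<xi>))"] by (simp add: norm_mult fourier_def)

text \<open>The counterpart of \<open>inv_fourier_heat\<close> that starts from an integrable
  function instead of an integrable symbol. It does not presuppose inversion and serves to prove
  it.\<close>

lemma heat_conv_fourier:
  fixes \<phi> :: "real^'n \<Rightarrow> complex"
  assumes \<phi>: "integrable lborel \<phi>" and t: "t > 0"
  shows "inv_fourier (\<lambda>\<xi>. complex_of_real (exp (- t * (norm \<xi>)\<^sup>2)) * fourier \<phi> \<xi>) x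
       = (LINT y|lborel. complex_of_real (heat t (x - y)) * \<phi> y)"
proof -
  define c where "c = complex_of_real (1 / (2 * pi) ^ CARD('n))"
  note [measurable] = borel_measurable_integrable[OF \<phi>, simplified]
  let ?F = "\<lambda>y \<xi>. \<phi> y * (complex_of_real (exp (- t * (norm \<xi>)\<^sup>2)) * cis (\<xi> \<bullet> (x - y)))"
  have meas: "case_prod ?F \<in> borel_measurable (lborel \<Otimes>\<^sub>M lborel)"
    unfolding case_prod_beta' by measurable
  have fin: "(\<integral>\<^sup>+y. \<integral>\<^sup>+\<xi>. ennreal (norm (?F y \<xi>)) \<partial>lborel \<partial>lborel) < \<infinity>"
  proof -
    have "(\<integral>\<^sup>+y. \<integral>\<^sup>+\<xi>. ennreal (norm (?F y \<xi>)) \<partial>lborel \<partial>lborel)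
       = (\<integral>\<^sup>+y. ennreal (norm (\<phi> y)) * (\<integral>\<^sup>+(\<xi>::real^'n). ennreal (exp (- t * (norm \<xi>)\<^sup>2)) \<partial>lborel) \<partial>lborel)"
      by (intro nn_integral_cong) (simp add: norm_mult ennreal_mult nn_integral_cmult)
    also have "\<dots> = (\<integral>\<^sup>+y. ennreal (norm (\<phi> y)) \<partial>lborel) * (\<integral>\<^sup>+(\<xi>::real^'n). ennreal (exp (- t * (norm \<xi>)\<^sup>2)) \<partial>lborel)"
      by (rule nn_integral_multc) measurable
    also have "\<dots> < \<infinity>"
      using \<phi> integrable_gaussian[OF t, where 'a="real^'n"] by (simp add: ennreal_mult_less_top nn_integral_eq_integral)
    finally show ?thesis .
  qed
  have "(LINT \<xi>|lborel. (complex_of_real (exp (- t * (norm \<xi>)\<^sup>2)) * fourier \<phi> \<xi>) * cis (x \<bullet> \<xi>)) = (LINT \<xi>|lborel. LINT y|lborel. ?F y \<xi>)"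
  proof (rule Bochner_Integration.integral_cong[OF refl])
    fix \<xi> :: "real^'n"
    have "(LINT y|lborel. ?F y \<xi>) = (LINT y|lborel. (complex_of_real (exp (- t * (norm \<xi>)\<^sup>2)) * cis (x \<bullet> \<xi>)) * (\<phi> y * cis (- (y \<bullet> \<xi>))))"
    proof (rule Bochner_Integration.integral_cong[OF refl])
      fix y
      have "cis (\<xi> \<bullet> (x - y)) = cis (x \<bullet> \<xi>) * cis (- (y \<bullet> \<xi>))"
        by (simp add: cis_mult inner_diff_right inner_commute)
      then show "?F y \<xi> = (complex_of_real (exp (- t * (norm \<xi>)\<^sup>2)) * cis (x \<bullet> \<xi>)) * (\<phi> y * cis (- (y \<bullet> \<xi>)))"
        by (simp only: mult_ac)
    qed
    also have "\<dots> = (complex_of_real (exp (- t * (norm \<xi>)\<^sup>2)) * cis (x \<bullet> \<xi>)) * fourier \<phi> \<xi>"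
      unfolding fourier_def by (rule integral_mult_right_zero)
    finally show "(complex_of_real (exp (- t * (norm \<xi>)\<^sup>2)) * fourier \<phi> \<xi>) * cis (x \<bullet> \<xi>) = (LINT y|lborel. ?F y \<xi>)"
      by (simp only: mult_ac)
  qed
  also have "\<dots> = (LINT y|lborel. LINT \<xi>|lborel. ?F y \<xi>)"
    by (rule fubini_swap(1)[OF sigma_finite_lborel sigma_finite_lborel meas fin, symmetric])
  also have "\<dots> = (LINT y|lborel. \<phi> y * complex_of_real ((pi / t) powr (real CARD('n) / 2) * exp (- (norm (x - y))\<^sup>2 / (4 * t))))"
    using gaussian_fourier[OF t, where 'a="real^'n"] by (subst integral_mult_right_zero) simp
  finally have eq: "(LINT \<xi>|lborel. (complex_of_real (exp (- t * (norm \<xi>)\<^sup>2)) * fourier \<phi> \<xi>) * cis (x \<bullet> \<xi>))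
      = (LINT y|lborel. \<phi> y * complex_of_real ((pi / t) powr (real CARD('n) / 2) * exp (- (norm (x - y))\<^sup>2 / (4 * t))))" .
  have "inv_fourier (\<lambda>\<xi>. complex_of_real (exp (- t * (norm \<xi>)\<^sup>2)) * fourier \<phi> \<xi>) x
     = (LINT y|lborel. c * (\<phi> y * complex_of_real ((pi / t) powr (real CARD('n) / 2) * exp (- (norm (x - y))\<^sup>2 / (4 * t)))))"
    unfolding inv_fourier_def eq c_def by (rule integral_mult_right_zero[symmetric])
  also have "\<dots> = (LINT y|lborel. complex_of_real (heat t (x - y)) * \<phi> y)"
  proof (rule Bochner_Integration.integral_cong[OF refl])
    fix y
    have "c * complex_of_real ((pi / t) powr (real CARD('n) / 2) * exp (- (norm (x - y))\<^sup>2 / (4 * t))) = complex_of_real (heat t (x - y))"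
      unfolding c_def of_real_mult[symmetric] mult.assoc[symmetric] gaussian_const[OF t] by (simp add: heat_def)
    then show "c * (\<phi> y * complex_of_real ((pi / t) powr (real CARD('n) / 2) * exp (- (norm (x - y))\<^sup>2 / (4 * t)))) = complex_of_real (heat t (x - y)) * \<phi> y"
      by (metis mult.left_commute mult.commute)
  qed
  finally show ?thesis .
qed

text \<open>A Gaussian cutoff at time t(k) \<rightarrow> 0 is evaluated twice: on the frequency side
  it disappears by dominated convergence, on the space side it is an average of \<phi>(x -
  sqrt(t(k)) w) against the fixed density \<open>heat 1\<close>, which tends to \<phi>(x) by
  continuity.\<close>

lemma fourier_inversion:
  fixes \<phi> :: "real^'n \<Rightarrow> complex"
  assumes \<phi>: "integrable lborel \<phi>" and cont: "continuous_on UNIV \<phi>" and B: "\<And>x. norm (\<phi> x) \<le> B"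
    and hat: "integrable lborel (fourier \<phi>)"
  shows "inv_fourier (fourier \<phi>) x = \<phi> x"
proof -
  define t where "t k = 1 / real (Suc k)" for k
  have t: "t k > 0" for k by (simp add: t_def)
  have t0: "t \<longlonglongrightarrow> 0" unfolding t_def by (rule LIMSEQ_Suc) (rule lim_1_over_n)
  note [measurable] = borel_measurable_integrable[OF \<phi>, simplified] borel_measurable_integrable[OF hat, simplified]
  have "(\<lambda>k. inv_fourier (\<lambda>\<xi>. complex_of_real (exp (- t k * (norm \<xi>)\<^sup>2)) * fourier \<phi> \<xi>) x) \<longlonglongrightarrow> inv_fourier (fourier \<phi>) x"
    unfolding inv_fourier_def
  proof (intro tendsto_mult_left integral_dominated_convergence[where w="\<lambda>\<xi>. norm (fourier \<phi> \<xi>)"])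
    show "AE \<xi> in lborel. (\<lambda>k. complex_of_real (exp (- t k * (norm \<xi>)\<^sup>2)) * fourier \<phi> \<xi> * cis (x \<bullet> \<xi>)) \<longlonglongrightarrow> fourier \<phi> \<xi> * cis (x \<bullet> \<xi>)"
    proof (intro always_eventually allI)
      fix \<xi> :: "real^'n"
      have "(\<lambda>k. complex_of_real (exp (- t k * (norm \<xi>)\<^sup>2)) * fourier \<phi> \<xi> * cis (x \<bullet> \<xi>)) \<longlonglongrightarrow> complex_of_real (exp (- 0 * (norm \<xi>)\<^sup>2)) * fourier \<phi> \<xi> * cis (x \<bullet> \<xi>)"
        by (intro tendsto_intros t0)
      then show "(\<lambda>k. complex_of_real (exp (- t k * (norm \<xi>)\<^sup>2)) * fourier \<phi> \<xi> * cis (x \<bullet> \<xi>)) \<longlonglongrightarrow> fourier \<phi> \<xi> * cis (x \<bullet> \<xi>)" by simp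
    qed
    show "AE \<xi> in lborel. norm (complex_of_real (exp (- t k * (norm \<xi>)\<^sup>2)) * fourier \<phi> \<xi> * cis (x \<bullet> \<xi>)) \<le> norm (fourier \<phi> \<xi>)" for k
      using t[of k] by (intro always_eventually allI) (simp add: norm_mult mult_left_le_one_le less_imp_le)
  qed (use hat in auto)
  moreover have "(\<lambda>k. inv_fourier (\<lambda>\<xi>. complex_of_real (exp (- t k * (norm \<xi>)\<^sup>2)) * fourier \<phi> \<xi>) x) \<longlonglongrightarrow> \<phi> x"
  proof -
    have eq: "inv_fourier (\<lambda>\<xi>. complex_of_real (exp (- t k * (norm \<xi>)\<^sup>2)) * fourier \<phi> \<xi>) x
       = (LINT w|lborel. heat 1 w *\<^sub>R \<phi> (x - sqrt (t k) *\<^sub>R w))" for k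
    proof -
      have "inv_fourier (\<lambda>\<xi>. complex_of_real (exp (- t k * (norm \<xi>)\<^sup>2)) * fourier \<phi> \<xi>) x
         = (LINT y|lborel. heat (t k) (x - y) *\<^sub>R \<phi> y)"
        unfolding heat_conv_fourier[OF \<phi> t] by (simp add: scaleR_conv_of_real)
      also have "\<dots> = (LINT z|lborel. heat (t k) z *\<^sub>R \<phi> (x - z))"
        using lborel_integral_reflect(1)[of "\<lambda>y. heat (t k) (x - y) *\<^sub>R \<phi> y" x] by simp
      also have "\<dots> = sqrt (t k) ^ CARD('n) *\<^sub>R (LINT w|lborel. heat (t k) (sqrt (t k) *\<^sub>R w) *\<^sub>R \<phi> (x - sqrt (t k) *\<^sub>R w))"
        using t[of k] lborel_integral_scale(1)[of "sqrt (t k)" "\<lambda>z. heat (t k) z *\<^sub>R \<phi> (x - z)"] by simp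
      also have "\<dots> = (LINT w|lborel. sqrt (t k) ^ CARD('n) *\<^sub>R heat (t k) (sqrt (t k) *\<^sub>R w) *\<^sub>R \<phi> (x - sqrt (t k) *\<^sub>R w))"
        by (rule integral_scaleR_right[symmetric])
      also have "\<dots> = (LINT w|lborel. heat 1 w *\<^sub>R \<phi> (x - sqrt (t k) *\<^sub>R w))"
        using heat_scale[OF t[of k], where 'a="real^'n"] by simp
      finally show ?thesis .
    qed
    have "(\<lambda>k. LINT w|lborel. heat 1 w *\<^sub>R \<phi> (x - sqrt (t k) *\<^sub>R w)) \<longlonglongrightarrow> (LINT w::real^'n|lborel. heat 1 w *\<^sub>R \<phi> x)"
    proof (rule integral_dominated_convergence[where w="\<lambda>w. B * heat 1 w"])
      show "integrable lborel (\<lambda>w::real^'n. B * heat 1 w)" using heat_integrable[of 1 0, where 'a="real^'n"] by simp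
      show "AE w in lborel. (\<lambda>k. heat 1 w *\<^sub>R \<phi> (x - sqrt (t k) *\<^sub>R w)) \<longlonglongrightarrow> heat 1 w *\<^sub>R \<phi> x"
      proof (intro always_eventually allI tendsto_scaleR tendsto_const)
        fix w :: "real^'n"
        have "(\<lambda>k. x - sqrt (t k) *\<^sub>R w) \<longlonglongrightarrow> x - sqrt 0 *\<^sub>R w" by (intro tendsto_intros t0)
        then have l: "(\<lambda>k. x - sqrt (t k) *\<^sub>R w) \<longlonglongrightarrow> x" by simp
        have "isCont \<phi> x" using cont by (simp add: continuous_on_eq_continuous_at)
        then show "(\<lambda>k. \<phi> (x - sqrt (t k) *\<^sub>R w)) \<longlonglongrightarrow> \<phi> x" by (rule isCont_tendsto_compose[OF _ l])
      qed
      show "AE w in lborel. norm (heat 1 w *\<^sub>R \<phi> (x - sqrt (t k) *\<^sub>R w)) \<le> B * heat 1 w" for k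
        by (intro always_eventually allI) (simp add: heat_nonneg mult.commute[of B] mult_left_mono B)
    qed auto
    also have "(LINT w::real^'n|lborel. heat 1 w *\<^sub>R \<phi> x) = \<phi> x"
      using heat_total[of 1, where 'a="real^'n"] heat_integrable[of 1 0, where 'a="real^'n"] by simp
    finally show ?thesis unfolding eq .
  qed
  ultimately show ?thesis by (rule LIMSEQ_unique)
qed

section \<open>Schwartz functions and the decay of their transforms\<close>

lemma iter_pderiv_append: "iter_pderiv vs (iter_pderiv ws f) = iter_pderiv (vs @ ws) f"
  by (induction vs) auto

lemma schwartz_iter_pderiv:
  assumes "schwartz_fun f" "set ws \<subseteq> Basis"
  shows "schwartz_fun (iter_pderiv ws f)"
  using assms by (auto simp: schwartz_fun_def smooth_fun_def iter_pderiv_append)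

lemma one_plus_power_le:
  fixes s :: real
  assumes "s \<ge> 0"
  shows "(1 + s) ^ k \<le> 2 ^ k * (1 + s ^ k)"
proof (cases "s \<le> 1")
  case True
  have "(1 + s) ^ k \<le> 2 ^ k * 1" using True assms by (simp add: power_mono)
  also have "\<dots> \<le> 2 ^ k * (1 + s ^ k)" using assms by (intro mult_left_mono) auto
  finally show ?thesis .
next
  case False
  have "(1 + s) ^ k \<le> (2 * s) ^ k" using False by (intro power_mono) auto
  also have "\<dots> = 2 ^ k * s ^ k" by (rule power_mult_distrib)
  also have "\<dots> \<le> 2 ^ k * (1 + s ^ k)" by (intro mult_left_mono) auto
  finally show ?thesis .
qed

lemma schwartz_continuous:
  assumes "schwartz_fun f"
  shows "continuous_on UNIV f" and "f differentiable (at x)"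
proof -
  have "iter_pderiv [] f differentiable (at x)" for x
    using assms unfolding schwartz_fun_def smooth_fun_def by (metis empty_subsetI list.set(1))
  then show "f differentiable (at x)" "continuous_on UNIV f" for x
    by (auto simp: continuous_on_eq_continuous_at differentiable_imp_continuous_within)
qed

lemma schwartz_decay:
  assumes "schwartz_fun f"
  shows "\<exists>C. \<forall>x. \<bar>f x\<bar> * (1 + (norm x)\<^sup>2) ^ k \<le> C"
proof -
  have *: "bounded (range (\<lambda>x. norm x ^ j * f x))" for j
    using assms unfolding schwartz_fun_def by (metis empty_subsetI iter_pderiv.simps(1) list.set(1))
  obtain C0 where C0: "\<And>x. \<bar>f x\<bar> \<le> C0" using *[of 0] by (auto simp: bounded_iff)
  obtain C1 where C1: "\<And>x. \<bar>norm x ^ (2 * k) * f x\<bar> \<le> C1" using *[of "2 * k"] by (auto simp: bounded_iff)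
  have "\<bar>f x\<bar> * (1 + (norm x)\<^sup>2) ^ k \<le> 2 ^ k * (C0 + C1)" for x
  proof -
    have "\<bar>f x\<bar> * (1 + (norm x)\<^sup>2) ^ k \<le> \<bar>f x\<bar> * (2 ^ k * (1 + ((norm x)\<^sup>2) ^ k))"
      by (intro mult_left_mono one_plus_power_le) auto
    also have "\<dots> = 2 ^ k * (\<bar>f x\<bar> + \<bar>norm x ^ (2 * k) * f x\<bar>)"
      by (simp add: abs_mult power_mult[symmetric] algebra_simps)
    also have "\<dots> \<le> 2 ^ k * (C0 + C1)" by (intro mult_left_mono add_mono C0 C1) auto
    finally show ?thesis .
  qed
  then show ?thesis by blast
qed

lemma decay_integrable:
  fixes f :: "'a::euclidean_space \<Rightarrow> 'b::{banach, second_countable_topology}"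
  assumes [measurable]: "f \<in> borel_measurable borel"
    and C: "\<And>x. norm (f x) * (1 + (norm x)\<^sup>2) ^ (j + DIM('a)) \<le> C"
  shows "integrable lborel (\<lambda>x. (1 + (norm x)\<^sup>2) ^ j *\<^sub>R f x)"
proof -
  have "integrable lborel (\<lambda>x::'a. C * (1 + (norm x)\<^sup>2) powr (- real DIM('a)))"
    by (intro integrable_mult_right integrable_one_plus_norm_sq_powr) auto
  then show ?thesis
  proof (rule Bochner_Integration.integrable_bound)
    show "AE x in lborel. norm ((1 + (norm x)\<^sup>2) ^ j *\<^sub>R f x) \<le> norm (C * (1 + (norm x)\<^sup>2) powr (- real DIM('a)))"
    proof (intro always_eventually allI)
      fix x :: 'a
      have pos: "1 + (norm x)\<^sup>2 > 0" by (simp add: add_pos_nonneg)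
      have "C \<ge> 0" using C[of x] by (rule order_trans[rotated]) (use pos in simp)
      have "(1 + (norm x)\<^sup>2) ^ j * norm (f x) \<le> C / (1 + (norm x)\<^sup>2) ^ DIM('a)"
        using C[of x] pos by (simp add: field_simps power_add)
      also have "\<dots> = C * (1 + (norm x)\<^sup>2) powr (- real DIM('a))"
        using pos by (simp add: powr_minus powr_realpow divide_inverse)
      finally show "norm ((1 + (norm x)\<^sup>2) ^ j *\<^sub>R f x) \<le> norm (C * (1 + (norm x)\<^sup>2) powr (- real DIM('a)))"
        using pos \<open>C \<ge> 0\<close> by simp
    qed
  qed measurable
qed

lemma schwartz_integrable:
  fixes f :: "real^'n \<Rightarrow> real"
  assumes "schwartz_fun f"
  shows "integrable lborel (\<lambda>x. (1 + (norm x)\<^sup>2) ^ j * f x)"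
proof -
  have [measurable]: "f \<in> borel_measurable borel"
    by (rule borel_measurable_continuous_onI[OF schwartz_continuous(1)[OF assms]])
  obtain C where "\<And>x. \<bar>f x\<bar> * (1 + (norm x)\<^sup>2) ^ (j + DIM(real^'n)) \<le> C" using schwartz_decay[OF assms] by blast
  then show ?thesis using decay_integrable[of f j C] by simp
qed

text \<open>Off the closed support the function vanishes on an open set, hence so do all its
  derivatives; on the support compactness bounds them. With this, one argument for Schwartz
  functions settles even and odd dimensions alike.\<close>

lemma test_fun_imp_schwartz:
  fixes f :: "real^'n \<Rightarrow> real"
  assumes "test_fun f"
  shows "schwartz_fun f"
proof -
  define S where "S = closure {x. f x \<noteq> 0}"
  have S: "compact S" "smooth_fun f" using assms by (auto simp: test_fun_def S_def)
  have op: "open (- S)" unfolding S_def by (intro open_Compl closed_closure)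
  have zero: "iter_pderiv vs f x = 0" if "x \<notin> S" for vs x
    using that
  proof (induction vs arbitrary: x)
    case Nil
    then show ?case using closure_subset[of "{x. f x \<noteq> 0}"] by (auto simp: S_def)
  next
    case (Cons v vs)
    have "(iter_pderiv vs f has_derivative (\<lambda>_. 0)) (at x)"
      by (rule has_derivative_transform_within_open[OF has_derivative_const op])
         (use Cons in auto)
    then show ?case using frechet_derivative_at by (metis iter_pderiv.simps(2))
  qed
  have "bounded (range (\<lambda>x. norm x ^ k * iter_pderiv vs f x))" if vs: "set vs \<subseteq> Basis" for vs k
  proof -
    have "continuous_on S (iter_pderiv vs f)"
      using S(2) vs by (auto simp: smooth_fun_def intro!: continuous_at_imp_continuous_on differentiable_imp_continuous_within)
    then have "continuous_on S (\<lambda>x. norm x ^ k * iter_pderiv vs f x)" by (intro continuous_intros)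
    then have "bounded ((\<lambda>x. norm x ^ k * iter_pderiv vs f x) ` S)"
      using S(1) compact_continuous_image compact_imp_bounded by blast
    then have "bounded (insert 0 ((\<lambda>x. norm x ^ k * iter_pderiv vs f x) ` S))" by simp
    moreover have "norm x ^ k * iter_pderiv vs f x \<in> insert 0 ((\<lambda>x. norm x ^ k * iter_pderiv vs f x) ` S)" for x
      using zero[of x vs] by (cases "x \<in> S") auto
    ultimately show ?thesis by (meson bounded_subset image_subset_iff)
  qed
  then show ?thesis using S(2) by (simp add: schwartz_fun_def)
qed

abbreviation cfourier :: "(real^'n \<Rightarrow> real) \<Rightarrow> real^'n \<Rightarrow> complex" where
  "cfourier f \<equiv> fourier (\<lambda>y. complex_of_real (f y))"

lemma schwartz_measurable: "schwartz_fun f \<Longrightarrow> f \<in> borel_measurable borel"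
  by (rule borel_measurable_continuous_onI[OF schwartz_continuous(1)])

lemma schwartz_integrable_complex:
  "schwartz_fun f \<Longrightarrow> integrable lborel (\<lambda>x. complex_of_real (f x))"
  using schwartz_integrable[of f 0] by simp

lemma fourier_shift:
  fixes f :: "real^'n \<Rightarrow> real"
  assumes [measurable]: "f \<in> borel_measurable borel"
  shows "cfourier (\<lambda>x. f (x + v)) \<xi> = cis (v \<bullet> \<xi>) * cfourier f \<xi>"
proof -
  have "cfourier (\<lambda>x. f (x + v)) \<xi> = (LINT x|lborel. cis (v \<bullet> \<xi>) * (complex_of_real (f (x + v)) * cis (- ((x + v) \<bullet> \<xi>))))"
    unfolding fourier_def
  proof (rule Bochner_Integration.integral_cong[OF refl])
    fix x
    have "cis (v \<bullet> \<xi>) * cis (- ((x + v) \<bullet> \<xi>)) = cis (- (x \<bullet> \<xi>))" by (simp add: cis_mult inner_add_left)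
    then show "complex_of_real (f (x + v)) * cis (- (x \<bullet> \<xi>)) = cis (v \<bullet> \<xi>) * (complex_of_real (f (x + v)) * cis (- ((x + v) \<bullet> \<xi>)))"
      by (metis mult.left_commute)
  qed
  also have "\<dots> = cis (v \<bullet> \<xi>) * (LINT x|lborel. complex_of_real (f (x + v)) * cis (- ((x + v) \<bullet> \<xi>)))"
    by (rule integral_mult_right_zero)
  also have "(LINT x|lborel. complex_of_real (f (x + v)) * cis (- ((x + v) \<bullet> \<xi>))) = cfourier f \<xi>"
    unfolding fourier_def by (rule lborel_integral_shift(1)[where f="\<lambda>x. complex_of_real (f x) * cis (- (x \<bullet> \<xi>))"]) measurable
  finally show ?thesis .
qed

text \<open>Difference quotients take the place of integration by parts: a translation multiplies
  the transform by a character, and both sides converge as the increment tends to 0.\<close>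

lemma fourier_pderiv:
  fixes f :: "real^'n \<Rightarrow> real"
  assumes f: "schwartz_fun f" and b: "b \<in> Basis"
  shows "cfourier (iter_pderiv [b] f) \<xi> = \<i> * complex_of_real (\<xi> \<bullet> b) * cfourier f \<xi>"
proof -
  define g where "g = iter_pderiv [b] f"
  have g: "schwartz_fun g" unfolding g_def using f b by (intro schwartz_iter_pderiv) auto
  note [measurable] = schwartz_measurable[OF f] schwartz_measurable[OF g]
  have der: "((\<lambda>s. f (x + s *\<^sub>R b)) has_real_derivative g (x + s *\<^sub>R b)) (at s)" for x s
  proof -
    have d: "(f has_derivative frechet_derivative f (at (x + s *\<^sub>R b))) (at (x + s *\<^sub>R b))"
      using schwartz_continuous(2)[OF f] by (simp add: frechet_derivative_works)
    have "((\<lambda>s. x + s *\<^sub>R b) has_derivative (\<lambda>h. h *\<^sub>R b)) (at s)"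
      by (auto intro!: derivative_eq_intros)
    from diff_chain_at[OF this d] have "((\<lambda>s. f (x + s *\<^sub>R b)) has_derivative (\<lambda>h. frechet_derivative f (at (x + s *\<^sub>R b)) (h *\<^sub>R b))) (at s)"
      by (simp add: o_def)
    moreover have "frechet_derivative f (at (x + s *\<^sub>R b)) (h *\<^sub>R b) = g (x + s *\<^sub>R b) * h" for h
      using linear_cmul[OF linear_frechet_derivative[OF schwartz_continuous(2)[OF f]]] by (simp add: g_def)
    ultimately show ?thesis by (simp add: has_field_derivative_def)
  qed
  define h where "h k = 1 / real (Suc k)" for k
  have h: "0 < h k" "h k \<le> 1" "h k \<noteq> 0" for k by (auto simp: h_def)
  have h0: "h \<longlonglongrightarrow> 0" unfolding h_def by (rule LIMSEQ_Suc) (rule lim_1_over_n)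
  obtain C where C: "\<And>x. \<bar>g x\<bar> * (1 + (norm x)\<^sup>2) ^ CARD('n) \<le> C" using schwartz_decay[OF g] by blast
  \<comment> \<open>An integrable majorant of the difference quotients, through the mean value
    theorem and the decay of g. A shift by at most 1 changes 1 + |x|^2 by a factor of at most
    3.\<close>
  define w where "w x = 3 ^ CARD('n) * C * (1 + (norm x)\<^sup>2) powr (- real CARD('n))" for x :: "real^'n"
  have wi: "integrable lborel w"
    unfolding w_def using zero_less_card_finite[where 'a='n]
    by (intro integrable_mult_right integrable_one_plus_norm_sq_powr) auto
  have dq: "\<bar>(f (x + h k *\<^sub>R b) - f x) / h k\<bar> \<le> w x" for x k
  proof -
    obtain s where s: "0 < s" "s < h k" "f (x + h k *\<^sub>R b) - f (x + 0 *\<^sub>R b) = (h k - 0) * g (x + s *\<^sub>R b)"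
      using MVT2[OF h(1)[of k], of "\<lambda>s. f (x + s *\<^sub>R b)" "\<lambda>s. g (x + s *\<^sub>R b)"] der by blast
    have nb: "norm (s *\<^sub>R b) \<le> 1" using s h(2)[of k] b by simp
    have pos: "1 + (norm y)\<^sup>2 > 0" for y :: "real^'n" by (simp add: add_pos_nonneg)
    have "norm x \<le> norm (x + s *\<^sub>R b) + 1" using nb norm_triangle_ineq4[of "x + s *\<^sub>R b" "s *\<^sub>R b"] by simp
    then have "(norm x)\<^sup>2 \<le> (norm (x + s *\<^sub>R b) + 1)\<^sup>2" by (intro power_mono) auto
    also have "\<dots> \<le> 2 * (norm (x + s *\<^sub>R b))\<^sup>2 + 2"
      using sum_squares_bound[of "norm (x + s *\<^sub>R b)" 1] by (simp add: power2_sum)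
    finally have "1 + (norm x)\<^sup>2 \<le> 3 * (1 + (norm (x + s *\<^sub>R b))\<^sup>2)"
      using zero_le_power2[of "norm (x + s *\<^sub>R b)"] unfolding distrib_left by linarith
    then have "(1 + (norm x)\<^sup>2) ^ CARD('n) \<le> (3 * (1 + (norm (x + s *\<^sub>R b))\<^sup>2)) ^ CARD('n)"
      by (intro power_mono) auto
    also have "\<dots> = 3 ^ CARD('n) * (1 + (norm (x + s *\<^sub>R b))\<^sup>2) ^ CARD('n)" by (rule power_mult_distrib)
    finally have le: "(1 + (norm x)\<^sup>2) ^ CARD('n) \<le> 3 ^ CARD('n) * (1 + (norm (x + s *\<^sub>R b))\<^sup>2) ^ CARD('n)" .
    have "\<bar>g (x + s *\<^sub>R b)\<bar> * (1 + (norm x)\<^sup>2) ^ CARD('n) \<le> \<bar>g (x + s *\<^sub>R b)\<bar> * (3 ^ CARD('n) * (1 + (norm (x + s *\<^sub>R b))\<^sup>2) ^ CARD('n))"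
      by (intro mult_left_mono le) auto
    also have "\<dots> = 3 ^ CARD('n) * (\<bar>g (x + s *\<^sub>R b)\<bar> * (1 + (norm (x + s *\<^sub>R b))\<^sup>2) ^ CARD('n))"
      by (simp only: mult.left_commute)
    also have "\<dots> \<le> 3 ^ CARD('n) * C" by (intro mult_left_mono C) auto
    finally have "\<bar>g (x + s *\<^sub>R b)\<bar> \<le> w x"
      using pos[of x] by (simp add: w_def powr_minus powr_realpow field_simps)
    moreover have "(f (x + h k *\<^sub>R b) - f x) / h k = g (x + s *\<^sub>R b)" using s(3) h(3)[of k] by simp
    ultimately show ?thesis by simp
  qed
  have lim1: "(\<lambda>k. cfourier (\<lambda>x. (f (x + h k *\<^sub>R b) - f x) / h k) \<xi>) \<longlonglongrightarrow> cfourier g \<xi>"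
    unfolding fourier_def
  proof (rule integral_dominated_convergence[OF _ _ wi])
    show "AE x in lborel. (\<lambda>k. complex_of_real ((f (x + h k *\<^sub>R b) - f x) / h k) * cis (- (x \<bullet> \<xi>))) \<longlonglongrightarrow> complex_of_real (g x) * cis (- (x \<bullet> \<xi>))"
    proof (intro always_eventually allI tendsto_mult tendsto_of_real tendsto_const)
      fix x
      have "((\<lambda>s. (f (x + s *\<^sub>R b) - f x) / s) \<longlongrightarrow> g x) (at 0)"
        using der[of x 0] by (simp add: has_field_derivative_iff)
      moreover have "filterlim h (at 0) sequentially"
        using h0 h(3) by (auto simp: filterlim_at intro!: always_eventually)
      ultimately show "(\<lambda>k. (f (x + h k *\<^sub>R b) - f x) / h k) \<longlonglongrightarrow> g x" by (rule filterlim_compose)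
    qed
    show "AE x in lborel. norm (complex_of_real ((f (x + h k *\<^sub>R b) - f x) / h k) * cis (- (x \<bullet> \<xi>))) \<le> w x" for k
      using dq[of _ k] by (intro always_eventually allI) (simp only: norm_mult norm_of_real norm_cis mult_1_right)
  qed auto
  have eq: "cfourier (\<lambda>x. (f (x + h k *\<^sub>R b) - f x) / h k) \<xi> = (cis (h k * (\<xi> \<bullet> b)) - 1) / complex_of_real (h k) * cfourier f \<xi>" for k
  proof -
    have i1: "integrable lborel (\<lambda>x. complex_of_real (f x) * cis (- (x \<bullet> \<xi>)))"
      by (rule Bochner_Integration.integrable_bound[OF schwartz_integrable_complex[OF f]]) (auto simp: norm_mult)
    have i2: "integrable lborel (\<lambda>x. complex_of_real (f (x + h k *\<^sub>R b)) * cis (- (x \<bullet> \<xi>)))"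
      by (rule Bochner_Integration.integrable_bound[where f="\<lambda>x. complex_of_real (f (x + h k *\<^sub>R b))"])
         (use lborel_integral_shift(2)[of "\<lambda>x. complex_of_real (f x)" "h k *\<^sub>R b"] schwartz_integrable_complex[OF f] in \<open>auto simp: norm_mult\<close>)
    have "cfourier (\<lambda>x. (f (x + h k *\<^sub>R b) - f x) / h k) \<xi>
      = (LINT x|lborel. (complex_of_real (f (x + h k *\<^sub>R b)) * cis (- (x \<bullet> \<xi>)) - complex_of_real (f x) * cis (- (x \<bullet> \<xi>))) / complex_of_real (h k))"
      unfolding fourier_def by (simp add: left_diff_distrib)
    also have "\<dots> = (cfourier (\<lambda>x. f (x + h k *\<^sub>R b)) \<xi> - cfourier f \<xi>) / complex_of_real (h k)"
      using i1 i2 by (simp add: fourier_def)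
    also have "\<dots> = (cis (h k * (\<xi> \<bullet> b)) - 1) / complex_of_real (h k) * cfourier f \<xi>"
      by (subst fourier_shift) (auto simp: left_diff_distrib inner_commute)
    finally show ?thesis .
  qed
  have lim2: "(\<lambda>k. (cis (h k * (\<xi> \<bullet> b)) - 1) / complex_of_real (h k) * cfourier f \<xi>) \<longlonglongrightarrow> \<i> * complex_of_real (\<xi> \<bullet> b) * cfourier f \<xi>"
  proof (rule tendsto_mult_right)
    define a where "a = \<xi> \<bullet> b"
    have "((\<lambda>z. exp (\<i> * z * complex_of_real a)) has_field_derivative (\<i> * complex_of_real a)) (at 0)"
      by (auto intro!: derivative_eq_intros)
    then have "((\<lambda>z. (exp (\<i> * z * complex_of_real a) - 1) / z) \<longlongrightarrow> \<i> * complex_of_real a) (at 0)"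
      by (simp add: has_field_derivative_iff)
    moreover have "filterlim (\<lambda>k. complex_of_real (h k)) (at 0) sequentially"
      using tendsto_of_real[OF h0, where 'a=complex] h(3) by (auto simp: filterlim_at intro!: always_eventually)
    ultimately have "(\<lambda>k. (exp (\<i> * complex_of_real (h k) * complex_of_real a) - 1) / complex_of_real (h k)) \<longlonglongrightarrow> \<i> * complex_of_real a"
      by (rule filterlim_compose)
    then show "(\<lambda>k. (cis (h k * (\<xi> \<bullet> b)) - 1) / complex_of_real (h k)) \<longlonglongrightarrow> \<i> * complex_of_real (\<xi> \<bullet> b)"
      by (simp add: cis_conv_exp a_def mult.assoc)
  qed
  show ?thesis using LIMSEQ_unique[OF lim1[unfolded eq] lim2] by (simp add: g_def)
qed

lemma fourier_laplace:
  fixes f :: "real^'n \<Rightarrow> real"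
  assumes f: "schwartz_fun f"
  shows "complex_of_real ((norm \<xi>)\<^sup>2) * cfourier f \<xi> = - (\<Sum>b\<in>Basis. cfourier (iter_pderiv [b, b] f) \<xi>)"
proof -
  have "cfourier (iter_pderiv [b, b] f) \<xi> = - complex_of_real ((\<xi> \<bullet> b)\<^sup>2) * cfourier f \<xi>" if b: "b \<in> Basis" for b
  proof -
    have "cfourier (iter_pderiv [b] (iter_pderiv [b] f)) \<xi> = \<i> * complex_of_real (\<xi> \<bullet> b) * cfourier (iter_pderiv [b] f) \<xi>"
      using f b by (intro fourier_pderiv schwartz_iter_pderiv) auto
    also have "cfourier (iter_pderiv [b] f) \<xi> = \<i> * complex_of_real (\<xi> \<bullet> b) * cfourier f \<xi>"
      by (rule fourier_pderiv[OF f b])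
    also have "\<i> * complex_of_real (\<xi> \<bullet> b) * (\<i> * complex_of_real (\<xi> \<bullet> b) * cfourier f \<xi>)
        = (\<i> * \<i>) * (complex_of_real (\<xi> \<bullet> b) * complex_of_real (\<xi> \<bullet> b)) * cfourier f \<xi>" by (simp only: mult_ac)
    finally show ?thesis by (simp add: power2_eq_square)
  qed
  then have "- (\<Sum>b\<in>Basis. cfourier (iter_pderiv [b, b] f) \<xi>) = (\<Sum>b\<in>Basis. complex_of_real ((\<xi> \<bullet> b)\<^sup>2) * cfourier f \<xi>)"
    by (simp add: sum_negf)
  also have "\<dots> = complex_of_real (\<Sum>b\<in>Basis. (\<xi> \<bullet> b)\<^sup>2) * cfourier f \<xi>" by (simp add: sum_distrib_right)
  also have "(\<Sum>b\<in>Basis. (\<xi> \<bullet> b)\<^sup>2) = (norm \<xi>)\<^sup>2"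
    unfolding power2_norm_eq_inner by (subst (2) euclidean_inner) (simp add: power2_eq_square)
  finally show ?thesis by simp
qed

text \<open>Two powers of |\<xi>| are traded for a Laplacian, which maps Schwartz functions to sums
  of Schwartz functions; the induction therefore runs over all f.\<close>

lemma fourier_norm_power_bounded:
  fixes f :: "real^'n \<Rightarrow> real"
  assumes "schwartz_fun f"
  shows "\<exists>C. \<forall>\<xi>. norm (cfourier f \<xi>) * (norm \<xi>) ^ (2 * j) \<le> C"
  using assms
proof (induction j arbitrary: f)
  case 0
  then show ?case using norm_fourier_le[OF schwartz_integrable_complex[OF 0]] by auto
next
  case (Suc j)
  have "\<exists>C. \<forall>\<xi>. norm (cfourier (iter_pderiv [b, b] f) \<xi>) * (norm \<xi>) ^ (2 * j) \<le> C" if "b \<in> Basis" for b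
    using Suc.prems that by (intro Suc.IH schwartz_iter_pderiv) auto
  then obtain C where C: "\<And>b \<xi>. b \<in> Basis \<Longrightarrow> norm (cfourier (iter_pderiv [b, b] f) \<xi>) * (norm \<xi>) ^ (2 * j) \<le> C b"
    by metis
  have "norm (cfourier f \<xi>) * (norm \<xi>) ^ (2 * Suc j) \<le> (\<Sum>b\<in>Basis. C b)" for \<xi>
  proof -
    have "norm (cfourier f \<xi>) * (norm \<xi>) ^ (2 * Suc j) = norm (complex_of_real ((norm \<xi>)\<^sup>2) * cfourier f \<xi>) * (norm \<xi>) ^ (2 * j)"
      by (simp add: norm_mult norm_power power2_eq_square mult_ac)
    also have "\<dots> = norm (\<Sum>b\<in>Basis. cfourier (iter_pderiv [b, b] f) \<xi>) * (norm \<xi>) ^ (2 * j)"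
      unfolding fourier_laplace[OF Suc.prems] norm_minus_cancel ..
    also have "\<dots> \<le> (\<Sum>b\<in>Basis. norm (cfourier (iter_pderiv [b, b] f) \<xi>)) * (norm \<xi>) ^ (2 * j)"
      by (intro mult_right_mono norm_sum) auto
    also have "\<dots> \<le> (\<Sum>b\<in>Basis. C b)" unfolding sum_distrib_right by (intro sum_mono C)
    finally show ?thesis .
  qed
  then show ?case by blast
qed

text \<open>Decay is required but no smoothness, because for odd n the factor |\<xi>|^n is not
  smooth at 0 and leads out of the Schwartz class.\<close>

definition rapid :: "(real^'n \<Rightarrow> complex) \<Rightarrow> bool" where
  "rapid m \<longleftrightarrow> m \<in> borel_measurable borel \<and> (\<forall>k. \<exists>C. \<forall>\<xi>. norm (m \<xi>) * (1 + (norm \<xi>)\<^sup>2) ^ k \<le> C)"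

lemma rapid_fourier: "schwartz_fun f \<Longrightarrow> rapid (cfourier f)"
proof -
  assume f: "schwartz_fun f"
  note [measurable] = schwartz_measurable[OF f]
  have "\<exists>C. \<forall>\<xi>. norm (cfourier f \<xi>) * (1 + (norm \<xi>)\<^sup>2) ^ k \<le> C" for k
  proof -
    obtain C0 where C0: "\<And>\<xi>. norm (cfourier f \<xi>) * (norm \<xi>) ^ (2 * 0) \<le> C0" using fourier_norm_power_bounded[OF f] by blast
    obtain C1 where C1: "\<And>\<xi>. norm (cfourier f \<xi>) * (norm \<xi>) ^ (2 * k) \<le> C1" using fourier_norm_power_bounded[OF f] by blast
    have "norm (cfourier f \<xi>) * (1 + (norm \<xi>)\<^sup>2) ^ k \<le> 2 ^ k * (C0 + C1)" for \<xi>
    proof -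
      have "norm (cfourier f \<xi>) * (1 + (norm \<xi>)\<^sup>2) ^ k \<le> norm (cfourier f \<xi>) * (2 ^ k * (1 + ((norm \<xi>)\<^sup>2) ^ k))"
        by (intro mult_left_mono one_plus_power_le) auto
      also have "\<dots> = 2 ^ k * (norm (cfourier f \<xi>) * norm \<xi> ^ (2 * 0) + norm (cfourier f \<xi>) * norm \<xi> ^ (2 * k))"
        by (simp add: power_mult[symmetric] algebra_simps)
      also have "\<dots> \<le> 2 ^ k * (C0 + C1)" by (intro mult_left_mono add_mono C0 C1) auto
      finally show ?thesis .
    qed
    then show ?thesis by blast
  qed
  then show ?thesis by (simp add: rapid_def)
qed

lemma rapid_integrable:
  fixes m :: "real^'n \<Rightarrow> complex"
  assumes "rapid m"
  shows "integrable lborel (\<lambda>\<xi>. (1 + (norm \<xi>)\<^sup>2) ^ j *\<^sub>R m \<xi>)" "integrable lborel m"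
proof -
  show "integrable lborel (\<lambda>\<xi>. (1 + (norm \<xi>)\<^sup>2) ^ j *\<^sub>R m \<xi>)" for j
  proof -
    obtain C where "\<And>\<xi>. norm (m \<xi>) * (1 + (norm \<xi>)\<^sup>2) ^ (j + DIM(real^'n)) \<le> C" using assms by (auto simp: rapid_def)
    then show ?thesis using assms by (intro decay_integrable) (auto simp: rapid_def)
  qed
  from this[of 0] show "integrable lborel m" by simp
qed

lemma rapid_mult:
  fixes q :: "real^'n \<Rightarrow> real"
  assumes m: "rapid m" and [measurable]: "q \<in> borel_measurable borel"
    and q: "\<And>\<xi>. \<bar>q \<xi>\<bar> \<le> A * (1 + (norm \<xi>)\<^sup>2) ^ j"
  shows "rapid (\<lambda>\<xi>. complex_of_real (q \<xi>) * m \<xi>)"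
proof -
  have [measurable]: "m \<in> borel_measurable borel" using m by (simp add: rapid_def)
  have A: "A \<ge> 0" using order_trans[OF abs_ge_zero q[of 0]] by simp
  have "\<exists>C. \<forall>\<xi>. norm (complex_of_real (q \<xi>) * m \<xi>) * (1 + (norm \<xi>)\<^sup>2) ^ k \<le> C" for k
  proof -
    obtain C where C: "\<And>\<xi>. norm (m \<xi>) * (1 + (norm \<xi>)\<^sup>2) ^ (j + k) \<le> C" using m by (auto simp: rapid_def)
    have "norm (complex_of_real (q \<xi>) * m \<xi>) * (1 + (norm \<xi>)\<^sup>2) ^ k \<le> A * C" for \<xi>
    proof -
      have "norm (complex_of_real (q \<xi>) * m \<xi>) * (1 + (norm \<xi>)\<^sup>2) ^ k \<le> (A * (1 + (norm \<xi>)\<^sup>2) ^ j) * norm (m \<xi>) * (1 + (norm \<xi>)\<^sup>2) ^ k"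
        unfolding norm_mult norm_of_real using q[of \<xi>] by (intro mult_right_mono) auto
      also have "\<dots> = A * (norm (m \<xi>) * (1 + (norm \<xi>)\<^sup>2) ^ (j + k))" by (simp add: power_add mult_ac)
      also have "\<dots> \<le> A * C" by (intro mult_left_mono C A)
      finally show ?thesis .
    qed
    then show ?thesis by blast
  qed
  then show ?thesis by (simp add: rapid_def)
qed

section \<open>The fractional Laplacian of a Schwartz function\<close>

text \<open>The L1 norm with the weight needed to test functions of quadratic growth. Values in
  \<open>ennreal\<close> allow estimates before finiteness is known.\<close>

definition wnorm :: "(real^'n \<Rightarrow> complex) \<Rightarrow> ennreal" where
  "wnorm g = (\<integral>\<^sup>+x. ennreal ((1 + (norm x)\<^sup>2) * norm (g x)) \<partial>lborel)"

lemma wnorm_add: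
  assumes [measurable]: "f \<in> borel_measurable borel" "g \<in> borel_measurable borel"
  shows "wnorm (\<lambda>x. f x + g x) \<le> wnorm f + wnorm g"
proof -
  have "wnorm (\<lambda>x. f x + g x) \<le> (\<integral>\<^sup>+x. ennreal ((1 + (norm x)\<^sup>2) * norm (f x)) + ennreal ((1 + (norm x)\<^sup>2) * norm (g x)) \<partial>lborel)"
    unfolding wnorm_def
  proof (rule nn_integral_mono)
    fix x
    have "(1 + (norm x)\<^sup>2) * norm (f x + g x) \<le> (1 + (norm x)\<^sup>2) * (norm (f x) + norm (g x))"
      by (intro mult_left_mono norm_triangle_ineq) auto
    then show "ennreal ((1 + (norm x)\<^sup>2) * norm (f x + g x)) \<le> ennreal ((1 + (norm x)\<^sup>2) * norm (f x)) + ennreal ((1 + (norm x)\<^sup>2) * norm (g x))"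
      by (subst ennreal_plus[symmetric]) (auto simp: distrib_left simp del: ennreal_plus intro!: ennreal_leI)
  qed
  also have "\<dots> = wnorm f + wnorm g" unfolding wnorm_def by (rule nn_integral_add) measurable
  finally show ?thesis .
qed

lemma inv_fourier_add:
  assumes "integrable lborel m" "integrable lborel m'"
  shows "inv_fourier (\<lambda>\<xi>. m \<xi> + m' \<xi>) x = inv_fourier m x + inv_fourier m' x"
  unfolding inv_fourier_def using cis_integrable[OF assms(1), of x] cis_integrable[OF assms(2), of x]
  by (simp add: distrib_right distrib_left)

lemma inv_fourier_minus: "inv_fourier (\<lambda>\<xi>. - m \<xi>) x = - inv_fourier m x"
  unfolding inv_fourier_def by simp

lemma wnorm_inv_fourier_sum:
  assumes "finite I" "\<And>i. i \<in> I \<Longrightarrow> integrable lborel (m i)"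
    and "\<And>i. i \<in> I \<Longrightarrow> wnorm (inv_fourier (m i)) < \<infinity>"
  shows "wnorm (inv_fourier (\<lambda>\<xi>. \<Sum>i\<in>I. m i \<xi>)) < \<infinity>"
  using assms
proof (induction I rule: finite_induct)
  case empty
  then show ?case by (simp add: inv_fourier_def wnorm_def)
next
  case (insert i I)
  have [measurable]: "m i \<in> borel_measurable borel" "(\<lambda>\<xi>. \<Sum>i\<in>I. m i \<xi>) \<in> borel_measurable borel"
    using insert.prems(1) by (auto intro!: borel_measurable_sum dest: borel_measurable_integrable)
  have "wnorm (inv_fourier (\<lambda>\<xi>. m i \<xi> + (\<Sum>i\<in>I. m i \<xi>))) = wnorm (\<lambda>x. inv_fourier (m i) x + inv_fourier (\<lambda>\<xi>. \<Sum>i\<in>I. m i \<xi>) x)"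
  proof -
    have "inv_fourier (\<lambda>\<xi>. m i \<xi> + (\<Sum>i\<in>I. m i \<xi>)) x = inv_fourier (m i) x + inv_fourier (\<lambda>\<xi>. \<Sum>i\<in>I. m i \<xi>) x" for x
      using insert.prems(1) by (intro inv_fourier_add) auto
    then show ?thesis by presburger
  qed
  also have "\<dots> \<le> wnorm (inv_fourier (m i)) + wnorm (inv_fourier (\<lambda>\<xi>. \<Sum>i\<in>I. m i \<xi>))"
    by (rule wnorm_add) measurable
  also have "\<dots> < \<infinity>" using insert by simp
  finally show ?case using insert.hyps by simp
qed

lemma norm_sq_le_pow: "\<bar>(norm \<xi>) ^ (2 * j)\<bar> \<le> 1 * (1 + (norm \<xi>)\<^sup>2) ^ j"
proof -
  have "(norm \<xi>) ^ (2 * j) = ((norm \<xi>)\<^sup>2) ^ j" by (rule power_mult)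
  also have "\<dots> \<le> (1 + (norm \<xi>)\<^sup>2) ^ j" by (intro power_mono) auto
  finally show ?thesis by simp
qed

lemma rapid_norm_pow: "rapid m \<Longrightarrow> rapid (\<lambda>\<xi>. complex_of_real (norm \<xi> ^ (2 * j)) * m \<xi>)"
  by (rule rapid_mult[OF _ _ norm_sq_le_pow]) measurable

lemma schwartz_inversion:
  fixes f :: "real^'n \<Rightarrow> real"
  assumes "schwartz_fun f"
  shows "inv_fourier (cfourier f) x = complex_of_real (f x)"
proof -
  obtain C where "\<And>x. \<bar>f x\<bar> * (1 + (norm x)\<^sup>2) ^ 0 \<le> C" using schwartz_decay[OF assms] by blast
  then show ?thesis
    using fourier_inversion[OF schwartz_integrable_complex[OF assms], of C]
      rapid_integrable(2)[OF rapid_fourier[OF assms]] schwartz_continuous(1)[OF assms]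
    by (auto intro!: continuous_intros)
qed

text \<open>Even powers of |\<xi>| are iterates of minus the Laplacian, which stay among Schwartz
  functions. Odd powers are out of reach this way and require subordination.\<close>

lemma wnorm_laplace_power:
  fixes f :: "real^'n \<Rightarrow> real"
  assumes "schwartz_fun f"
  shows "wnorm (inv_fourier (\<lambda>\<xi>. complex_of_real (norm \<xi> ^ (2 * j)) * cfourier f \<xi>)) < \<infinity>"
  using assms
proof (induction j arbitrary: f)
  case 0
  have "wnorm (inv_fourier (cfourier f)) = (\<integral>\<^sup>+x. ennreal (norm ((1 + (norm x)\<^sup>2) ^ 1 * f x)) \<partial>lborel)"
    unfolding wnorm_def schwartz_inversion[OF 0] by (simp add: abs_mult)
  also have "\<dots> < \<infinity>" using schwartz_integrable[OF 0, of 1] by (simp add: integrable_iff_bounded)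
  finally show ?case by simp
next
  case (Suc j)
  have sch: "schwartz_fun (iter_pderiv [b, b] f)" if "b \<in> Basis" for b
    using Suc.prems that by (intro schwartz_iter_pderiv) auto
  have eq: "(\<lambda>\<xi>. complex_of_real (norm \<xi> ^ (2 * Suc j)) * cfourier f \<xi>)
     = (\<lambda>\<xi>. - (\<Sum>b\<in>Basis. complex_of_real (norm \<xi> ^ (2 * j)) * cfourier (iter_pderiv [b, b] f) \<xi>))"
  proof
    fix \<xi> :: "real^'n"
    have "complex_of_real (norm \<xi> ^ (2 * Suc j)) * cfourier f \<xi> = complex_of_real (norm \<xi> ^ (2 * j)) * (complex_of_real ((norm \<xi>)\<^sup>2) * cfourier f \<xi>)"
      by (simp add: power2_eq_square mult_ac)
    then show "complex_of_real (norm \<xi> ^ (2 * Suc j)) * cfourier f \<xi> = - (\<Sum>b\<in>Basis. complex_of_real (norm \<xi> ^ (2 * j)) * cfourier (iter_pderiv [b, b] f) \<xi>)"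
      unfolding fourier_laplace[OF Suc.prems] sum_distrib_left[symmetric] by (simp only: mult_minus_right)
  qed
  have "wnorm (inv_fourier (\<lambda>\<xi>. \<Sum>b\<in>Basis. complex_of_real (norm \<xi> ^ (2 * j)) * cfourier (iter_pderiv [b, b] f) \<xi>)) < \<infinity>"
    using sch Suc.IH by (intro wnorm_inv_fourier_sum rapid_integrable(2) rapid_norm_pow rapid_fourier) auto
  then show ?case unfolding eq inv_fourier_minus by (simp add: wnorm_def)
qed

text \<open>The weight is submultiplicative up to a factor 2, so a heat average costs the weighted
  mass of the heat kernel, and that grows linearly in t by scaling. Having c \<ge> 1 lets the same
  constant cover t = 0, where the average is the identity.\<close>

lemma wnorm_heat:
  "\<exists>c\<ge>1. \<forall>(m :: real^'n \<Rightarrow> complex) t. integrable lborel m \<longrightarrow> t > 0 \<longrightarrow>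
     wnorm (inv_fourier (\<lambda>\<xi>. complex_of_real (exp (- t * (norm \<xi>)\<^sup>2)) * m \<xi>)) \<le> ennreal (c * (1 + t)) * wnorm (inv_fourier m)"
proof -
  define c1 where "c1 = (LINT w::real^'n|lborel. (1 + (norm w)\<^sup>2) * heat 1 w)"
  have i1: "integrable lborel (\<lambda>w::real^'n. (1 + (norm w)\<^sup>2) * heat 1 w)" using heat_integrable[of 1 1, where 'a="real^'n"] by simp
  have c1: "c1 \<ge> 0" unfolding c1_def by (rule integral_nonneg_AE) (auto simp: heat_nonneg)
  have K: "(\<integral>\<^sup>+(z::real^'n). ennreal ((1 + (norm z)\<^sup>2) * heat t z) \<partial>lborel) \<le> ennreal ((1 + t) * c1)" if t: "t > 0" for t
  proof -
    have "(\<integral>\<^sup>+(z::real^'n). ennreal ((1 + (norm z)\<^sup>2) * heat t z) \<partial>lborel)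
       = ennreal (sqrt t ^ CARD('n)) * (\<integral>\<^sup>+(w::real^'n). ennreal ((1 + (norm (sqrt t *\<^sub>R w))\<^sup>2) * heat t (sqrt t *\<^sub>R w)) \<partial>lborel)"
      using t by (subst lborel_nn_integral_scale[of "sqrt t"]) auto
    also have "\<dots> = (\<integral>\<^sup>+(w::real^'n). ennreal ((1 + t * (norm w)\<^sup>2) * heat 1 w) \<partial>lborel)"
    proof (subst nn_integral_cmult[symmetric], measurable, rule nn_integral_cong)
      fix w :: "real^'n"
      have "sqrt t ^ CARD('n) * ((1 + (norm (sqrt t *\<^sub>R w))\<^sup>2) * heat t (sqrt t *\<^sub>R w)) = (1 + t * (norm w)\<^sup>2) * heat 1 w"
        using heat_scale[OF t, of w] t by (simp add: power_mult_distrib mult_ac)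
      then show "ennreal (sqrt t ^ CARD('n)) * ennreal ((1 + (norm (sqrt t *\<^sub>R w))\<^sup>2) * heat t (sqrt t *\<^sub>R w)) = ennreal ((1 + t * (norm w)\<^sup>2) * heat 1 w)"
        using t by (subst ennreal_mult[symmetric]) (auto simp: heat_nonneg)
    qed
    also have "\<dots> \<le> (\<integral>\<^sup>+(w::real^'n). ennreal ((1 + t) * ((1 + (norm w)\<^sup>2) * heat 1 w)) \<partial>lborel)"
    proof (intro nn_integral_mono ennreal_leI)
      fix w :: "real^'n"
      have "1 + t * (norm w)\<^sup>2 \<le> (1 + t) * (1 + (norm w)\<^sup>2)" using t by (simp add: algebra_simps)
      then show "(1 + t * (norm w)\<^sup>2) * heat 1 w \<le> (1 + t) * ((1 + (norm w)\<^sup>2) * heat 1 w)"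
        unfolding mult.assoc[symmetric] by (intro mult_right_mono heat_nonneg)
    qed
    also have "\<dots> = ennreal ((1 + t) * c1)"
      unfolding c1_def using t i1 by (subst nn_integral_eq_integral) (auto simp: heat_nonneg)
    finally show ?thesis .
  qed
  define c where "c = max 1 (2 * c1)"
  have "wnorm (inv_fourier (\<lambda>\<xi>. complex_of_real (exp (- t * (norm \<xi>)\<^sup>2)) * m \<xi>)) \<le> ennreal (c * (1 + t)) * wnorm (inv_fourier m)"
    if m: "integrable lborel m" and t: "t > 0" for m :: "real^'n \<Rightarrow> complex" and t
  proof -
    note [measurable] = borel_measurable_integrable[OF m, simplified]
    define G where "G = inv_fourier m"
    have [measurable]: "G \<in> borel_measurable borel" unfolding G_def by measurable
    have "wnorm (inv_fourier (\<lambda>\<xi>. complex_of_real (exp (- t * (norm \<xi>)\<^sup>2)) * m \<xi>))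
       \<le> (\<integral>\<^sup>+x. \<integral>\<^sup>+y. ennreal ((1 + (norm x)\<^sup>2) * (heat t (x - y) * norm (G y))) \<partial>lborel \<partial>lborel)"
      unfolding wnorm_def
    proof (rule nn_integral_mono)
      fix x :: "real^'n"
      let ?I = "LINT y|lborel. complex_of_real (heat t (x - y)) * G y"
      have hi: "integrable lborel (\<lambda>y. heat t (x - y))"
        using heat_integrable[OF t, of 0] lborel_integral_reflect(2)[of "heat t" x] by simp
      have gi: "integrable lborel (\<lambda>y. complex_of_real (heat t (x - y)) * G y)"
      proof (rule Bochner_Integration.integrable_bound)
        show "integrable lborel (\<lambda>y. heat t (x - y) * (1 / (2 * pi) ^ CARD('n) * (LINT \<xi>|lborel. norm (m \<xi>))))"
          by (intro integrable_mult_left hi)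
        show "AE y in lborel. norm (complex_of_real (heat t (x - y)) * G y) \<le> norm (heat t (x - y) * (1 / (2 * pi) ^ CARD('n) * (LINT \<xi>|lborel. norm (m \<xi>))))"
          unfolding norm_mult norm_of_real real_norm_def abs_mult
          using norm_inv_fourier_le[OF m] unfolding G_def
          by (intro always_eventually allI mult_left_mono) (auto simp flip: abs_mult intro: order_trans[OF _ abs_ge_self])
      qed measurable
      have "ennreal (norm ?I) \<le> (\<integral>\<^sup>+y. ennreal (norm (complex_of_real (heat t (x - y)) * G y)) \<partial>lborel)"
        by (rule integral_norm_bound_ennreal[OF gi])
      then have "ennreal (1 + (norm x)\<^sup>2) * ennreal (norm ?I) \<le> ennreal (1 + (norm x)\<^sup>2) * (\<integral>\<^sup>+y. ennreal (heat t (x - y) * norm (G y)) \<partial>lborel)"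
        by (intro mult_left_mono) (auto simp: norm_mult heat_nonneg)
      also have "\<dots> = (\<integral>\<^sup>+y. ennreal ((1 + (norm x)\<^sup>2) * (heat t (x - y) * norm (G y))) \<partial>lborel)"
        by (subst nn_integral_cmult[symmetric]) (auto simp: ennreal_mult heat_nonneg)
      finally show "ennreal ((1 + (norm x)\<^sup>2) * norm (inv_fourier (\<lambda>\<xi>. complex_of_real (exp (- t * (norm \<xi>)\<^sup>2)) * m \<xi>) x))
         \<le> (\<integral>\<^sup>+y. ennreal ((1 + (norm x)\<^sup>2) * (heat t (x - y) * norm (G y))) \<partial>lborel)"
        unfolding inv_fourier_heat[OF m t, symmetric] G_def[symmetric] by (simp add: ennreal_mult)
    qed
    also have "\<dots> \<le> (\<integral>\<^sup>+x. \<integral>\<^sup>+y. ennreal (2 * ((1 + (norm y)\<^sup>2) * norm (G y))) * ennreal ((1 + (norm (x - y))\<^sup>2) * heat t (x - y)) \<partial>lborel \<partial>lborel)"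
    proof (intro nn_integral_mono)
      fix x y :: "real^'n"
      have "(norm x)\<^sup>2 \<le> (norm (x - y) + norm y)\<^sup>2"
        using norm_triangle_ineq[of "x - y" y] by (intro power_mono) auto
      also have "\<dots> \<le> 2 * (norm (x - y))\<^sup>2 + 2 * (norm y)\<^sup>2"
        using sum_squares_bound[of "norm (x - y)" "norm y"] by (simp add: power2_sum)
      finally have "(norm x)\<^sup>2 \<le> 2 * (norm (x - y))\<^sup>2 + 2 * (norm y)\<^sup>2" .
      have "1 + (norm x)\<^sup>2 \<le> 2 * ((1 + (norm y)\<^sup>2) * (1 + (norm (x - y))\<^sup>2))"
      proof -
        have "2 * ((1 + (norm y)\<^sup>2) * (1 + (norm (x - y))\<^sup>2))
            = 2 + 2 * (norm (x - y))\<^sup>2 + 2 * (norm y)\<^sup>2 + 2 * ((norm y)\<^sup>2 * (norm (x - y))\<^sup>2)"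
          by (simp add: algebra_simps)
        moreover have "(norm y)\<^sup>2 * (norm (x - y))\<^sup>2 \<ge> 0" by simp
        ultimately show ?thesis using \<open>(norm x)\<^sup>2 \<le> 2 * (norm (x - y))\<^sup>2 + 2 * (norm y)\<^sup>2\<close> by linarith
      qed
      then have "(1 + (norm x)\<^sup>2) * (heat t (x - y) * norm (G y)) \<le> 2 * ((1 + (norm y)\<^sup>2) * (1 + (norm (x - y))\<^sup>2)) * (heat t (x - y) * norm (G y))"
        by (intro mult_right_mono) (auto simp: heat_nonneg)
      also have "\<dots> = (2 * ((1 + (norm y)\<^sup>2) * norm (G y))) * ((1 + (norm (x - y))\<^sup>2) * heat t (x - y))"
        by (simp only: mult_ac)
      finally show "ennreal ((1 + (norm x)\<^sup>2) * (heat t (x - y) * norm (G y)))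
         \<le> ennreal (2 * ((1 + (norm y)\<^sup>2) * norm (G y))) * ennreal ((1 + (norm (x - y))\<^sup>2) * heat t (x - y))"
        by (subst ennreal_mult[symmetric]) (auto simp: heat_nonneg intro!: ennreal_leI)
    qed
    also have "\<dots> = (\<integral>\<^sup>+y. \<integral>\<^sup>+x. ennreal (2 * ((1 + (norm y)\<^sup>2) * norm (G y))) * ennreal ((1 + (norm (x - y))\<^sup>2) * heat t (x - y)) \<partial>lborel \<partial>lborel)"
      by (rule lborel_pair.Fubini'[symmetric]) measurable
    also have "\<dots> \<le> (\<integral>\<^sup>+y. ennreal (2 * ((1 + (norm y)\<^sup>2) * norm (G y))) * ennreal ((1 + t) * c1) \<partial>lborel)"
    proof (rule nn_integral_mono)
      fix y :: "real^'n"
      have "(\<integral>\<^sup>+x. ennreal (2 * ((1 + (norm y)\<^sup>2) * norm (G y))) * ennreal ((1 + (norm (x - y))\<^sup>2) * heat t (x - y)) \<partial>lborel)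
         = ennreal (2 * ((1 + (norm y)\<^sup>2) * norm (G y))) * (\<integral>\<^sup>+x. ennreal ((1 + (norm (x - y))\<^sup>2) * heat t (x - y)) \<partial>lborel)"
        by (rule nn_integral_cmult) measurable
      also have "(\<integral>\<^sup>+x. ennreal ((1 + (norm (x - y))\<^sup>2) * heat t (x - y)) \<partial>lborel) = (\<integral>\<^sup>+(x::real^'n). ennreal ((1 + (norm x)\<^sup>2) * heat t x) \<partial>lborel)"
        using lborel_nn_integral_shift[of "\<lambda>x. ennreal ((1 + (norm x)\<^sup>2) * heat t x)" "- y"] by simp
      also have "ennreal (2 * ((1 + (norm y)\<^sup>2) * norm (G y))) * \<dots> \<le> ennreal (2 * ((1 + (norm y)\<^sup>2) * norm (G y))) * ennreal ((1 + t) * c1)"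
        by (intro mult_left_mono K t) auto
      finally show "(\<integral>\<^sup>+x. ennreal (2 * ((1 + (norm y)\<^sup>2) * norm (G y))) * ennreal ((1 + (norm (x - y))\<^sup>2) * heat t (x - y)) \<partial>lborel)
         \<le> ennreal (2 * ((1 + (norm y)\<^sup>2) * norm (G y))) * ennreal ((1 + t) * c1)" .
    qed
    also have "\<dots> = (\<integral>\<^sup>+y. ennreal (2 * c1 * (1 + t)) * ennreal ((1 + (norm y)\<^sup>2) * norm (G y)) \<partial>lborel)"
    proof (rule nn_integral_cong)
      fix y :: "real^'n"
      show "ennreal (2 * ((1 + (norm y)\<^sup>2) * norm (G y))) * ennreal ((1 + t) * c1) = ennreal (2 * c1 * (1 + t)) * ennreal ((1 + (norm y)\<^sup>2) * norm (G y))"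
        using t c1 by (subst (1 2) ennreal_mult[symmetric]) (auto simp: algebra_simps)
    qed
    also have "\<dots> = ennreal (2 * c1 * (1 + t)) * wnorm G"
      unfolding wnorm_def by (rule nn_integral_cmult) measurable
    also have "\<dots> \<le> ennreal (c * (1 + t)) * wnorm G"
      using t by (intro mult_right_mono ennreal_leI) (auto simp: c_def)
    finally show ?thesis by (simp add: G_def)
  qed
  moreover have "c \<ge> 1" by (simp add: c_def)
  ultimately show ?thesis by blast
qed

text \<open>The symbol K is a mixture of symbols k(s, .). Positivity of k makes absolute
  integrability of the double integral equivalent to that of K m.\<close>

lemma inv_fourier_superpose:
  fixes m :: "real^'n \<Rightarrow> complex" and k :: "real \<Rightarrow> real^'n \<Rightarrow> real"
  assumes [measurable]: "case_prod k \<in> borel_measurable (borel \<Otimes>\<^sub>M borel)" "m \<in> borel_measurable borel"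
    and nn: "\<And>s \<xi>. 0 \<le> k s \<xi>" "\<And>\<xi>. 0 \<le> K \<xi>"
    and K: "\<And>\<xi>. (\<integral>\<^sup>+s. ennreal (k s \<xi>) \<partial>lborel) = ennreal (K \<xi>)"
    and int: "integrable lborel (\<lambda>\<xi>. complex_of_real (K \<xi>) * m \<xi>)"
  shows "integrable lborel (\<lambda>s. inv_fourier (\<lambda>\<xi>. complex_of_real (k s \<xi>) * m \<xi>) x)"
    and "inv_fourier (\<lambda>\<xi>. complex_of_real (K \<xi>) * m \<xi>) x = (LINT s|lborel. inv_fourier (\<lambda>\<xi>. complex_of_real (k s \<xi>) * m \<xi>) x)"
proof -
  define c where "c = complex_of_real (1 / (2 * pi) ^ CARD('n))"
  let ?M = "\<lambda>s \<xi>. complex_of_real (k s \<xi>) * m \<xi>"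
  have k1[measurable]: "(\<lambda>s. k s \<xi>) \<in> borel_measurable borel" for \<xi>
    using measurable_Pair1[OF assms(1), of \<xi>] by simp
  have [measurable]: "(\<lambda>p. k (fst p) (snd p)) \<in> borel_measurable (borel \<Otimes>\<^sub>M borel)"
    using assms(1) by (simp add: case_prod_beta')
  let ?F = "\<lambda>\<xi> s. complex_of_real (k s \<xi>) * (m \<xi> * cis (x \<bullet> \<xi>))"
  have meas: "case_prod ?F \<in> borel_measurable (lborel \<Otimes>\<^sub>M lborel)"
  proof -
    have "(\<lambda>p. k (snd p) (fst p)) \<in> borel_measurable (borel \<Otimes>\<^sub>M borel)"
      using measurable_compose[of "\<lambda>p. (snd p, fst p)" "borel \<Otimes>\<^sub>M borel" "borel \<Otimes>\<^sub>M borel" "\<lambda>p. k (fst p) (snd p)"] by simp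
    then show ?thesis unfolding case_prod_beta' by measurable
  qed
  have fin: "(\<integral>\<^sup>+\<xi>. \<integral>\<^sup>+s. ennreal (norm (?F \<xi> s)) \<partial>lborel \<partial>lborel) < \<infinity>"
  proof -
    have "(\<integral>\<^sup>+\<xi>. \<integral>\<^sup>+s. ennreal (norm (?F \<xi> s)) \<partial>lborel \<partial>lborel) = (\<integral>\<^sup>+\<xi>. ennreal (norm (complex_of_real (K \<xi>) * m \<xi>)) \<partial>lborel)"
    proof (rule nn_integral_cong)
      fix \<xi> :: "real^'n"
      have "(\<integral>\<^sup>+s. ennreal (norm (?F \<xi> s)) \<partial>lborel) = (\<integral>\<^sup>+s. ennreal (k s \<xi>) * ennreal (norm (m \<xi>)) \<partial>lborel)"
        by (intro nn_integral_cong) (simp add: norm_mult nn ennreal_mult)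
      also have "\<dots> = ennreal (K \<xi>) * ennreal (norm (m \<xi>))"
        unfolding K[symmetric] by (rule nn_integral_multc) measurable
      finally show "(\<integral>\<^sup>+s. ennreal (norm (?F \<xi> s)) \<partial>lborel) = ennreal (norm (complex_of_real (K \<xi>) * m \<xi>))"
        by (simp add: norm_mult nn ennreal_mult)
    qed
    also have "\<dots> < \<infinity>" using int by (simp add: integrable_iff_bounded)
    finally show ?thesis .
  qed
  have inner: "(LINT s|lborel. ?F \<xi> s) = complex_of_real (K \<xi>) * m \<xi> * cis (x \<bullet> \<xi>)" for \<xi>
  proof -
    have "has_bochner_integral lborel (\<lambda>s. k s \<xi>) (K \<xi>)"
      using nn K by (intro has_bochner_integral_nn_integral) auto
    then have "has_bochner_integral lborel (\<lambda>s. complex_of_real (k s \<xi>)) (complex_of_real (K \<xi>))"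
      by (rule has_bochner_integral_of_real)
    then have "has_bochner_integral lborel (\<lambda>s. ?F \<xi> s) (complex_of_real (K \<xi>) * (m \<xi> * cis (x \<bullet> \<xi>)))"
      by (rule has_bochner_integral_mult_left[rotated])
    then show ?thesis by (simp add: has_bochner_integral_iff mult.assoc)
  qed
  have inv: "c * (LINT \<xi>|lborel. ?F \<xi> s) = inv_fourier (?M s) x" for s
    unfolding inv_fourier_def c_def by (simp add: mult.assoc)
  have "inv_fourier (\<lambda>\<xi>. complex_of_real (K \<xi>) * m \<xi>) x = c * (LINT \<xi>|lborel. LINT s|lborel. ?F \<xi> s)"
    unfolding inv_fourier_def c_def inner ..
  also have "(LINT \<xi>|lborel. LINT s|lborel. ?F \<xi> s) = (LINT s|lborel. LINT \<xi>|lborel. ?F \<xi> s)"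
    by (rule fubini_swap(1)[OF sigma_finite_lborel sigma_finite_lborel meas fin])
  also have "c * \<dots> = (LINT s|lborel. inv_fourier (?M s) x)"
    unfolding inv[symmetric] by (rule integral_mult_right_zero[symmetric])
  finally show "inv_fourier (\<lambda>\<xi>. complex_of_real (K \<xi>) * m \<xi>) x = (LINT s|lborel. inv_fourier (?M s) x)" .
  show "integrable lborel (\<lambda>s. inv_fourier (?M s) x)"
    unfolding inv[symmetric]
    by (intro integrable_mult_right fubini_swap(3)[OF sigma_finite_lborel sigma_finite_lborel meas fin])
qed

text \<open>Minkowski's integral inequality for the mixture.\<close>

lemma wnorm_superpose:
  fixes m :: "real^'n \<Rightarrow> complex" and k :: "real \<Rightarrow> real^'n \<Rightarrow> real"
  assumes [measurable]: "case_prod k \<in> borel_measurable (borel \<Otimes>\<^sub>M borel)" "m \<in> borel_measurable borel"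
    and nn: "\<And>s \<xi>. 0 \<le> k s \<xi>" "\<And>\<xi>. 0 \<le> K \<xi>"
    and K: "\<And>\<xi>. (\<integral>\<^sup>+s. ennreal (k s \<xi>) \<partial>lborel) = ennreal (K \<xi>)"
    and int: "integrable lborel (\<lambda>\<xi>. complex_of_real (K \<xi>) * m \<xi>)"
  shows "wnorm (inv_fourier (\<lambda>\<xi>. complex_of_real (K \<xi>) * m \<xi>))
     \<le> (\<integral>\<^sup>+s. wnorm (inv_fourier (\<lambda>\<xi>. complex_of_real (k s \<xi>) * m \<xi>)) \<partial>lborel)"
proof -
  let ?M = "\<lambda>s \<xi>. complex_of_real (k s \<xi>) * m \<xi>"
  have k1[measurable]: "(\<lambda>s. k s \<xi>) \<in> borel_measurable borel" for \<xi>
    using measurable_Pair1[OF assms(1), of \<xi>] by simp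
  have [measurable]: "(\<lambda>p. k (fst p) (snd p)) \<in> borel_measurable (borel \<Otimes>\<^sub>M borel)"
    using assms(1) by (simp add: case_prod_beta')
  have pw: "ennreal (norm (inv_fourier (\<lambda>\<xi>. complex_of_real (K \<xi>) * m \<xi>) x)) \<le> (\<integral>\<^sup>+s. ennreal (norm (inv_fourier (?M s) x)) \<partial>lborel)" for x
    unfolding inv_fourier_superpose(2)[OF assms] by (rule integral_norm_bound_ennreal[OF inv_fourier_superpose(1)[OF assms]])
  have [measurable]: "(\<lambda>p. inv_fourier (?M (snd p)) (fst p)) \<in> borel_measurable (lborel \<Otimes>\<^sub>M lborel)"
  proof -
    have "(\<lambda>p. k (snd (fst p)) (snd p)) \<in> borel_measurable ((lborel \<Otimes>\<^sub>M lborel) \<Otimes>\<^sub>M lborel)"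
      using measurable_compose[of "\<lambda>p. (snd (fst p), snd p)" "(lborel \<Otimes>\<^sub>M lborel) \<Otimes>\<^sub>M lborel" "borel \<Otimes>\<^sub>M borel" "\<lambda>p. k (fst p) (snd p)"] by simp
    then show ?thesis unfolding inv_fourier_def by measurable
  qed
  have [measurable]: "(\<lambda>s. inv_fourier (?M s) x) \<in> borel_measurable borel" for x
    using borel_measurable_integrable[OF inv_fourier_superpose(1)[OF assms]] by simp
  have "wnorm (inv_fourier (\<lambda>\<xi>. complex_of_real (K \<xi>) * m \<xi>))
     \<le> (\<integral>\<^sup>+x. \<integral>\<^sup>+s. ennreal (1 + (norm x)\<^sup>2) * ennreal (norm (inv_fourier (?M s) x)) \<partial>lborel \<partial>lborel)"
    unfolding wnorm_def
  proof (rule nn_integral_mono)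
    fix x :: "real^'n"
    have "ennreal (1 + (norm x)\<^sup>2) * ennreal (norm (inv_fourier (\<lambda>\<xi>. complex_of_real (K \<xi>) * m \<xi>) x))
       \<le> ennreal (1 + (norm x)\<^sup>2) * (\<integral>\<^sup>+s. ennreal (norm (inv_fourier (?M s) x)) \<partial>lborel)"
      by (intro mult_left_mono pw) auto
    also have "\<dots> = (\<integral>\<^sup>+s. ennreal (1 + (norm x)\<^sup>2) * ennreal (norm (inv_fourier (?M s) x)) \<partial>lborel)"
      by (rule nn_integral_cmult[symmetric]) measurable
    finally show "ennreal ((1 + (norm x)\<^sup>2) * norm (inv_fourier (\<lambda>\<xi>. complex_of_real (K \<xi>) * m \<xi>) x))
       \<le> (\<integral>\<^sup>+s. ennreal (1 + (norm x)\<^sup>2) * ennreal (norm (inv_fourier (?M s) x)) \<partial>lborel)"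
      by (simp add: ennreal_mult)
  qed
  also have "\<dots> = (\<integral>\<^sup>+s. \<integral>\<^sup>+x. ennreal (1 + (norm x)\<^sup>2) * ennreal (norm (inv_fourier (?M s) x)) \<partial>lborel \<partial>lborel)"
    by (rule lborel_pair.Fubini'[symmetric]) measurable
  also have "\<dots> = (\<integral>\<^sup>+s. wnorm (inv_fourier (?M s)) \<partial>lborel)"
    unfolding wnorm_def by (simp add: ennreal_mult)
  finally show ?thesis .
qed

definition gauss :: "real \<Rightarrow> real^'n \<Rightarrow> real" where
  "gauss t \<xi> = exp (- t * (norm \<xi>)\<^sup>2)"

lemma gauss_measurable [measurable]: "(\<lambda>x. gauss (f x) (g x)) \<in> borel_measurable M"
  if [measurable]: "f \<in> borel_measurable M" "g \<in> borel_measurable M"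
  unfolding gauss_def by measurable

lemma gauss_bounds: "0 \<le> gauss t \<xi>" "t \<ge> 0 \<Longrightarrow> gauss t \<xi> \<le> 1"
  by (auto simp: gauss_def)

lemma gauss_pow_bounds:
  assumes "t \<ge> 0"
  shows "0 \<le> (1 - gauss t \<xi>) ^ k" "(1 - gauss t \<xi>) ^ k \<le> 1"
  using gauss_bounds[of t \<xi>] assms by (auto intro!: power_le_one)

text \<open>The finiteness is demanded for all even powers so that the class is closed under
  multiplication by |\<xi>|^2, as the induction for small times requires.\<close>

definition wfast :: "(real^'n \<Rightarrow> complex) \<Rightarrow> bool" where
  "wfast m \<longleftrightarrow> rapid m \<and> (\<forall>j. wnorm (inv_fourier (\<lambda>\<xi>. complex_of_real (norm \<xi> ^ (2 * j)) * m \<xi>)) < \<infinity>)"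

lemma wfast_laplace:
  assumes "wfast m"
  shows "wfast (\<lambda>\<xi>. complex_of_real ((norm \<xi>)\<^sup>2) * m \<xi>)"
proof -
  have "rapid (\<lambda>\<xi>. complex_of_real ((norm \<xi>)\<^sup>2) * m \<xi>)"
    using rapid_norm_pow[of m 1] assms by (simp add: wfast_def)
  moreover have "wnorm (inv_fourier (\<lambda>\<xi>. complex_of_real (norm \<xi> ^ (2 * j)) * (complex_of_real ((norm \<xi>)\<^sup>2) * m \<xi>))) < \<infinity>" for j
  proof -
    have "(\<lambda>\<xi>. complex_of_real (norm \<xi> ^ (2 * j)) * (complex_of_real ((norm \<xi>)\<^sup>2) * m \<xi>)) = (\<lambda>\<xi>. complex_of_real (norm \<xi> ^ (2 * Suc j)) * m \<xi>)"
      by (auto simp: power2_eq_square mult_ac)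
    then show ?thesis using assms by (simp only: wfast_def)
  qed
  ultimately show ?thesis by (simp add: wfast_def)
qed

lemma wfast_wnorm: "wfast m \<Longrightarrow> wnorm (inv_fourier m) < \<infinity>"
  unfolding wfast_def by (drule conjunct2, drule spec[of _ 0]) simp

lemma rapid_bounded_mult:
  assumes "rapid m" "q \<in> borel_measurable borel" "\<And>\<xi>. 0 \<le> q \<xi>" "\<And>\<xi>. q \<xi> \<le> 1"
  shows "rapid (\<lambda>\<xi>. complex_of_real (q \<xi>) * m \<xi>)"
  using assms by (intro rapid_mult[where A=1 and j=0]) auto

lemma rapid_gauss_diff:
  assumes "rapid m" "t \<ge> 0"
  shows "rapid (\<lambda>\<xi>. complex_of_real ((1 - gauss t \<xi>) ^ k) * m \<xi>)"
  using assms gauss_pow_bounds[OF assms(2)] by (intro rapid_bounded_mult) auto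

text \<open>Since 1 - exp(-t|\<xi>|^2) is the integral over s in [0, t] of |\<xi>|^2
  exp(-s|\<xi>|^2), each factor gains a power of t at the price of one Laplacian on m and a heat
  average of bounded time.\<close>

lemma wnorm_small_time:
  fixes m :: "real^'n \<Rightarrow> complex"
  assumes "wfast m"
  shows "\<exists>C\<ge>0. \<forall>t. 0 < t \<longrightarrow> t \<le> 1 \<longrightarrow>
     wnorm (inv_fourier (\<lambda>\<xi>. complex_of_real ((1 - gauss t \<xi>) ^ k) * m \<xi>)) \<le> ennreal (C * t ^ k)"
  using assms
proof (induction k arbitrary: m)
  case 0
  have "wnorm (inv_fourier m) = ennreal (enn2real (wnorm (inv_fourier m)))" using wfast_wnorm[OF 0] by simp
  then show ?case by (intro exI[of _ "enn2real (wnorm (inv_fourier m))"]) (auto simp: enn2real_nonneg)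
next
  case (Suc k)
  define m' where "m' = (\<lambda>\<xi>. complex_of_real ((norm \<xi>)\<^sup>2) * m \<xi>)"
  have m': "wfast m'" unfolding m'_def by (rule wfast_laplace[OF Suc.prems])
  obtain C where C0: "C \<ge> 0" and C: "\<And>t. 0 < t \<Longrightarrow> t \<le> 1 \<Longrightarrow>
     wnorm (inv_fourier (\<lambda>\<xi>. complex_of_real ((1 - gauss t \<xi>) ^ k) * m' \<xi>)) \<le> ennreal (C * t ^ k)"
    using Suc.IH[OF m'] by blast
  obtain c where c1: "c \<ge> 1" and c: "\<And>(m :: real^'n \<Rightarrow> complex) t. integrable lborel m \<Longrightarrow> t > 0 \<Longrightarrow>
     wnorm (inv_fourier (\<lambda>\<xi>. complex_of_real (exp (- t * (norm \<xi>)\<^sup>2)) * m \<xi>)) \<le> ennreal (c * (1 + t)) * wnorm (inv_fourier m)"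
    using wnorm_heat[where 'n='n] by blast
  have rm: "rapid m" "rapid m'" using Suc.prems m' by (auto simp: wfast_def)
  have [measurable]: "m \<in> borel_measurable borel" using rm by (simp add: rapid_def)
  have "wnorm (inv_fourier (\<lambda>\<xi>. complex_of_real ((1 - gauss t \<xi>) ^ Suc k) * m \<xi>)) \<le> ennreal (2 * c * C * t ^ Suc k)"
    if t: "0 < t" "t \<le> 1" for t
  proof -
    define M where "M = (\<lambda>\<xi>. complex_of_real ((1 - gauss t \<xi>) ^ k) * m \<xi>)"
    define M' where "M' = (\<lambda>\<xi>. complex_of_real ((1 - gauss t \<xi>) ^ k) * m' \<xi>)"
    have [measurable]: "M \<in> borel_measurable borel" unfolding M_def by measurable
    have M'i: "integrable lborel M'" unfolding M'_def using rm t by (intro rapid_integrable(2) rapid_gauss_diff) auto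
    have rM: "rapid M" unfolding M_def using rm t by (intro rapid_gauss_diff) auto
    define ks where "ks s \<xi> = indicator {0..t} s * ((norm \<xi>)\<^sup>2 * gauss s \<xi>)" for s and \<xi> :: "real^'n"
    have "wnorm (inv_fourier (\<lambda>\<xi>. complex_of_real (1 - gauss t \<xi>) * M \<xi>)) \<le> (\<integral>\<^sup>+s. wnorm (inv_fourier (\<lambda>\<xi>. complex_of_real (ks s \<xi>) * M \<xi>)) \<partial>lborel)"
    proof (rule wnorm_superpose)
      show "case_prod ks \<in> borel_measurable (borel \<Otimes>\<^sub>M borel)" unfolding ks_def case_prod_beta' by measurable
      show "0 \<le> ks s \<xi>" for s \<xi> by (simp add: ks_def gauss_bounds)
      show "0 \<le> 1 - gauss t \<xi>" for \<xi> :: "real^'n" using gauss_bounds(2)[of t \<xi>] t by simp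
      show "integrable lborel (\<lambda>\<xi>. complex_of_real (1 - gauss t \<xi>) * M \<xi>)"
        using rapid_gauss_diff[OF rM, of t 1] t by (intro rapid_integrable(2)) auto
      fix \<xi> :: "real^'n"
      have "(\<integral>\<^sup>+s. ennreal (ks s \<xi>) \<partial>lborel) = (\<integral>\<^sup>+s. ennreal ((norm \<xi>)\<^sup>2 * exp (- s * (norm \<xi>)\<^sup>2)) * indicator {0..t} s \<partial>lborel)"
        by (intro nn_integral_cong) (auto simp: ks_def gauss_def indicator_def)
      also have "\<dots> = ennreal (- exp (- t * (norm \<xi>)\<^sup>2) - (- exp (- 0 * (norm \<xi>)\<^sup>2)))"
        using t by (intro nn_integral_FTC_Icc) (auto intro!: derivative_eq_intros)
      finally show "(\<integral>\<^sup>+s. ennreal (ks s \<xi>) \<partial>lborel) = ennreal (1 - gauss t \<xi>)" by (simp add: gauss_def)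
    qed auto
    also have "\<dots> \<le> (\<integral>\<^sup>+s. ennreal (2 * c * C * t ^ k) * indicator {0..t} s \<partial>lborel)"
    proof (rule nn_integral_mono)
      fix s :: real
      show "wnorm (inv_fourier (\<lambda>\<xi>. complex_of_real (ks s \<xi>) * M \<xi>)) \<le> ennreal (2 * c * C * t ^ k) * indicator {0..t} s"
      proof (cases "s \<in> {0..t}")
        case True
        have eq: "(\<lambda>\<xi>. complex_of_real (ks s \<xi>) * M \<xi>) = (\<lambda>\<xi>. complex_of_real (exp (- s * (norm \<xi>)\<^sup>2)) * M' \<xi>)"
          using True by (auto simp: ks_def M_def M'_def m'_def gauss_def mult_ac)
        have W: "wnorm (inv_fourier M') \<le> ennreal (C * t ^ k)" unfolding M'_def by (rule C[OF t])
        have "wnorm (inv_fourier (\<lambda>\<xi>. complex_of_real (exp (- s * (norm \<xi>)\<^sup>2)) * M' \<xi>)) \<le> ennreal (2 * c) * wnorm (inv_fourier M')"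
        proof (cases "s = 0")
          case True
          have "ennreal 1 * wnorm (inv_fourier M') \<le> ennreal (2 * c) * wnorm (inv_fourier M')"
            using c1 by (intro mult_right_mono ennreal_leI) auto
          then show ?thesis using True by simp
        next
          case False
          then have s: "s > 0" "s \<le> 1" using True t by auto
          have "ennreal (c * (1 + s)) * wnorm (inv_fourier M') \<le> ennreal (2 * c) * wnorm (inv_fourier M')"
            using c1 s by (intro mult_right_mono ennreal_leI) (auto simp: mult.commute[of 2] intro!: mult_left_mono)
          then show ?thesis using c[OF M'i s(1)] by (rule order_trans[rotated])
        qed
        also have "\<dots> \<le> ennreal (2 * c) * ennreal (C * t ^ k)" by (intro mult_left_mono W) auto
        also have "\<dots> = ennreal (2 * c * C * t ^ k)" using c1 C0 t by (subst ennreal_mult[symmetric]) (auto simp: mult_ac)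
        finally show ?thesis using True unfolding eq by simp
      next
        case False
        then show ?thesis by (simp add: ks_def inv_fourier_def wnorm_def)
      qed
    qed
    also have "\<dots> = ennreal (2 * c * C * t ^ Suc k)"
      using t c1 C0 by (subst nn_integral_cmult_indicator) (auto simp: ennreal_mult[symmetric] mult_ac)
    finally show ?thesis by (simp add: M_def mult_ac)
  qed
  then show ?case using c1 C0 by (intro exI[of _ "2 * c * C"]) auto
qed

lemma wnorm_minus: "wnorm (\<lambda>x. - f x) = wnorm f"
  by (simp add: wnorm_def)

text \<open>Each factor 1 - \<open>gauss t\<close> is split into two terms, the second of which
  advances the heat time by t; carrying the parameter a through the induction makes room for this.
  The k splittings give 2^k, and the growth in t stays linear.\<close>

lemma wnorm_large_time:
  "\<exists>c\<ge>0. \<forall>(m :: real^'n \<Rightarrow> complex) t a. rapid m \<longrightarrow> t > 0 \<longrightarrow> a \<ge> 0 \<longrightarrow>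
     wnorm (inv_fourier (\<lambda>\<xi>. complex_of_real (gauss (a * t) \<xi> * (1 - gauss t \<xi>) ^ k) * m \<xi>))
       \<le> ennreal (2 ^ k * c * (1 + (a + real k) * t)) * wnorm (inv_fourier m)"
proof -
  obtain c where c1: "c \<ge> 1" and c: "\<And>(m :: real^'n \<Rightarrow> complex) t. integrable lborel m \<Longrightarrow> t > 0 \<Longrightarrow>
     wnorm (inv_fourier (\<lambda>\<xi>. complex_of_real (exp (- t * (norm \<xi>)\<^sup>2)) * m \<xi>)) \<le> ennreal (c * (1 + t)) * wnorm (inv_fourier m)"
    using wnorm_heat[where 'n='n] by blast
  have "wnorm (inv_fourier (\<lambda>\<xi>. complex_of_real (gauss (a * t) \<xi> * (1 - gauss t \<xi>) ^ k) * m \<xi>))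
       \<le> ennreal (2 ^ k * c * (1 + (a + real k) * t)) * wnorm (inv_fourier m)"
    if m: "rapid m" and t: "t > 0" and a: "a \<ge> 0" for m :: "real^'n \<Rightarrow> complex" and t a
    using a
  proof (induction k arbitrary: a)
    case 0
    show ?case
    proof (cases "a = 0")
      case True
      have "ennreal 1 * wnorm (inv_fourier m) \<le> ennreal c * wnorm (inv_fourier m)"
        using c1 by (intro mult_right_mono ennreal_leI) auto
      then show ?thesis using True by (simp add: gauss_def)
    next
      case False
      then show ?thesis using c[OF rapid_integrable(2)[OF m], of "a * t"] t 0 by (simp add: gauss_def)
    qed
  next
    case (Suc k)
    define M where "M a \<xi> = complex_of_real (gauss (a * t) \<xi> * (1 - gauss t \<xi>) ^ k) * m \<xi>" for a \<xi>
    have [measurable]: "m \<in> borel_measurable borel" using m by (simp add: rapid_def)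
    have Mm[measurable]: "M a \<in> borel_measurable borel" for a unfolding M_def by measurable
    have Mi: "integrable lborel (M a)" if "a \<ge> 0" for a
    proof -
      have "rapid (\<lambda>\<xi>. complex_of_real (gauss (a * t) \<xi> * (1 - gauss t \<xi>) ^ k) * m \<xi>)"
        using gauss_pow_bounds[of t _ k] gauss_bounds[of "a * t"] that t m
        by (intro rapid_bounded_mult) (auto intro!: mult_le_one mult_nonneg_nonneg)
      then show ?thesis unfolding M_def by (rule rapid_integrable(2))
    qed
    have g: "gauss ((a + 1) * t) \<xi> = gauss (a * t) \<xi> * gauss t \<xi>" for \<xi> :: "real^'n"
      by (simp add: gauss_def algebra_simps flip: exp_add)
    have eq: "(\<lambda>\<xi>. complex_of_real (gauss (a * t) \<xi> * (1 - gauss t \<xi>) ^ Suc k) * m \<xi>) = (\<lambda>\<xi>. M a \<xi> + - M (a + 1) \<xi>)"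
      unfolding M_def g by (simp add: fun_eq_iff left_diff_distrib right_diff_distrib mult_ac)
    have inv: "inv_fourier (\<lambda>\<xi>. M a \<xi> + - M (a + 1) \<xi>) x = inv_fourier (M a) x + - inv_fourier (M (a + 1)) x" for x
      using Mi[of a] Mi[of "a + 1"] Suc.prems by (subst inv_fourier_add) (auto simp: inv_fourier_minus)
    have "wnorm (inv_fourier (\<lambda>\<xi>. M a \<xi> + - M (a + 1) \<xi>)) = wnorm (\<lambda>x. inv_fourier (M a) x + - inv_fourier (M (a + 1)) x)"
      by (simp only: inv wnorm_def)
    also have "\<dots> \<le> wnorm (inv_fourier (M a)) + wnorm (\<lambda>x. - inv_fourier (M (a + 1)) x)"
      by (rule wnorm_add) measurable
    also have "\<dots> \<le> ennreal (2 ^ k * c * (1 + (a + real k) * t)) * wnorm (inv_fourier m)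
        + ennreal (2 ^ k * c * (1 + (a + 1 + real k) * t)) * wnorm (inv_fourier m)"
      unfolding wnorm_minus M_def using Suc.prems by (intro add_mono Suc.IH) auto
    also have "\<dots> = ennreal (2 ^ k * c * (1 + (a + real k) * t) + 2 ^ k * c * (1 + (a + 1 + real k) * t)) * wnorm (inv_fourier m)"
      using c1 Suc.prems t by (subst ennreal_plus) (auto simp: distrib_right)
    also have "\<dots> \<le> ennreal (2 ^ Suc k * c * (1 + (a + real (Suc k)) * t)) * wnorm (inv_fourier m)"
    proof (intro mult_right_mono ennreal_leI)
      have "2 ^ k * c * (1 + (a + real k) * t) \<le> 2 ^ k * c * (1 + (a + real (Suc k)) * t)"
        using c1 t by (intro mult_left_mono add_left_mono mult_right_mono) auto
      moreover have "2 ^ k * c * (1 + (a + 1 + real k) * t) = 2 ^ k * c * (1 + (a + real (Suc k)) * t)" by (simp add: algebra_simps)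
      moreover have "2 ^ Suc k * c * (1 + (a + real (Suc k)) * t) = 2 ^ k * c * (1 + (a + real (Suc k)) * t) + 2 ^ k * c * (1 + (a + real (Suc k)) * t)"
        by simp
      ultimately show "2 ^ k * c * (1 + (a + real k) * t) + 2 ^ k * c * (1 + (a + 1 + real k) * t) \<le> 2 ^ Suc k * c * (1 + (a + real (Suc k)) * t)"
        by linarith
    qed auto
    finally show ?case unfolding eq .
  qed
  then show ?thesis using c1 by (intro exI[of _ c]) auto
qed

lemma inv_fourier_scale: "inv_fourier (\<lambda>\<xi>. complex_of_real a * m \<xi>) x = complex_of_real a * inv_fourier m x"
  unfolding inv_fourier_def by (simp add: mult.assoc mult.left_commute)

lemma wnorm_scale:
  assumes "a \<ge> 0" and [measurable]: "f \<in> borel_measurable borel"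
  shows "wnorm (\<lambda>x. complex_of_real a * f x) = ennreal a * wnorm f"
proof -
  have "wnorm (\<lambda>x. complex_of_real a * f x) = (\<integral>\<^sup>+x. ennreal a * ennreal ((1 + (norm x)\<^sup>2) * norm (f x)) \<partial>lborel)"
    unfolding wnorm_def
  proof (rule nn_integral_cong)
    fix x
    have "(1 + (norm x)\<^sup>2) * norm (complex_of_real a * f x) = a * ((1 + (norm x)\<^sup>2) * norm (f x))"
      using assms(1) by (simp add: norm_mult mult.left_commute)
    then show "ennreal ((1 + (norm x)\<^sup>2) * norm (complex_of_real a * f x)) = ennreal a * ennreal ((1 + (norm x)\<^sup>2) * norm (f x))"
      using assms(1) by (simp only:) (rule ennreal_mult, auto)
  qed
  also have "\<dots> = ennreal a * wnorm f" unfolding wnorm_def by (rule nn_integral_cmult) measurable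
  finally show ?thesis .
qed

text \<open>The weighted integrability of the fractional Laplacian rests on the subordination formula
  \<open>|\<xi>|\<^sup>n = c\<^sup>-\<^sup>1 \<integral> t powr (-n/2-1) (1 - exp(-t|\<xi>|\<^sup>2))\<^sup>n dt\<close>: the \<open>n\<close>-fold difference is \<open>O(t\<^sup>n)\<close>
  for small \<open>t\<close>, while for large \<open>t\<close> the second moment of a heat flow grows only linearly.\<close>

lemma wnorm_norm_power:
  fixes m :: "real^'n \<Rightarrow> complex"
  assumes n3: "CARD('n) \<ge> 3" and m: "wfast m"
  shows "wnorm (inv_fourier (\<lambda>\<xi>. complex_of_real (norm \<xi> ^ CARD('n)) * m \<xi>)) < \<infinity>"
proof -
  define n where "n = CARD('n)"
  have n: "n \<ge> 3" using n3 by (simp add: n_def)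
  \<comment> \<open>The majorant in the subordination variable, integrable at infinity because n/2 >
    1. For large t the kernel \<kappa> decays one power faster, which offsets the linear growth of
    the weighted norm.\<close>
  define D where "D t = indicator {0..1} t + indicator {1..} t *\<^sub>R t powr (- (real n / 2))" for t :: real
  have Di: "integrable lborel D"
    unfolding D_def using n
    by (intro Bochner_Integration.integrable_add integrable_powr_tail integrable_real_indicator) auto
  have D0: "D t \<ge> 0" for t by (simp add: D_def)
  define e where "e = - (real n / 2) - 1"
  define \<kappa> where "\<kappa> t = indicator {0<..} t * t powr e" for t :: real
  have [measurable]: "\<kappa> \<in> borel_measurable borel" "D \<in> borel_measurable borel" unfolding \<kappa>_def D_def by measurable
  have k0: "\<kappa> t \<ge> 0" for t by (simp add: \<kappa>_def)
  have k_small: "\<kappa> t * t ^ n \<le> 1" if "0 < t" "t \<le> 1" for t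
  proof -
    have "\<kappa> t * t ^ n = t powr (e + real n)" using that by (simp add: \<kappa>_def powr_add powr_realpow)
    also have "\<dots> \<le> 1" using that n by (intro powr_le1) (auto simp: e_def)
    finally show ?thesis .
  qed
  have k_large: "\<kappa> t * t = t powr (- (real n / 2))" "\<kappa> t \<le> t powr (- (real n / 2))" if "t \<ge> 1" for t
  proof -
    show eq: "\<kappa> t * t = t powr (- (real n / 2))"
      using that powr_add[of t e 1] by (simp add: \<kappa>_def e_def)
    show "\<kappa> t \<le> t powr (- (real n / 2))"
      unfolding eq[symmetric] using that k0[of t] by (simp add: mult_le_cancel_left1)
  qed
  \<comment> \<open>The normalising constant of the mixture; what matters is that it lies strictly
    between 0 and infinity.\<close>
  define I0 where "I0 = (\<integral>\<^sup>+s. ennreal (\<kappa> s * (1 - exp (- s)) ^ n) \<partial>lborel)"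
  have le_D: "\<kappa> s * (1 - exp (- s)) ^ n \<le> D s" for s
  proof -
    consider "s \<le> 0" | "0 < s" "s \<le> 1" | "s > 1" by linarith
    then show ?thesis
    proof cases
      case 2
      have "1 - exp (- s) \<le> s" using exp_ge_add_one_self[of "- s"] by linarith
      then have "\<kappa> s * (1 - exp (- s)) ^ n \<le> \<kappa> s * s ^ n" using 2 k0 by (intro mult_left_mono power_mono) auto
      also have "\<dots> \<le> 1" by (rule k_small) (use 2 in auto)
      also have "\<dots> \<le> D s" using 2 by (simp add: D_def)
      finally show ?thesis .
    next
      case 3
      have "(1 - exp (- s)) ^ n \<le> 1" using 3 by (intro power_le_one) auto
      then have "\<kappa> s * (1 - exp (- s)) ^ n \<le> \<kappa> s" using k0[of s] by (simp add: mult_left_le)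
      also have "\<dots> \<le> D s" using k_large(2)[of s] 3 by (simp add: D_def)
      finally show ?thesis .
    qed (simp add: \<kappa>_def D0)
  qed
  have I0_fin: "I0 < \<infinity>"
  proof -
    have "I0 \<le> (\<integral>\<^sup>+s. ennreal (D s) \<partial>lborel)" unfolding I0_def by (intro nn_integral_mono ennreal_leI le_D)
    also have "\<dots> < \<infinity>" using Di D0 by (simp add: nn_integral_eq_integral)
    finally show ?thesis .
  qed
  have I0_pos: "I0 \<noteq> 0"
  proof
    assume "I0 = 0"
    then have "AE s in lborel. ennreal (\<kappa> s * (1 - exp (- s)) ^ n) = 0"
      unfolding I0_def by (subst (asm) nn_integral_0_iff_AE) auto
    then have "AE s in lborel. s \<notin> {1..2::real}"
    proof eventually_elim
      case (elim s)
      show ?case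
      proof
        assume s: "s \<in> {1..2}"
        then have "\<kappa> s * (1 - exp (- s)) ^ n > 0" by (auto simp: \<kappa>_def)
        then show False using elim unfolding ennreal_eq_0_iff by linarith
      qed
    qed
    then have "{1..2::real} \<in> null_sets lborel" by (subst AE_iff_null_sets) auto
    then show False by (simp add: null_sets_def)
  qed
  define c0 where "c0 = enn2real I0"
  have I0: "I0 = ennreal c0" and c0: "c0 > 0"
    using I0_fin I0_pos by (auto simp: c0_def enn2real_positive_iff less_top zero_less_iff_neq_zero)
  \<comment> \<open>Substituting t = s/r^2 produces the factor (1/r^2) powr (1 + e), which is r^n
    for e = -n/2 - 1.\<close>
  have scale: "(\<integral>\<^sup>+t. ennreal (\<kappa> t * (1 - exp (- t * r\<^sup>2)) ^ n) \<partial>lborel) = ennreal (r ^ n * c0)" if r: "r > 0" for r :: real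
  proof -
    have "(\<integral>\<^sup>+t. ennreal (\<kappa> t * (1 - exp (- t * r\<^sup>2)) ^ n) \<partial>lborel)
       = ennreal \<bar>1 / r\<^sup>2\<bar> * (\<integral>\<^sup>+s. ennreal (\<kappa> (0 + 1 / r\<^sup>2 * s) * (1 - exp (- (0 + 1 / r\<^sup>2 * s) * r\<^sup>2)) ^ n) \<partial>lborel)"
      using r by (intro nn_integral_real_affine) auto
    also have "\<dots> = (\<integral>\<^sup>+s. ennreal (1 / r\<^sup>2) * ennreal (\<kappa> (1 / r\<^sup>2 * s) * (1 - exp (- s)) ^ n) \<partial>lborel)"
      using r by (subst nn_integral_cmult) auto
    also have "\<dots> = (\<integral>\<^sup>+s. ennreal (r ^ n) * ennreal (\<kappa> s * (1 - exp (- s)) ^ n) \<partial>lborel)"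
    proof (rule nn_integral_cong)
      fix s :: real
      show "ennreal (1 / r\<^sup>2) * ennreal (\<kappa> (1 / r\<^sup>2 * s) * (1 - exp (- s)) ^ n) = ennreal (r ^ n) * ennreal (\<kappa> s * (1 - exp (- s)) ^ n)"
      proof (cases "s > 0")
        case True
        have "1 / r\<^sup>2 * \<kappa> (1 / r\<^sup>2 * s) = (1 / r\<^sup>2 * (1 / r\<^sup>2) powr e) * s powr e"
          using True r powr_mult[of "1 / r\<^sup>2" s e] by (simp add: \<kappa>_def)
        also have "1 / r\<^sup>2 * (1 / r\<^sup>2) powr e = (1 / r\<^sup>2) powr (- (real n / 2))"
          using r powr_add[of "1 / r\<^sup>2" 1 e] by (simp add: e_def)
        also have "\<dots> = r ^ n"
        proof -
          have "(1 / r\<^sup>2) powr (- (real n / 2)) = (r powr 2) powr (real n / 2)"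
            using r by (simp add: powr_divide powr_minus)
          then show ?thesis using r by (simp only: powr_powr) (simp add: powr_realpow)
        qed
        finally have "1 / r\<^sup>2 * \<kappa> (1 / r\<^sup>2 * s) = r ^ n * \<kappa> s" using True by (simp add: \<kappa>_def)
        then have "1 / r\<^sup>2 * (\<kappa> (1 / r\<^sup>2 * s) * (1 - exp (- s)) ^ n) = r ^ n * (\<kappa> s * (1 - exp (- s)) ^ n)"
          by (metis mult.assoc)
        then show ?thesis using True r k0 by (subst (1 2) ennreal_mult[symmetric]) auto
      next
        case False
        then have "\<not> 0 < s / r\<^sup>2" using r by (simp add: divide_nonpos_pos not_less)
        then show ?thesis using False by (simp add: \<kappa>_def)
      qed
    qed
    also have "\<dots> = ennreal (r ^ n) * I0" unfolding I0_def by (rule nn_integral_cmult) measurable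
    also have "\<dots> = ennreal (r ^ n * c0)" unfolding I0 using r c0 by (simp add: ennreal_mult)
    finally show ?thesis .
  qed
  have rm: "rapid m" using m by (simp add: wfast_def)
  have [measurable]: "m \<in> borel_measurable borel" using rm by (simp add: rapid_def)
  define k where "k t \<xi> = \<kappa> t / c0 * (1 - gauss t \<xi>) ^ n" for t and \<xi> :: "real^'n"
  have "wnorm (inv_fourier (\<lambda>\<xi>. complex_of_real (norm \<xi> ^ n) * m \<xi>)) \<le> (\<integral>\<^sup>+t. wnorm (inv_fourier (\<lambda>\<xi>. complex_of_real (k t \<xi>) * m \<xi>)) \<partial>lborel)"
  proof (rule wnorm_superpose)
    show "case_prod k \<in> borel_measurable (borel \<Otimes>\<^sub>M borel)" unfolding k_def case_prod_beta' by measurable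
    show "0 \<le> k t \<xi>" for t \<xi>
    proof (cases "t > 0")
      case True
      then show ?thesis using c0 k0[of t] gauss_pow_bounds(1)[of t \<xi> n] by (simp add: k_def)
    qed (simp add: k_def \<kappa>_def)
    show "integrable lborel (\<lambda>\<xi>. complex_of_real (norm \<xi> ^ n) * m \<xi>)"
    proof (intro rapid_integrable(2) rapid_mult[OF rm, where A=1 and j=n])
      fix \<xi> :: "real^'n"
      show "\<bar>norm \<xi> ^ n\<bar> \<le> 1 * (1 + (norm \<xi>)\<^sup>2) ^ n"
        using norm_power_le_one_plus_sq[of \<xi> n] by simp
    qed measurable
    fix \<xi> :: "real^'n"
    show "(\<integral>\<^sup>+t. ennreal (k t \<xi>) \<partial>lborel) = ennreal (norm \<xi> ^ n)"
    proof (cases "\<xi> = 0")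
      case True
      then show ?thesis using n by (simp add: k_def gauss_def power_0_left)
    next
      case False
      have pos: "0 \<le> \<kappa> t * (1 - exp (- t * (norm \<xi>)\<^sup>2)) ^ n" for t
        by (cases "t > 0") (auto simp: \<kappa>_def)
      have "(\<integral>\<^sup>+t. ennreal (k t \<xi>) \<partial>lborel) = (\<integral>\<^sup>+t. ennreal (1 / c0) * ennreal (\<kappa> t * (1 - exp (- t * (norm \<xi>)\<^sup>2)) ^ n) \<partial>lborel)"
        using c0 pos by (intro nn_integral_cong) (subst ennreal_mult[symmetric], auto simp: k_def gauss_def)
      also have "\<dots> = ennreal (1 / c0) * (\<integral>\<^sup>+t. ennreal (\<kappa> t * (1 - exp (- t * (norm \<xi>)\<^sup>2)) ^ n) \<partial>lborel)"
        by (rule nn_integral_cmult) measurable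
      also have "\<dots> = ennreal (1 / c0) * ennreal (norm \<xi> ^ n * c0)"
        using scale[of "norm \<xi>"] False by simp
      also have "\<dots> = ennreal (norm \<xi> ^ n)" using c0 by (simp add: ennreal_mult[symmetric])
      finally show ?thesis .
    qed
  qed auto
  also have "\<dots> < \<infinity>"
  proof -
    obtain C where C0: "C \<ge> 0" and C: "\<And>t. 0 < t \<Longrightarrow> t \<le> 1 \<Longrightarrow>
       wnorm (inv_fourier (\<lambda>\<xi>. complex_of_real ((1 - gauss t \<xi>) ^ n) * m \<xi>)) \<le> ennreal (C * t ^ n)"
      using wnorm_small_time[OF m, of n] by blast
    obtain c where c: "c \<ge> 0" and c_le: "\<And>(m :: real^'n \<Rightarrow> complex) t a. rapid m \<Longrightarrow> t > 0 \<Longrightarrow> a \<ge> 0 \<Longrightarrow>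
       wnorm (inv_fourier (\<lambda>\<xi>. complex_of_real (gauss (a * t) \<xi> * (1 - gauss t \<xi>) ^ n) * m \<xi>))
         \<le> ennreal (2 ^ n * c * (1 + (a + real n) * t)) * wnorm (inv_fourier m)"
      using wnorm_large_time[where 'n='n and k=n] by blast
    define w where "w = enn2real (wnorm (inv_fourier m))"
    have w: "wnorm (inv_fourier m) = ennreal w" "w \<ge> 0" using wfast_wnorm[OF m] by (auto simp: w_def enn2real_nonneg)
    define A where "A = C / c0 + 2 ^ n * c * (1 + real n) * w / c0"
    have Apos: "C / c0 \<ge> 0" "2 ^ n * c * (1 + real n) * w / c0 \<ge> 0" using C0 c0 c w by auto
    have bound: "wnorm (inv_fourier (\<lambda>\<xi>. complex_of_real (k t \<xi>) * m \<xi>)) \<le> ennreal (A * D t)" for t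
    proof -
      let ?W = "wnorm (inv_fourier (\<lambda>\<xi>. complex_of_real ((1 - gauss t \<xi>) ^ n) * m \<xi>))"
      have eq: "wnorm (inv_fourier (\<lambda>\<xi>. complex_of_real (k t \<xi>) * m \<xi>)) = ennreal (\<kappa> t / c0) * ?W"
      proof -
        have "inv_fourier (\<lambda>\<xi>. complex_of_real (k t \<xi>) * m \<xi>)
            = (\<lambda>x. complex_of_real (\<kappa> t / c0) * inv_fourier (\<lambda>\<xi>. complex_of_real ((1 - gauss t \<xi>) ^ n) * m \<xi>) x)"
          unfolding inv_fourier_scale[symmetric] by (simp add: k_def mult.assoc)
        then show ?thesis using k0[of t] c0 by (simp only:) (rule wnorm_scale, auto)
      qed
      consider "t \<le> 0" | "0 < t" "t \<le> 1" | "t > 1" by linarith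
      then show ?thesis
      proof cases
        case 1
        then show ?thesis unfolding eq by (simp add: \<kappa>_def)
      next
        case 2
        have "ennreal (\<kappa> t / c0) * ?W \<le> ennreal (\<kappa> t / c0) * ennreal (C * t ^ n)"
          by (intro mult_left_mono C) (use 2 in auto)
        also have "\<dots> = ennreal (C / c0 * (\<kappa> t * t ^ n))"
          using 2 C0 c0 k0[of t] by (subst ennreal_mult[symmetric]) (auto simp: mult_ac)
        also have "\<dots> \<le> ennreal (A * D t)"
        proof (intro ennreal_leI mult_mono)
          show "C / c0 \<le> A" using Apos by (simp add: A_def)
          have "1 \<le> D t" using 2 by (simp add: D_def)
          then show "\<kappa> t * t ^ n \<le> D t" using k_small[of t] 2 by linarith
        qed (use 2 k0 Apos in \<open>auto simp: A_def\<close>)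
        finally show ?thesis unfolding eq .
      next
        case 3
        have "?W \<le> ennreal (2 ^ n * c * (1 + (0 + real n) * t)) * wnorm (inv_fourier m)"
          using c_le[OF rm, of t 0] 3 by (simp add: gauss_def)
        then have "ennreal (\<kappa> t / c0) * ?W \<le> ennreal (\<kappa> t / c0) * (ennreal (2 ^ n * c * (1 + (0 + real n) * t)) * ennreal w)"
          unfolding w(1) by (intro mult_left_mono) auto
        also have "\<dots> = ennreal (\<kappa> t / c0 * (2 ^ n * c * (1 + real n * t) * w))"
        proof -
          have "ennreal (2 ^ n * c * (1 + (0 + real n) * t)) * ennreal w = ennreal (2 ^ n * c * (1 + real n * t) * w)"
            using c w 3 by (subst ennreal_mult) (auto simp del: ennreal_plus)
          moreover have "ennreal (\<kappa> t / c0) * ennreal (2 ^ n * c * (1 + real n * t) * w) = ennreal (\<kappa> t / c0 * (2 ^ n * c * (1 + real n * t) * w))"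
            using c c0 k0[of t] w 3 by (intro ennreal_mult[symmetric]) auto
          ultimately show ?thesis by (simp only:)
        qed
        also have "\<kappa> t / c0 * (2 ^ n * c * (1 + real n * t) * w) = 2 ^ n * c * w / c0 * (\<kappa> t + real n * (\<kappa> t * t))"
          by (simp add: algebra_simps add_divide_distrib)
        also have "ennreal \<dots> \<le> ennreal (A * D t)"
        proof (rule ennreal_leI)
          have "2 ^ n * c * w / c0 * (\<kappa> t + real n * (\<kappa> t * t)) \<le> 2 ^ n * c * w / c0 * ((1 + real n) * t powr (- (real n / 2)))"
            using k_large[of t] 3 c c0 w by (intro mult_left_mono) (auto simp: distrib_right)
          also have "\<dots> = 2 ^ n * c * (1 + real n) * w / c0 * t powr (- (real n / 2))" by (simp add: mult_ac)
          also have "\<dots> \<le> A * D t"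
            using Apos 3 by (intro mult_mono) (auto simp: A_def D_def)
          finally show "2 ^ n * c * w / c0 * (\<kappa> t + real n * (\<kappa> t * t)) \<le> A * D t" .
        qed
        finally show ?thesis unfolding eq .
      qed
    qed
    have "(\<integral>\<^sup>+t. wnorm (inv_fourier (\<lambda>\<xi>. complex_of_real (k t \<xi>) * m \<xi>)) \<partial>lborel) \<le> (\<integral>\<^sup>+t. ennreal (A * D t) \<partial>lborel)"
      by (intro nn_integral_mono bound)
    also have "\<dots> < \<infinity>"
      using Di D0 Apos by (subst nn_integral_eq_integral) (auto simp: A_def)
    finally show ?thesis .
  qed
  finally show ?thesis by (simp add: n_def)
qed

lemma wfast_fourier: "schwartz_fun f \<Longrightarrow> wfast (cfourier f)"
  unfolding wfast_def using rapid_fourier wnorm_laplace_power by blast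

section \<open>The constant of the logarithmic fundamental solution\<close>

text \<open>This is the constant \<gamma> of the fundamental solution, half of
  \<open>Lambda1\<close>, in the form in which the Gamma integral delivers it.\<close>

definition log_const :: "nat \<Rightarrow> real" where
  "log_const n = (4 * pi) powr (real n / 2) * Gamma (real n / 2) / 2"

text \<open>Legendre duplication at z = n/2 rewrites (n - 1)! = Gamma(2z) through Gamma(z) Gamma(z +
  1/2), and the second factor cancels the Gamma value in \<open>sphere_vol\<close>.\<close>

lemma Lambda1_eq_log_const:
  assumes "n \<ge> 1"
  shows "Lambda1 n = 2 * log_const n"
proof -
  define z where "z = real n / 2"
  have z: "z > 0" using assms by (simp add: z_def)
  have cz: "complex_of_real z \<notin> \<int>\<^sub>\<le>\<^sub>0" "complex_of_real z + 1/2 \<notin> \<int>\<^sub>\<le>\<^sub>0"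
  proof -
    have pos: "complex_of_real x \<notin> \<int>\<^sub>\<le>\<^sub>0" if "x > 0" for x
    proof
      assume "complex_of_real x \<in> \<int>\<^sub>\<le>\<^sub>0"
      then obtain k where "complex_of_real x = of_int k" "k \<le> 0" by (rule nonpos_Ints_cases)
      then have "x = of_int k" by (metis of_real_of_int_eq of_real_eq_iff)
      then show False using that \<open>k \<le> 0\<close> by simp
    qed
    from pos[OF z] pos[of "z + 1/2"] z show "complex_of_real z \<notin> \<int>\<^sub>\<le>\<^sub>0" "complex_of_real z + 1/2 \<notin> \<int>\<^sub>\<le>\<^sub>0" by auto
  qed
  have "complex_of_real (Gamma z * Gamma (z + 1/2)) = Gamma (complex_of_real z) * Gamma (complex_of_real z + 1/2)"
    using Gamma_complex_of_real[of z] Gamma_complex_of_real[of "z + 1/2"] by simp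
  also have "\<dots> = exp ((1 - 2 * complex_of_real z) * complex_of_real (ln 2)) * complex_of_real (sqrt pi) * Gamma (2 * complex_of_real z)"
    by (rule Gamma_legendre_duplication[OF cz])
  also have "\<dots> = complex_of_real (exp ((1 - 2 * z) * ln 2) * sqrt pi * Gamma (2 * z))"
    using Gamma_complex_of_real[of "2 * z"] by (simp flip: exp_of_real)
  finally have "Gamma z * Gamma (z + 1/2) = exp ((1 - 2 * z) * ln 2) * sqrt pi * Gamma (2 * z)"
    unfolding of_real_eq_iff .
  also have "Gamma (2 * z) = fact (n - 1)"
    using Gamma_fact[of "n - 1", where 'a=real] assms by (simp add: z_def)
  also have "exp ((1 - 2 * z) * ln 2) = 2 / 2 powr real n"
    by (simp add: z_def powr_def exp_diff left_diff_distrib)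
  finally have dup: "fact (n - 1) = Gamma z * Gamma (z + 1/2) * 2 powr real n / (2 * sqrt pi)"
    by simp
  have zz: "(real n + 1) / 2 = z + 1/2" by (simp add: z_def add_divide_distrib)
  have g: "Gamma (z + 1/2) > 0" using z by (intro Gamma_real_pos) auto
  have p1: "pi powr (z + 1/2) = pi powr z * sqrt pi" by (simp add: powr_add powr_half_sqrt)
  have p2: "(4 * pi) powr z = 2 powr real n * pi powr z"
  proof -
    have "(4::real) powr z = (2 powr 2) powr z" by simp
    also have "\<dots> = 2 powr real n" unfolding powr_powr by (simp add: z_def)
    finally show ?thesis by (simp add: powr_mult)
  qed
  have "Lambda1 n = Gamma z * 2 powr real n * pi powr z"
    unfolding Lambda1_def sphere_vol_def zz dup p1 using g by (simp add: field_simps)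
  also have "\<dots> = 2 * log_const n" unfolding log_const_def z_def[symmetric] p2 by (simp add: mult_ac)
  finally show ?thesis .
qed

text \<open>The substitution u = s r^2 turns the integral into that of Gamma(n/2) and cancels r^n.
  Independence of r is the reason why the logarithm inverts the multiplier |\<xi>|^n.\<close>

lemma gamma_kernel_integral:
  fixes r :: real
  assumes r: "r > 0" and n: "n \<ge> 1"
  shows "(\<integral>\<^sup>+s. ennreal (indicator {0<..} s * (1 / (2 * s) * (4 * pi * s) powr (real n / 2) * exp (- s * r\<^sup>2) * r ^ n)) \<partial>lborel)
     = ennreal (log_const n)"
proof -
  define z where "z = real n / 2"
  have z: "z > 0" using n by (simp add: z_def)
  define a where "a = (4 * pi) powr z / 2"
  have a: "a > 0" by (simp add: a_def)
  let ?f = "\<lambda>s. indicator {0<..} s * (1 / (2 * s) * (4 * pi * s) powr (real n / 2) * exp (- s * r\<^sup>2) * r ^ n)"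
  have "(\<integral>\<^sup>+s. ennreal (?f s) \<partial>lborel) = ennreal \<bar>1 / r\<^sup>2\<bar> * (\<integral>\<^sup>+u. ennreal (?f (0 + 1 / r\<^sup>2 * u)) \<partial>lborel)"
    using r by (intro nn_integral_real_affine) auto
  also have "\<dots> = (\<integral>\<^sup>+u. ennreal \<bar>1 / r\<^sup>2\<bar> * ennreal (?f (0 + 1 / r\<^sup>2 * u)) \<partial>lborel)"
    by (rule nn_integral_cmult[symmetric]) measurable
  also have "\<dots> = (\<integral>\<^sup>+u. ennreal a * ennreal (indicator {0..} u * u powr (z - 1) / exp u) \<partial>lborel)"
  proof (rule nn_integral_cong_AE)
    show "AE u in lborel. ennreal \<bar>1 / r\<^sup>2\<bar> * ennreal (?f (0 + 1 / r\<^sup>2 * u)) = ennreal a * ennreal (indicator {0..} u * u powr (z - 1) / exp u)"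
      using AE_lborel_singleton[of "0::real"]
    proof eventually_elim
      case (elim u)
      show ?case
      proof (cases "u > 0")
        case True
        have rz: "(1 / r\<^sup>2) powr z = 1 / r ^ n"
        proof -
          have "(r\<^sup>2) powr z = (r powr 2) powr z" using r by simp
          also have "\<dots> = r ^ n" unfolding powr_powr using r by (simp add: z_def powr_realpow)
          finally show ?thesis by (simp add: powr_divide)
        qed
        have "(4 * pi * (1 / r\<^sup>2 * u)) powr z = (4 * pi) powr z * ((1 / r\<^sup>2) powr z * u powr z)"
          using True r by (simp only: powr_mult)
        then have p: "(4 * pi * (1 / r\<^sup>2 * u)) powr z = 2 * a * (1 / r ^ n * u powr z)" by (simp add: a_def rz)
        have "?f (1 / r\<^sup>2 * u) = 1 / (2 * (1 / r\<^sup>2 * u)) * (2 * a * (1 / r ^ n * u powr z)) * exp (- u) * r ^ n"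
          using True r unfolding z_def[symmetric] p by simp
        also have "\<dots> = r\<^sup>2 * (a * (u powr z / u * exp (- u)))" using True r by (simp add: field_simps)
        also have "u powr z / u * exp (- u) = u powr (z - 1) / exp u"
          using True by (simp add: powr_diff exp_minus divide_inverse)
        finally have "1 / r\<^sup>2 * ?f (1 / r\<^sup>2 * u) = a * (indicator {0..} u * u powr (z - 1) / exp u)"
          using True r by simp
        then show ?thesis using True r a by (simp add: ennreal_mult[symmetric])
      next
        case False
        then have "\<not> 0 < u / r\<^sup>2" using r by (simp add: divide_nonpos_pos not_less)
        then show ?thesis using False elim by simp
      qed
    qed
  qed
  also have "\<dots> = ennreal a * ennreal (Gamma z)"
    using z by (subst nn_integral_cmult) (auto simp: Gamma_conv_nn_integral_real)
  also have "\<dots> = ennreal (log_const n)"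
    using a z Gamma_real_pos[of z] by (simp add: ennreal_mult[symmetric] log_const_def a_def z_def)
  finally show ?thesis .
qed

section \<open>The fractional Laplacian of a test function: decay and Gaussian averages\<close>

lemma frac_lap_eq:
  fixes \<phi> :: "real^'n \<Rightarrow> real"
  shows "frac_lap (real CARD('n) / 2) \<phi> x = Re (inv_fourier (\<lambda>\<xi>. complex_of_real (norm \<xi> ^ CARD('n)) * cfourier \<phi> \<xi>) x)"
proof -
  have "norm \<xi> powr (2 * (real CARD('n) / 2)) = norm \<xi> ^ CARD('n)" for \<xi> :: "real^'n"
    using zero_less_card_finite[where 'a='n] by (cases "\<xi> = 0") (auto simp: powr_realpow)
  then show ?thesis by (simp add: frac_lap_def)
qed

locale frac_test =
  fixes \<phi> :: "real^'n \<Rightarrow> real"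
  assumes n3: "CARD('n) \<ge> 3" and schwartz: "schwartz_fun \<phi>"
begin

definition symb :: "real^'n \<Rightarrow> complex" where
  "symb \<xi> = complex_of_real (norm \<xi> ^ CARD('n)) * cfourier \<phi> \<xi>"

definition g :: "real^'n \<Rightarrow> real" where
  "g = frac_lap (real CARD('n) / 2) \<phi>"

lemma g_eq: "g x = Re (inv_fourier symb x)"
  unfolding g_def frac_lap_eq symb_def[abs_def] ..

lemma rapid_symb: "rapid symb"
  unfolding symb_def[abs_def]
proof (rule rapid_mult[OF rapid_fourier[OF schwartz], where A=1 and j="CARD('n)"])
  fix \<xi> :: "real^'n"
  show "\<bar>norm \<xi> ^ CARD('n)\<bar> \<le> 1 * (1 + (norm \<xi>)\<^sup>2) ^ CARD('n)"
    using norm_power_le_one_plus_sq[of \<xi> "CARD('n)"] by simp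
qed measurable

lemma symb_integrable: "integrable lborel symb" by (rule rapid_integrable(2)[OF rapid_symb])

lemma symb_measurable [measurable]: "symb \<in> borel_measurable borel"
  using rapid_symb by (simp add: rapid_def)

lemma g_measurable [measurable]: "g \<in> borel_measurable borel"
  unfolding g_eq[abs_def] by measurable

lemma g_bounded: "\<exists>G\<ge>0. \<forall>x. \<bar>g x\<bar> \<le> G"
proof (intro exI[of _ "1 / (2 * pi) ^ CARD('n) * (LINT \<xi>|lborel. norm (symb \<xi>))"] conjI allI)
  show "\<bar>g x\<bar> \<le> 1 / (2 * pi) ^ CARD('n) * (LINT \<xi>|lborel. norm (symb \<xi>))" for x
    unfolding g_eq using abs_Re_le_cmod[of "inv_fourier symb x"] norm_inv_fourier_le[OF symb_integrable, of x] by linarith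
  show "0 \<le> 1 / (2 * pi) ^ CARD('n) * (LINT \<xi>|lborel. norm (symb \<xi>))"
    by (intro mult_nonneg_nonneg integral_nonneg_AE) auto
qed

lemma g_weighted_integrable: "integrable lborel (\<lambda>x. (1 + (norm x)\<^sup>2) * g x)"
proof (rule integrableI_bounded)
  have "(\<integral>\<^sup>+x. ennreal (norm ((1 + (norm x)\<^sup>2) * g x)) \<partial>lborel) \<le> wnorm (inv_fourier symb)"
    unfolding wnorm_def
  proof (intro nn_integral_mono ennreal_leI)
    fix x
    show "norm ((1 + (norm x)\<^sup>2) * g x) \<le> (1 + (norm x)\<^sup>2) * norm (inv_fourier symb x)"
      unfolding g_eq by (simp add: abs_mult abs_Re_le_cmod mult_left_mono)
  qed
  also have "\<dots> < \<infinity>"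
    unfolding symb_def[abs_def] by (rule wnorm_norm_power[OF n3 wfast_fourier[OF schwartz]])
  finally show "(\<integral>\<^sup>+x. ennreal (norm ((1 + (norm x)\<^sup>2) * g x)) \<partial>lborel) < \<infinity>" .
qed measurable

lemma g_dominated_integrable:
  assumes [measurable]: "h \<in> borel_measurable borel" and h: "\<And>x. \<bar>h x\<bar> \<le> A * (1 + (norm x)\<^sup>2)"
  shows "integrable lborel (\<lambda>x. g x * h x)"
proof (rule Bochner_Integration.integrable_bound[OF integrable_mult_right[OF g_weighted_integrable, of A]])
  show "AE x in lborel. norm (g x * h x) \<le> norm (A * ((1 + (norm x)\<^sup>2) * g x))"
  proof (intro always_eventually allI)
    fix x
    have "\<bar>g x\<bar> * \<bar>h x\<bar> \<le> \<bar>g x\<bar> * \<bar>A * (1 + (norm x)\<^sup>2)\<bar>"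
      using h[of x] by (intro mult_left_mono) auto
    then show "norm (g x * h x) \<le> norm (A * ((1 + (norm x)\<^sup>2) * g x))"
      by (simp add: abs_mult mult_ac)
  qed
qed measurable

lemma g_integrable: "integrable lborel g"
  using g_dominated_integrable[of "\<lambda>_. 1" 1] by simp

text \<open>Up to the factor (4 pi s)^(n/2), the heat flow of \<open>g\<close> at time s and point
  y. Left unnormalised, it tends to the integral of \<open>g\<close> as s grows.\<close>

definition Z :: "real^'n \<Rightarrow> real \<Rightarrow> real" where
  "Z y s = (LINT x|lborel. g x * exp (- (1 / (4 * s)) * (norm (x - y))\<^sup>2))"

lemma gauss_g_integrable: "s > 0 \<Longrightarrow> integrable lborel (\<lambda>x. g x * exp (- (1 / (4 * s)) * (norm (x - y))\<^sup>2))"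
proof (rule g_dominated_integrable[where A=1])
  fix x :: "real^'n"
  assume "s > 0"
  then have e1: "exp (- (1 / (4 * s)) * (norm (x - y))\<^sup>2) \<le> 1" by simp
  show "\<bar>exp (- (1 / (4 * s)) * (norm (x - y))\<^sup>2)\<bar> \<le> 1 * (1 + (norm x)\<^sup>2)"
    unfolding abs_exp_cancel by (rule order_trans[OF e1]) simp
qed measurable

lemma Z_eq:
  assumes s: "s > 0"
  shows "Z y s = (4 * pi * s) powr (real CARD('n) / 2) * Re (inv_fourier (\<lambda>\<xi>. complex_of_real (exp (- s * (norm \<xi>)\<^sup>2)) * symb \<xi>) y)"
proof -
  define G where "G = inv_fourier symb"
  have [measurable]: "G \<in> borel_measurable borel" unfolding G_def by measurable
  have hi: "integrable lborel (\<lambda>x. heat s (y - x))"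
    using heat_integrable[OF s, of 0] lborel_integral_reflect(2)[of "heat s" y] by simp
  have gi: "integrable lborel (\<lambda>x. complex_of_real (heat s (y - x)) * G x)"
  proof (rule Bochner_Integration.integrable_bound)
    show "integrable lborel (\<lambda>x. heat s (y - x) * (1 / (2 * pi) ^ CARD('n) * (LINT \<xi>|lborel. norm (symb \<xi>))))"
      by (intro integrable_mult_left hi)
    show "AE x in lborel. norm (complex_of_real (heat s (y - x)) * G x) \<le> norm (heat s (y - x) * (1 / (2 * pi) ^ CARD('n) * (LINT \<xi>|lborel. norm (symb \<xi>))))"
      unfolding norm_mult norm_of_real real_norm_def abs_mult
      using norm_inv_fourier_le[OF symb_integrable] unfolding G_def
      by (intro always_eventually allI mult_left_mono) (auto simp flip: abs_mult intro: order_trans[OF _ abs_ge_self])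
  qed measurable
  have "Re (inv_fourier (\<lambda>\<xi>. complex_of_real (exp (- s * (norm \<xi>)\<^sup>2)) * symb \<xi>) y) = Re (LINT x|lborel. complex_of_real (heat s (y - x)) * G x)"
    unfolding inv_fourier_heat[OF symb_integrable s, symmetric] G_def ..
  also have "\<dots> = (LINT x|lborel. Re (complex_of_real (heat s (y - x)) * G x))"
    by (rule integral_Re[OF gi, symmetric])
  also have "\<dots> = (LINT x|lborel. (4 * pi * s) powr (- (real CARD('n) / 2)) * (g x * exp (- (1 / (4 * s)) * (norm (x - y))\<^sup>2)))"
    unfolding g_eq G_def by (intro Bochner_Integration.integral_cong refl) (simp add: heat_def norm_minus_commute mult_ac)
  also have "\<dots> = (4 * pi * s) powr (- (real CARD('n) / 2)) * Z y s"
    unfolding Z_def by (rule integral_mult_right_zero)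
  finally show ?thesis using s by (simp add: powr_minus field_simps)
qed

text \<open>The symbol vanishes to order n at the origin, so the heat flow decays like s^(-n); the
  prefactor gives back s^(n/2). The net rate s^(-n/2) is at least as good as s^(-3/2) for n \<ge> 3,
  and an exponent above 1 is what the second moment requires.\<close>

lemma Z_decay: "\<exists>C. \<forall>y s. s \<ge> 1 \<longrightarrow> \<bar>Z y s\<bar> \<le> C * s powr (- (3 / 2))"
proof -
  define B where "B = (LINT x|lborel. norm (complex_of_real (\<phi> x)))"
  have B: "norm (cfourier \<phi> \<xi>) \<le> B" for \<xi> unfolding B_def by (rule norm_fourier_le[OF schwartz_integrable_complex[OF schwartz]])
  have B0: "B \<ge> 0" using order_trans[OF norm_ge_zero B] .
  define J0 where "J0 = (LINT w::real^'n|lborel. norm w ^ CARD('n) * exp (- 1 * (norm w)\<^sup>2))"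
  define C where "C = (4 * pi) powr (real CARD('n) / 2) * (1 / (2 * pi) ^ CARD('n) * (B * J0))"
  have J0n: "J0 \<ge> 0" unfolding J0_def by (rule integral_nonneg_AE) auto
  have "\<bar>Z y s\<bar> \<le> C * s powr (- (3 / 2))" if s: "s \<ge> 1" for y s
  proof -
    have s0: "s > 0" using s by simp
    have i1: "integrable lborel (\<lambda>\<xi>::real^'n. norm \<xi> ^ CARD('n) * exp (- s * (norm \<xi>)\<^sup>2))"
      using norm_power_le_one_plus_sq[where k="CARD('n)"] by (intro integrable_nonneg_bound[OF integrable_weighted_gaussian[OF s0, of "CARD('n)"]]) (auto intro!: mult_right_mono)
    have mi: "integrable lborel (\<lambda>\<xi>. complex_of_real (exp (- s * (norm \<xi>)\<^sup>2)) * symb \<xi>)"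
      by (intro rapid_integrable(2) rapid_bounded_mult[OF rapid_symb]) (use s in auto)
    have J: "(LINT \<xi>::real^'n|lborel. norm \<xi> ^ CARD('n) * exp (- s * (norm \<xi>)\<^sup>2)) = s powr (- real CARD('n)) * J0"
    proof -
      define c where "c = 1 / sqrt s"
      have c: "c > 0" using s0 by (simp add: c_def)
      have c2: "c\<^sup>2 = 1 / s" using s0 by (simp add: c_def power_divide)
      have "(LINT \<xi>::real^'n|lborel. norm \<xi> ^ CARD('n) * exp (- s * (norm \<xi>)\<^sup>2))
         = c ^ CARD('n) * (LINT w::real^'n|lborel. norm (c *\<^sub>R w) ^ CARD('n) * exp (- s * (norm (c *\<^sub>R w))\<^sup>2))"
        using lborel_integral_scale(1)[OF c, of "\<lambda>\<xi>::real^'n. norm \<xi> ^ CARD('n) * exp (- s * (norm \<xi>)\<^sup>2)"] by simp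
      also have "(LINT w::real^'n|lborel. norm (c *\<^sub>R w) ^ CARD('n) * exp (- s * (norm (c *\<^sub>R w))\<^sup>2)) = (LINT w::real^'n|lborel. c ^ CARD('n) * (norm w ^ CARD('n) * exp (- 1 * (norm w)\<^sup>2)))"
        using c s0 by (intro Bochner_Integration.integral_cong refl) (simp add: power_mult_distrib c2 mult_ac)
      also have "\<dots> = c ^ CARD('n) * J0" unfolding J0_def by (rule integral_mult_right_zero)
      also have "c ^ CARD('n) * (c ^ CARD('n) * J0) = (c\<^sup>2) ^ CARD('n) * J0" by (simp add: power2_eq_square power_mult_distrib)
      also have "(c\<^sup>2) ^ CARD('n) = s powr (- real CARD('n))" using s0 by (simp add: c2 power_divide powr_minus powr_realpow divide_inverse power_inverse)
      finally show ?thesis .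
    qed
    have "norm (inv_fourier (\<lambda>\<xi>. complex_of_real (exp (- s * (norm \<xi>)\<^sup>2)) * symb \<xi>) y)
       \<le> 1 / (2 * pi) ^ CARD('n) * (LINT \<xi>|lborel. norm (complex_of_real (exp (- s * (norm \<xi>)\<^sup>2)) * symb \<xi>))"
      by (rule norm_inv_fourier_le[OF mi])
    also have "\<dots> \<le> 1 / (2 * pi) ^ CARD('n) * (LINT \<xi>::real^'n|lborel. B * (norm \<xi> ^ CARD('n) * exp (- s * (norm \<xi>)\<^sup>2)))"
    proof (intro mult_left_mono integral_mono integrable_norm mi integrable_mult_right i1)
      fix \<xi> :: "real^'n"
      have "norm (complex_of_real (exp (- s * (norm \<xi>)\<^sup>2)) * symb \<xi>) = norm \<xi> ^ CARD('n) * exp (- s * (norm \<xi>)\<^sup>2) * norm (cfourier \<phi> \<xi>)"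
        unfolding symb_def norm_mult norm_of_real by simp
      also have "\<dots> \<le> norm \<xi> ^ CARD('n) * exp (- s * (norm \<xi>)\<^sup>2) * B" by (intro mult_left_mono B) auto
      finally show "norm (complex_of_real (exp (- s * (norm \<xi>)\<^sup>2)) * symb \<xi>) \<le> B * (norm \<xi> ^ CARD('n) * exp (- s * (norm \<xi>)\<^sup>2))"
        by (simp only: mult.commute)
    qed auto
    also have "\<dots> = 1 / (2 * pi) ^ CARD('n) * (B * (s powr (- real CARD('n)) * J0))" using J by simp
    finally have le: "norm (inv_fourier (\<lambda>\<xi>. complex_of_real (exp (- s * (norm \<xi>)\<^sup>2)) * symb \<xi>) y) \<le> 1 / (2 * pi) ^ CARD('n) * (B * (s powr (- real CARD('n)) * J0))" .
    have "\<bar>Z y s\<bar> \<le> (4 * pi * s) powr (real CARD('n) / 2) * norm (inv_fourier (\<lambda>\<xi>. complex_of_real (exp (- s * (norm \<xi>)\<^sup>2)) * symb \<xi>) y)"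
      unfolding Z_eq[OF s0] abs_mult using abs_Re_le_cmod by (intro mult_mono) auto
    also have "\<dots> \<le> (4 * pi * s) powr (real CARD('n) / 2) * (1 / (2 * pi) ^ CARD('n) * (B * (s powr (- real CARD('n)) * J0)))"
      by (intro mult_left_mono le) auto
    also have "(4 * pi * s) powr (real CARD('n) / 2) = (4 * pi) powr (real CARD('n) / 2) * s powr (real CARD('n) / 2)"
      using s0 by (simp add: powr_mult)
    also have "(4 * pi) powr (real CARD('n) / 2) * s powr (real CARD('n) / 2) * (1 / (2 * pi) ^ CARD('n) * (B * (s powr (- real CARD('n)) * J0))) = C * (s powr (real CARD('n) / 2) * s powr (- real CARD('n)))"
      unfolding C_def by (simp only: mult_ac)
    also have "s powr (real CARD('n) / 2) * s powr (- real CARD('n)) = s powr (- (real CARD('n) / 2))" by (simp flip: powr_add)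
    also have "C * \<dots> \<le> C * s powr (- (3 / 2))"
      using s n3 B0 J0n by (intro mult_left_mono powr_mono) (auto simp: C_def)
    finally show ?thesis .
  qed
  then show ?thesis by blast
qed

end

section \<open>Vanishing moments and the logarithmic potential of \<open>g\<close>\<close>

context frac_test
begin

lemma sq_dist_integrable: "integrable lborel (\<lambda>x. g x * (norm (x - y))\<^sup>2)"
  by (rule g_dominated_integrable[where A="2 + 2 * (norm y)\<^sup>2"]) (use norm_diff_sq_le in auto)

lemma s_seq_powr_lim:
  assumes "a < 0"
  shows "(\<lambda>k. C * real (Suc k) powr a) \<longlonglongrightarrow> 0"
proof -
  have "((\<lambda>k. real (Suc k) powr a) \<longlonglongrightarrow> 0)"
    using assms by (intro tendsto_neg_powr filterlim_compose[OF filterlim_real_sequentially filterlim_Suc])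
  then show ?thesis using tendsto_mult_left[of _ 0 _ C] by simp
qed

text \<open>As s grows the Gaussian tends to 1, so \<open>Z 0 s\<close> tends to the integral of
  \<open>g\<close>, while \<open>Z_decay\<close> forces the limit 0.\<close>

lemma g_integral_zero: "(LINT x|lborel. g x) = 0"
proof -
  obtain C where C: "\<And>y s. s \<ge> 1 \<Longrightarrow> \<bar>Z y s\<bar> \<le> C * s powr (- (3 / 2))" using Z_decay by blast
  have "(\<lambda>k. Z 0 (real (Suc k))) \<longlonglongrightarrow> 0"
  proof (rule Lim_null_comparison)
    show "\<forall>\<^sub>F k in sequentially. norm (Z 0 (real (Suc k))) \<le> C * real (Suc k) powr (- (3 / 2))"
      using C by (intro always_eventually allI) auto
    show "(\<lambda>k. C * real (Suc k) powr (- (3 / 2))) \<longlonglongrightarrow> 0" by (rule s_seq_powr_lim) simp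
  qed
  moreover have "(\<lambda>k. Z 0 (real (Suc k))) \<longlonglongrightarrow> (LINT x|lborel. g x)"
    unfolding Z_def
  proof (rule integral_dominated_convergence[where w="\<lambda>x. \<bar>g x\<bar>"])
    show "AE x in lborel. (\<lambda>k. g x * exp (- (1 / (4 * real (Suc k))) * (norm (x - 0))\<^sup>2)) \<longlonglongrightarrow> g x"
    proof (intro always_eventually allI)
      fix x :: "real^'n"
      have "(\<lambda>k. 1 / (4 * real (Suc k))) \<longlonglongrightarrow> 0" by real_asymp
      then have "(\<lambda>k. g x * exp (- (1 / (4 * real (Suc k))) * (norm (x - 0))\<^sup>2)) \<longlonglongrightarrow> g x * exp (- 0 * (norm (x - 0))\<^sup>2)"
        by (intro tendsto_intros)
      then show "(\<lambda>k. g x * exp (- (1 / (4 * real (Suc k))) * (norm (x - 0))\<^sup>2)) \<longlonglongrightarrow> g x" by simp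
    qed
    show "AE x in lborel. norm (g x * exp (- (1 / (4 * real (Suc k))) * (norm (x - 0))\<^sup>2)) \<le> \<bar>g x\<bar>" for k
      by (intro always_eventually allI) (simp add: abs_mult mult_left_le)
  qed (use g_integrable in auto)
  ultimately show ?thesis using LIMSEQ_unique by blast
qed

text \<open>The functions 4s(1 - exp(-|x - y|^2/(4s))) converge to |x - y|^2 from below. Against
  \<open>g\<close> they give -4s \<open>Z y s\<close>, of order s^(-1/2). Dimension at least 3 is
  essential: the Laplacian of |x|^2 in the plane is a nonzero constant.\<close>

lemma g_sq_dist_integral_zero: "(LINT x|lborel. g x * (norm (x - y))\<^sup>2) = 0"
proof -
  obtain C where C: "\<And>y s. s \<ge> 1 \<Longrightarrow> \<bar>Z y s\<bar> \<le> C * s powr (- (3 / 2))" using Z_decay by blast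
  define E where "E k x = 4 * real (Suc k) * (1 - exp (- (1 / (4 * real (Suc k))) * (norm (x - y))\<^sup>2))" for k x
  have "(\<lambda>k. LINT x|lborel. g x * E k x) \<longlonglongrightarrow> 0"
  proof (rule Lim_null_comparison)
    show "\<forall>\<^sub>F k in sequentially. norm (LINT x|lborel. g x * E k x) \<le> (4 * C) * real (Suc k) powr (- (1 / 2))"
    proof (intro always_eventually allI)
      fix k
      let ?s = "real (Suc k)"
      have "(LINT x|lborel. g x * E k x) = (LINT x|lborel. 4 * ?s * g x - 4 * ?s * (g x * exp (- (1 / (4 * ?s)) * (norm (x - y))\<^sup>2)))"
        unfolding E_def by (simp add: algebra_simps)
      also have "\<dots> = 4 * ?s * (LINT x|lborel. g x) - 4 * ?s * Z y ?s"
        unfolding Z_def using g_integrable gauss_g_integrable[of ?s y] by (simp del: of_nat_Suc)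
      finally have "norm (LINT x|lborel. g x * E k x) = 4 * ?s * \<bar>Z y ?s\<bar>" by (simp add: g_integral_zero abs_mult)
      also have "\<dots> \<le> 4 * ?s * (C * ?s powr (- (3 / 2)))" by (intro mult_left_mono C) auto
      also have "\<dots> = (4 * C) * (?s powr 1 * ?s powr (- (3 / 2)))" by (simp only: powr_one mult_ac)
      also have "?s powr 1 * ?s powr (- (3 / 2)) = ?s powr (- (1 / 2))" unfolding powr_add[symmetric] by simp
      finally show "norm (LINT x|lborel. g x * E k x) \<le> (4 * C) * ?s powr (- (1 / 2))" .
    qed
    show "(\<lambda>k. (4 * C) * real (Suc k) powr (- (1 / 2))) \<longlonglongrightarrow> 0" by (rule s_seq_powr_lim) simp
  qed
  moreover have "(\<lambda>k. LINT x|lborel. g x * E k x) \<longlonglongrightarrow> (LINT x|lborel. g x * (norm (x - y))\<^sup>2)"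
  proof (rule integral_dominated_convergence[where w="\<lambda>x. \<bar>g x * (norm (x - y))\<^sup>2\<bar>"])
    show "AE x in lborel. (\<lambda>k. g x * E k x) \<longlonglongrightarrow> g x * (norm (x - y))\<^sup>2"
    proof (intro always_eventually allI tendsto_mult tendsto_const)
      fix x :: "real^'n"
      define a where "a = (norm (x - y))\<^sup>2"
      have "(\<lambda>k. 4 * real (Suc k) * (1 - exp (- (1 / (4 * real (Suc k))) * a))) \<longlonglongrightarrow> a"
      proof (cases "a = 0")
        case False
        then have "a > 0" by (simp add: a_def)
        then show ?thesis by real_asymp
      qed simp
      then show "(\<lambda>k. E k x) \<longlonglongrightarrow> (norm (x - y))\<^sup>2" by (simp add: E_def a_def)
    qed
    show "AE x in lborel. norm (g x * E k x) \<le> \<bar>g x * (norm (x - y))\<^sup>2\<bar>" for k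
    proof (intro always_eventually allI)
      fix x :: "real^'n"
      let ?s = "real (Suc k)"
      define b where "b = (1 / (4 * ?s)) * (norm (x - y))\<^sup>2"
      have b: "b \<ge> 0" by (simp add: b_def)
      have "1 - exp (- b) \<le> b" using exp_ge_add_one_self[of "- b"] by linarith
      then have "4 * ?s * (1 - exp (- b)) \<le> 4 * ?s * b" by (intro mult_left_mono) auto
      also have "4 * ?s * b = (norm (x - y))\<^sup>2" by (simp add: b_def)
      finally have "\<bar>E k x\<bar> \<le> (norm (x - y))\<^sup>2" using b by (simp add: E_def b_def)
      then show "norm (g x * E k x) \<le> \<bar>g x * (norm (x - y))\<^sup>2\<bar>" by (simp add: abs_mult mult_left_mono)
    qed
  qed (use sq_dist_integrable[of y] in \<open>auto simp: E_def\<close>)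
  ultimately show ?thesis using LIMSEQ_unique by blast
qed

text \<open>Boundedness of \<open>g\<close> handles the singularity at y, and its weighted
  integrability handles infinity.\<close>

lemma log_g_integrable: "integrable lborel (\<lambda>x. g x * ln (norm (x - y)))"
proof -
  obtain G where G: "G \<ge> 0" "\<And>x. \<bar>g x\<bar> \<le> G" using g_bounded by blast
  have e: "(0::real) \<le> 1/2" "(1/2::real) < DIM(real^'n)" using n3 by auto
  have i1: "integrable lborel (\<lambda>x. \<bar>g x\<bar> * (1 + (norm (x - y))\<^sup>2))"
    using integrable_abs[OF g_integrable] integrable_abs[OF sq_dist_integrable[of y]] by (simp add: distrib_left abs_mult)
  have "integrable lborel (\<lambda>x. \<bar>g x\<bar> * (1 + (norm (x - y))\<^sup>2) + 2 * \<bar>g x\<bar> + 2 * G * truncpow (1/2) (y - x))"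
    using i1 integrable_abs[OF g_integrable] truncpow_shift(1)[OF e, of y] by simp
  then show ?thesis
  proof (rule Bochner_Integration.integrable_bound)
    show "AE x in lborel. norm (g x * ln (norm (x - y))) \<le> norm (\<bar>g x\<bar> * (1 + (norm (x - y))\<^sup>2) + 2 * \<bar>g x\<bar> + 2 * G * truncpow (1/2) (y - x))"
    proof (intro always_eventually allI)
      fix x
      let ?r = "norm (x - y)"
      have "\<bar>ln ?r\<bar> \<le> ?r + exp (- (1/2) * ln ?r) / (1/2)" by (rule abs_ln_le) auto
      also have "exp (- (1/2) * ln ?r) \<le> 1 + truncpow (1/2) (y - x)"
        using exp_ln_le_truncpow[of "1/2" "y - x"] by (simp add: norm_minus_commute)
      also have "?r \<le> 1 + ?r\<^sup>2" using norm_power_le_one_plus_sq[of "x - y" 1] by simp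
      finally have "\<bar>ln ?r\<bar> \<le> (1 + ?r\<^sup>2) + 2 + 2 * truncpow (1/2) (y - x)" by simp
      then have "\<bar>g x\<bar> * \<bar>ln ?r\<bar> \<le> \<bar>g x\<bar> * ((1 + ?r\<^sup>2) + 2 + 2 * truncpow (1/2) (y - x))" by (intro mult_left_mono) auto
      also have "\<dots> = \<bar>g x\<bar> * (1 + ?r\<^sup>2) + 2 * \<bar>g x\<bar> + 2 * (\<bar>g x\<bar> * truncpow (1/2) (y - x))" by (simp add: algebra_simps)
      also have "\<dots> \<le> \<bar>g x\<bar> * (1 + ?r\<^sup>2) + 2 * \<bar>g x\<bar> + 2 * (G * truncpow (1/2) (y - x))"
        using G(2)[of x] by (intro add_left_mono mult_left_mono mult_right_mono truncpow_nonneg) auto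
      finally show "norm (g x * ln ?r) \<le> norm (\<bar>g x\<bar> * (1 + ?r\<^sup>2) + 2 * \<bar>g x\<bar> + 2 * G * truncpow (1/2) (y - x))"
        by (simp add: abs_mult mult.assoc)
    qed
  qed measurable
qed

text \<open>In the mixture for the logarithm the constant part drops out because \<open>g\<close>
  has integral 0, and the Gaussian part is a heat flow of \<open>g\<close>. On the frequency side
  the integral over s collapses to the constant of \<open>gamma_kernel_integral\<close>, so that
  Fourier inversion returns \<phi>(y).\<close>

lemma log_g_integral: "(LINT x|lborel. g x * ln (norm (x - y))) = - log_const CARD('n) * \<phi> y"
proof -
  have n1: "CARD('n) \<ge> 1" using n3 by simp
  have ae: "AE x in lborel. x \<noteq> y" by (rule AE_lborel_neq)
  let ?F = "\<lambda>x s. g x * logker (norm (x - y)) s"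
  have meas: "case_prod ?F \<in> borel_measurable (lborel \<Otimes>\<^sub>M lborel)" unfolding case_prod_beta' by measurable
  have fin: "(\<integral>\<^sup>+x. \<integral>\<^sup>+s. ennreal (norm (?F x s)) \<partial>lborel \<partial>lborel) < \<infinity>"
  proof -
    have "(\<integral>\<^sup>+x. \<integral>\<^sup>+s. ennreal (norm (?F x s)) \<partial>lborel \<partial>lborel) = (\<integral>\<^sup>+x. ennreal (norm (g x * ln (norm (x - y)))) \<partial>lborel)"
    proof (rule nn_integral_cong_AE)
      show "AE x in lborel. (\<integral>\<^sup>+s. ennreal (norm (?F x s)) \<partial>lborel) = ennreal (norm (g x * ln (norm (x - y))))"
        using ae
      proof eventually_elim
        case (elim x)
        have "(\<integral>\<^sup>+s. ennreal (norm (?F x s)) \<partial>lborel) = ennreal \<bar>g x\<bar> * (\<integral>\<^sup>+s. ennreal \<bar>logker (norm (x - y)) s\<bar> \<partial>lborel)"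
          by (subst nn_integral_cmult[symmetric]) (auto simp: abs_mult ennreal_mult)
        then show ?case using elim by (simp add: nn_integral_abs_logker abs_mult ennreal_mult)
      qed
    qed
    also have "\<dots> < \<infinity>" using log_g_integrable[of y] by (simp add: integrable_iff_bounded)
    finally show ?thesis .
  qed
  have "(LINT x|lborel. g x * ln (norm (x - y))) = (LINT x|lborel. LINT s|lborel. ?F x s)"
  proof (rule integral_cong_AE)
    show "AE x in lborel. g x * ln (norm (x - y)) = (LINT s|lborel. ?F x s)"
      using ae
    proof eventually_elim
      case (elim x)
      then show ?case using logker_integral(1)[of "norm (x - y)"] by (simp add: has_bochner_integral_iff)
    qed
  qed measurable
  also have "\<dots> = (LINT s|lborel. LINT x|lborel. ?F x s)"
    by (rule fubini_swap(1)[OF sigma_finite_lborel sigma_finite_lborel meas fin])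
  also have "\<dots> = (LINT s|lborel. - Re (inv_fourier (\<lambda>\<xi>. complex_of_real (indicator {0<..} s * (1 / (2 * s) * (4 * pi * s) powr (real CARD('n) / 2) * exp (- s * (norm \<xi>)\<^sup>2) * norm \<xi> ^ CARD('n))) * cfourier \<phi> \<xi>) y))"
  proof (rule Bochner_Integration.integral_cong[OF refl])
    fix s :: real
    show "(LINT x|lborel. ?F x s) = - Re (inv_fourier (\<lambda>\<xi>. complex_of_real (indicator {0<..} s * (1 / (2 * s) * (4 * pi * s) powr (real CARD('n) / 2) * exp (- s * (norm \<xi>)\<^sup>2) * norm \<xi> ^ CARD('n))) * cfourier \<phi> \<xi>) y)"
    proof (cases "s > 0")
      case True
      let ?e = "\<lambda>x. exp (- (1 / (4 * s)) * (norm (x - y))\<^sup>2)"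
      have "(LINT x|lborel. ?F x s) = (LINT x|lborel. exp (- (1 / (4 * s))) / (2 * s) * g x - 1 / (2 * s) * (g x * ?e x))"
        using True by (intro Bochner_Integration.integral_cong refl) (simp add: logker_def diff_divide_distrib algebra_simps)
      also have "\<dots> = exp (- (1 / (4 * s))) / (2 * s) * (LINT x|lborel. g x) - 1 / (2 * s) * Z y s"
        unfolding Z_def using g_integrable gauss_g_integrable[OF True, of y] by simp
      also have "\<dots> = - (1 / (2 * s) * (4 * pi * s) powr (real CARD('n) / 2) * Re (inv_fourier (\<lambda>\<xi>. complex_of_real (exp (- s * (norm \<xi>)\<^sup>2)) * symb \<xi>) y))"
        using g_integral_zero Z_eq[OF True, of y] by simp
      also have "\<dots> = - Re (complex_of_real (1 / (2 * s) * (4 * pi * s) powr (real CARD('n) / 2)) * inv_fourier (\<lambda>\<xi>. complex_of_real (exp (- s * (norm \<xi>)\<^sup>2)) * symb \<xi>) y)"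
        by simp
      also have "complex_of_real (1 / (2 * s) * (4 * pi * s) powr (real CARD('n) / 2)) * inv_fourier (\<lambda>\<xi>. complex_of_real (exp (- s * (norm \<xi>)\<^sup>2)) * symb \<xi>) y
         = inv_fourier (\<lambda>\<xi>. complex_of_real (1 / (2 * s) * (4 * pi * s) powr (real CARD('n) / 2)) * (complex_of_real (exp (- s * (norm \<xi>)\<^sup>2)) * symb \<xi>)) y"
        by (rule inv_fourier_scale[symmetric])
      finally show ?thesis using True by (simp add: symb_def mult.assoc)
    qed (simp add: logker_def inv_fourier_def)
  qed
  \<comment> \<open>At \<xi> = 0 the integrand carries the factor 0^n, so the mixture is 0 there;
    the exceptional point is a null set and is removed afterwards.\<close>
  also have "\<dots> = - Re (inv_fourier (\<lambda>\<xi>. complex_of_real (if \<xi> = 0 then 0 else log_const CARD('n)) * cfourier \<phi> \<xi>) y)"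
  proof -
    define k where "k s \<xi> = indicator {0<..} s * (1 / (2 * s) * (4 * pi * s) powr (real CARD('n) / 2) * exp (- s * (norm \<xi>)\<^sup>2) * norm \<xi> ^ CARD('n))" for s and \<xi> :: "real^'n"
    have lc: "log_const CARD('n) \<ge> 0" using n3 by (simp add: log_const_def Gamma_real_pos less_imp_le)
    have [measurable]: "\<phi> \<in> borel_measurable borel" by (rule schwartz_measurable[OF schwartz])
    have a: "case_prod k \<in> borel_measurable (borel \<Otimes>\<^sub>M borel)" unfolding k_def case_prod_beta' by measurable
    have b: "cfourier \<phi> \<in> borel_measurable borel" by measurable
    have c: "0 \<le> k s \<xi>" for s \<xi> by (auto simp: k_def indicator_def)
    have d: "0 \<le> (if \<xi> = 0 then 0 else log_const CARD('n))" for \<xi> :: "real^'n" using lc by simp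
    have e: "(\<integral>\<^sup>+s. ennreal (k s \<xi>) \<partial>lborel) = ennreal (if \<xi> = 0 then 0 else log_const CARD('n))" for \<xi> :: "real^'n"
    proof (cases "\<xi> = 0")
      case True
      then show ?thesis using n3 by (simp add: k_def power_0_left)
    next
      case False
      then show ?thesis using gamma_kernel_integral[of "norm \<xi>" "CARD('n)"] n1 by (simp add: k_def)
    qed
    have f: "integrable lborel (\<lambda>\<xi>. complex_of_real (if \<xi> = 0 then 0 else log_const CARD('n)) * cfourier \<phi> \<xi>)"
      by (intro rapid_integrable(2) rapid_mult[OF rapid_fourier[OF schwartz], where A="log_const CARD('n)" and j=0]) (use lc in auto)
    note S = inv_fourier_superpose[OF a b c d e f, of y]
    show ?thesis unfolding S(2) k_def[symmetric] using S(1) by simp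
  qed
  also have "inv_fourier (\<lambda>\<xi>. complex_of_real (if \<xi> = 0 then 0 else log_const CARD('n)) * cfourier \<phi> \<xi>) y = inv_fourier (\<lambda>\<xi>. complex_of_real (log_const CARD('n)) * cfourier \<phi> \<xi>) y"
  proof -
    have [measurable]: "\<phi> \<in> borel_measurable borel" by (rule schwartz_measurable[OF schwartz])
    have "AE \<xi>::real^'n in lborel. \<xi> \<noteq> 0" by (rule AE_lborel_neq)
    then have "AE \<xi>::real^'n in lborel. complex_of_real (if \<xi> = 0 then 0 else log_const CARD('n)) * cfourier \<phi> \<xi> * cis (y \<bullet> \<xi>) = complex_of_real (log_const CARD('n)) * cfourier \<phi> \<xi> * cis (y \<bullet> \<xi>)"
      by eventually_elim simp
    then show ?thesis unfolding inv_fourier_def by (subst integral_cong_AE) auto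
  qed
  also have "\<dots> = complex_of_real (log_const CARD('n)) * complex_of_real (\<phi> y)"
    unfolding inv_fourier_scale schwartz_inversion[OF schwartz] ..
  finally show ?thesis by simp
qed

end

section \<open>Existence of solutions\<close>

lemma loc_integrableI:
  fixes u :: "real^'n \<Rightarrow> real"
  assumes [measurable]: "u \<in> borel_measurable borel" and u: "\<And>x. \<bar>u x\<bar> \<le> A * (1 + (norm x)\<^sup>2)"
  shows "loc_integrable u"
  unfolding loc_integrable_def
proof (intro conjI allI impI)
  fix K :: "(real^'n) set"
  assume K: "compact K"
  then obtain R where R: "\<And>x. x \<in> K \<Longrightarrow> norm x \<le> R" using compact_imp_bounded bounded_iff by metis
  have Km[measurable]: "K \<in> sets borel" using K by (simp add: borel_compact)
  have A: "A \<ge> 0" using order_trans[OF abs_ge_zero u[of 0]] by simp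
  have "integrable lborel (\<lambda>x. (A * (1 + R\<^sup>2)) * indicat_real K x)"
    using emeasure_compact_finite[OF K] by (intro integrable_mult_right integrable_real_indicator) auto
  then show "set_integrable lborel K u"
    unfolding set_integrable_def
  proof (rule Bochner_Integration.integrable_bound)
    show "AE x in lborel. norm (indicat_real K x *\<^sub>R u x) \<le> norm ((A * (1 + R\<^sup>2)) * indicat_real K x)"
    proof (intro always_eventually allI)
      fix x
      show "norm (indicat_real K x *\<^sub>R u x) \<le> norm ((A * (1 + R\<^sup>2)) * indicat_real K x)"
      proof (cases "x \<in> K")
        case True
        have "(norm x)\<^sup>2 \<le> R\<^sup>2" using R[OF True] by (intro power_mono) auto
        then have "A * (1 + (norm x)\<^sup>2) \<le> A * (1 + R\<^sup>2)" using A by (intro mult_left_mono) auto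
        then have "\<bar>u x\<bar> \<le> A * (1 + R\<^sup>2)" using u[of x] by linarith
        then show ?thesis using True by simp
      qed simp
    qed
  qed measurable
qed auto

text \<open>The weight in the definition is of order |x|^(2n), so the quotient is at most a multiple
  of (1 + |x|^2)^(1 - n). It is integrable because 2(n - 1) > n, that is n > 2.\<close>

lemma L_spaceI:
  fixes u :: "real^'n \<Rightarrow> real"
  assumes n3: "CARD('n) \<ge> 3" and [measurable]: "u \<in> borel_measurable borel" and u: "\<And>x. \<bar>u x\<bar> \<le> A * (1 + (norm x)\<^sup>2)"
  shows "L_space (real CARD('n) / 2) u"
  unfolding L_space_def
proof (intro conjI loc_integrableI[OF assms(2) u])
  define n where "n = CARD('n)"
  have n: "n \<ge> 3" using n3 by (simp add: n_def)
  have A: "A \<ge> 0" using order_trans[OF abs_ge_zero u[of 0]] by simp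
  have i: "integrable lborel (\<lambda>x::real^'n. (A * 2 ^ n) * (1 + (norm x)\<^sup>2) powr (- (real n - 1)))"
    using n by (intro integrable_mult_right integrable_one_plus_norm_sq_powr) (auto simp: n_def)
  show "integrable lborel (\<lambda>x. \<bar>u x\<bar> / (1 + norm x powr (real CARD('n) + 2 * (real CARD('n) / 2))))"
  proof (rule integrable_nonneg_bound[OF i])
    fix x :: "real^'n"
    let ?q = "1 + (norm x)\<^sup>2"
    have q: "?q > 0" by (simp add: add_pos_nonneg)
    have pw: "norm x powr (real CARD('n) + 2 * (real CARD('n) / 2)) = ((norm x)\<^sup>2) ^ n"
    proof (cases "x = 0")
      case True
      then show ?thesis using n by (simp add: power_0_left)
    next
      case False
      have "norm x powr (real CARD('n) + 2 * (real CARD('n) / 2)) = norm x powr (real (2 * n))" by (simp add: n_def)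
      also have "\<dots> = norm x ^ (2 * n)" using False by (subst powr_realpow) auto
      finally show ?thesis by (simp add: power_mult)
    qed
    have "?q ^ n \<le> 2 ^ n * (1 + ((norm x)\<^sup>2) ^ n)" by (rule one_plus_power_le) simp
    then have "1 / (1 + ((norm x)\<^sup>2) ^ n) \<le> 2 ^ n / ?q ^ n"
      using q by (simp add: field_simps add_pos_nonneg)
    then have "\<bar>u x\<bar> * (1 / (1 + ((norm x)\<^sup>2) ^ n)) \<le> (A * ?q) * (2 ^ n / ?q ^ n)"
      using u[of x] by (intro mult_mono) (auto simp: A add_nonneg_nonneg)
    also have "\<dots> = (A * 2 ^ n) * (?q / ?q ^ n)" by simp
    also have "?q / ?q ^ n = ?q powr (- (real n - 1))"
      using q powr_diff[of ?q 1 "real n"] by (simp add: powr_realpow)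
    finally show "\<bar>u x\<bar> / (1 + norm x powr (real CARD('n) + 2 * (real CARD('n) / 2))) \<le> (A * 2 ^ n) * ?q powr (- (real n - 1))"
      unfolding pw by simp
  qed (auto simp: add_nonneg_nonneg)
qed

theorem theorem1p3:
  fixes \<alpha> \<Lambda> :: real
  assumes "CARD('n::finite) \<ge> 3"
    and "\<alpha> > -1"
    and "0 < \<Lambda>" and "\<Lambda> < Lambda1 CARD('n)"
  shows "\<exists>u :: real^'n \<Rightarrow> real. P0 \<alpha> u \<and>
           (LINT x|lborel. norm x powr (real CARD('n) * \<alpha>) * exp (real CARD('n) * u x)) = \<Lambda>"
proof -
  define N where "N = real CARD('n)"
  have N: "N \<ge> 3" using assms(1) by (simp add: N_def)
  define \<gamma> where "\<gamma> = log_const CARD('n)"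
  have L1: "Lambda1 CARD('n) = 2 * \<gamma>" unfolding \<gamma>_def using assms(1) by (intro Lambda1_eq_log_const) auto
  have \<gamma>: "\<gamma> > 0" using assms(3,4) L1 by simp
  \<comment> \<open>Chosen so that N times \<Lambda>/\<gamma> is 2\<beta>, the factor in the
    exponent of the equilibrium. As \<open>Lambda1\<close> equals 2\<gamma>, the bound on \<Lambda>
    is exactly \<beta> < N.\<close>
  define \<beta> where "\<beta> = N * \<Lambda> / (2 * \<gamma>)"
  have \<beta>: "0 < \<beta>" "\<beta> < N"
    using N \<gamma> assms(3,4) L1 by (auto simp: \<beta>_def field_simps)
  have b2: "\<beta> < real DIM(real^'n)" using \<beta>(2) by (simp add: N_def)
  obtain l and p :: "real^'n" and \<rho> Z A where G: "\<rho> \<in> borel_measurable borel \<and> (\<forall>x. 0 \<le> \<rho> x) \<and> integrable lborel \<rho> \<and>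
     (LINT x|lborel. \<rho> x) = 1 \<and> Z > 0 \<and>
     (\<forall>x. \<rho> x = weight \<alpha> l p x * exp (- 2 * \<beta> * (LINT y|lborel. ln (norm (x - y)) * \<rho> y)) / Z) \<and>
     (\<forall>x. integrable lborel (\<lambda>y. ln (norm (x - y)) * \<rho> y)) \<and>
     (\<forall>x. (LINT y|lborel. \<bar>ln (norm (x - y)) * \<rho> y\<bar>) \<le> A * (1 + norm x))"
    using gas_equilibrium_exists[OF assms(2) \<beta>(1) b2] by (elim exE) (rule that)
  have [measurable]: "\<rho> \<in> borel_measurable borel" and \<rho>0: "\<And>x. 0 \<le> \<rho> x"
    and \<rho>i: "integrable lborel \<rho>" and \<rho>1: "(LINT x|lborel. \<rho> x) = 1" and Z: "Z > 0"
    and eq: "\<And>x. \<rho> x = weight \<alpha> l p x * exp (- 2 * \<beta> * (LINT y|lborel. ln (norm (x - y)) * \<rho> y)) / Z"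
    and li: "\<And>x::real^'n. integrable lborel (\<lambda>y. ln (norm (x - y)) * \<rho> y)"
    and lb: "\<And>x. (LINT y|lborel. \<bar>ln (norm (x - y)) * \<rho> y\<bar>) \<le> A * (1 + norm x)"
    using G by blast+
  define \<psi> where "\<psi> x = (LINT y|lborel. ln (norm (x - y)) * \<rho> y)" for x
  have [measurable]: "\<psi> \<in> borel_measurable borel" unfolding \<psi>_def by measurable
  have A0: "A \<ge> 0"
  proof -
    have "0 \<le> (LINT y|lborel. \<bar>ln (norm (0 - y)) * \<rho> y\<bar>)" by (rule integral_nonneg_AE) auto
    from order_trans[OF this lb[of 0]] show ?thesis by simp
  qed
  have lin: "1 + norm x \<le> 2 * (1 + (norm x)\<^sup>2)" for x :: "real^'n"
    using sum_squares_bound[of "norm x" 1] zero_le_power2[of "norm x"] norm_ge_zero[of x] unfolding power_one distrib_left by linarith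
  have \<psi>_le: "\<bar>\<psi> x\<bar> \<le> (2 * A) * (1 + (norm x)\<^sup>2)" for x
  proof -
    have "\<bar>\<psi> x\<bar> \<le> (LINT y|lborel. \<bar>ln (norm (x - y)) * \<rho> y\<bar>)"
      unfolding \<psi>_def using integral_norm_bound[of lborel "\<lambda>y. ln (norm (x - y)) * \<rho> y"] by simp
    also have "\<dots> \<le> A * (1 + norm x)" by (rule lb)
    also have "\<dots> \<le> A * (2 * (1 + (norm x)\<^sup>2))" by (intro mult_left_mono lin A0)
    finally show ?thesis by (simp add: mult_ac)
  qed
  \<comment> \<open>The additive constant replaces the normalisation 1/Z by \<Lambda>/Z, so that the
    right-hand side of the equation is \<Lambda> \<rho> pointwise and has total mass
    \<Lambda>.\<close>
  define c where "c = ln (\<Lambda> / Z) / N"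
  define u where "u x = - (\<Lambda> / \<gamma>) * \<psi> x - l * (norm (x - p))\<^sup>2 + c" for x
  have um[measurable]: "u \<in> borel_measurable borel" unfolding u_def by measurable
  have rhs: "norm x powr (N * \<alpha>) * exp (N * u x) = \<Lambda> * \<rho> x" for x
  proof -
    have "N * u x = - 2 * \<beta> * \<psi> x + (- (N * l * (norm (x - p))\<^sup>2) + ln (\<Lambda> / Z))"
      using \<gamma> N by (simp add: u_def \<beta>_def c_def algebra_simps)
    then have "exp (N * u x) = exp (- 2 * \<beta> * \<psi> x) * (exp (- (N * l * (norm (x - p))\<^sup>2)) * (\<Lambda> / Z))"
      using assms(3) Z by (simp only: exp_add) simp
    moreover have "\<rho> x = norm x powr (N * \<alpha>) * exp (- (N * l * (norm (x - p))\<^sup>2)) * exp (- 2 * \<beta> * \<psi> x) / Z"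
      using eq[of x] unfolding weight_def \<psi>_def[symmetric] N_def by simp
    ultimately show ?thesis by simp
  qed
  obtain A' where u_le: "\<And>x. \<bar>u x\<bar> \<le> A' * (1 + (norm x)\<^sup>2)"
  proof
    fix x :: "real^'n"
    have q: "1 \<le> 1 + (norm x)\<^sup>2" by simp
    have d: "(norm (x - p))\<^sup>2 \<le> (2 + 2 * (norm p)\<^sup>2) * (1 + (norm x)\<^sup>2)" by (rule norm_diff_sq_le)
    have "\<bar>u x\<bar> \<le> \<bar>\<Lambda> / \<gamma>\<bar> * \<bar>\<psi> x\<bar> + \<bar>l\<bar> * (norm (x - p))\<^sup>2 + \<bar>c\<bar> * 1"
      unfolding u_def using abs_triangle_ineq[of "- (\<Lambda> / \<gamma>) * \<psi> x - l * (norm (x - p))\<^sup>2" c]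
        abs_triangle_ineq4[of "- (\<Lambda> / \<gamma>) * \<psi> x" "l * (norm (x - p))\<^sup>2"] by (simp add: abs_mult)
    also have "\<dots> \<le> \<bar>\<Lambda> / \<gamma>\<bar> * ((2 * A) * (1 + (norm x)\<^sup>2)) + \<bar>l\<bar> * ((2 + 2 * (norm p)\<^sup>2) * (1 + (norm x)\<^sup>2)) + \<bar>c\<bar> * (1 + (norm x)\<^sup>2)"
      by (intro add_mono mult_left_mono \<psi>_le d q) auto
    also have "\<dots> = (\<bar>\<Lambda> / \<gamma>\<bar> * (2 * A) + \<bar>l\<bar> * (2 + 2 * (norm p)\<^sup>2) + \<bar>c\<bar>) * (1 + (norm x)\<^sup>2)"
      by (simp only: distrib_right mult.assoc)
    finally show "\<bar>u x\<bar> \<le> (\<bar>\<Lambda> / \<gamma>\<bar> * (2 * A) + \<bar>l\<bar> * (2 + 2 * (norm p)\<^sup>2) + \<bar>c\<bar>) * (1 + (norm x)\<^sup>2)" .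
  qed
  \<comment> \<open>Proved for every Schwartz function whatever the parity of n; for even n it is
    then restricted to compactly supported ones.\<close>
  have weak: "integrable lborel (\<lambda>x. u x * frac_lap (real CARD('n) / 2) \<phi> x) \<and>
      (LINT x|lborel. u x * frac_lap (real CARD('n) / 2) \<phi> x) = (LINT x|lborel. (\<Lambda> * \<rho> x) * \<phi> x)"
    if \<phi>: "schwartz_fun \<phi>" for \<phi>
  proof -
    interpret frac_test \<phi> by standard (use assms(1) \<phi> in auto)
    have gu: "integrable lborel (\<lambda>x. g x * u x)" by (rule g_dominated_integrable[OF um u_le])
    have g\<psi>: "integrable lborel (\<lambda>x. g x * \<psi> x)" by (rule g_dominated_integrable[OF _ \<psi>_le]) measurable
    let ?F = "\<lambda>x y. g x * (ln (norm (x - y)) * \<rho> y)"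
    have meas: "case_prod ?F \<in> borel_measurable (lborel \<Otimes>\<^sub>M lborel)" unfolding case_prod_beta' by measurable
    have fin: "(\<integral>\<^sup>+x. \<integral>\<^sup>+y. ennreal (norm (?F x y)) \<partial>lborel \<partial>lborel) < \<infinity>"
    proof -
      have i: "integrable lborel (\<lambda>x. g x * ((2 * A) * (1 + (norm x)\<^sup>2)))"
        by (rule g_dominated_integrable[where A="2 * A"]) (use A0 in \<open>auto simp: abs_mult\<close>)
      have "(\<integral>\<^sup>+x. \<integral>\<^sup>+y. ennreal (norm (?F x y)) \<partial>lborel \<partial>lborel) \<le> (\<integral>\<^sup>+x. ennreal (norm (g x * ((2 * A) * (1 + (norm x)\<^sup>2)))) \<partial>lborel)"
      proof (rule nn_integral_mono)
        fix x
        have "(\<integral>\<^sup>+y. ennreal (norm (?F x y)) \<partial>lborel) = ennreal \<bar>g x\<bar> * (\<integral>\<^sup>+y. ennreal \<bar>ln (norm (x - y)) * \<rho> y\<bar> \<partial>lborel)"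
          by (subst nn_integral_cmult[symmetric]) (auto simp: abs_mult ennreal_mult)
        also have "(\<integral>\<^sup>+y. ennreal \<bar>ln (norm (x - y)) * \<rho> y\<bar> \<partial>lborel) = ennreal (LINT y|lborel. \<bar>ln (norm (x - y)) * \<rho> y\<bar>)"
          by (rule nn_integral_eq_integral) (use li in auto)
        also have "\<dots> \<le> ennreal ((2 * A) * (1 + (norm x)\<^sup>2))"
        proof (rule ennreal_leI)
          have "A * (1 + norm x) \<le> A * (2 * (1 + (norm x)\<^sup>2))" by (intro mult_left_mono lin A0)
          then show "(LINT y|lborel. \<bar>ln (norm (x - y)) * \<rho> y\<bar>) \<le> (2 * A) * (1 + (norm x)\<^sup>2)"
            using lb[of x] by (simp add: mult_ac)
        qed
        also have "ennreal \<bar>g x\<bar> * ennreal ((2 * A) * (1 + (norm x)\<^sup>2)) = ennreal (norm (g x * ((2 * A) * (1 + (norm x)\<^sup>2))))"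
          using A0 by (subst ennreal_mult[symmetric]) (auto simp: abs_mult)
        finally show "(\<integral>\<^sup>+y. ennreal (norm (?F x y)) \<partial>lborel) \<le> ennreal (norm (g x * ((2 * A) * (1 + (norm x)\<^sup>2))))"
          by (simp add: mult_left_mono)
      qed
      also have "\<dots> < \<infinity>" using i by (simp add: integrable_iff_bounded)
      finally show ?thesis .
    qed
    have "(LINT x|lborel. g x * \<psi> x) = (LINT x|lborel. LINT y|lborel. ?F x y)"
      unfolding \<psi>_def by simp
    also have "\<dots> = (LINT y|lborel. LINT x|lborel. ?F x y)"
      by (rule fubini_swap(1)[OF sigma_finite_lborel sigma_finite_lborel meas fin])
    also have "\<dots> = (LINT y|lborel. - \<gamma> * (\<rho> y * \<phi> y))"
    proof (rule Bochner_Integration.integral_cong[OF refl])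
      fix y
      have "(LINT x|lborel. ?F x y) = \<rho> y * (LINT x|lborel. g x * ln (norm (x - y)))"
        by (subst integral_mult_right_zero[symmetric]) (simp add: mult_ac)
      then show "(LINT x|lborel. ?F x y) = - \<gamma> * (\<rho> y * \<phi> y)"
        unfolding log_g_integral \<gamma>_def by simp
    qed
    also have "\<dots> = - \<gamma> * (LINT y|lborel. \<rho> y * \<phi> y)" by (rule integral_mult_right_zero)
    finally have I\<psi>: "(LINT x|lborel. g x * \<psi> x) = - \<gamma> * (LINT y|lborel. \<rho> y * \<phi> y)" .
    have "(LINT x|lborel. g x * u x) = (LINT x|lborel. - (\<Lambda> / \<gamma>) * (g x * \<psi> x) - l * (g x * (norm (x - p))\<^sup>2) + c * g x)"
      unfolding u_def by (intro Bochner_Integration.integral_cong refl) (simp add: algebra_simps)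
    also have "\<dots> = - (\<Lambda> / \<gamma>) * (LINT x|lborel. g x * \<psi> x) - l * (LINT x|lborel. g x * (norm (x - p))\<^sup>2) + c * (LINT x|lborel. g x)"
      using g\<psi> sq_dist_integrable[of p] g_integrable by simp
    \<comment> \<open>The quadratic and the constant parts of u are annihilated by the vanishing
      moments of \<open>g\<close>; the factor \<gamma> cancels against the one in the definition of
      u.\<close>
    also have "\<dots> = \<Lambda> * (LINT y|lborel. \<rho> y * \<phi> y)"
      unfolding I\<psi> g_sq_dist_integral_zero g_integral_zero using \<gamma> by simp
    also have "\<dots> = (LINT x|lborel. (\<Lambda> * \<rho> x) * \<phi> x)"
      by (simp add: mult.assoc)
    finally show ?thesis using gu by (simp add: g_def mult.commute)
  qed
  have "solves_frac CARD('n) u (\<lambda>x. norm x powr (real CARD('n) * \<alpha>) * exp (real CARD('n) * u x))"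
    unfolding rhs[unfolded N_def] solves_frac_def
    using weak test_fun_imp_schwartz loc_integrableI[OF um u_le] L_spaceI[OF assms(1) um u_le] by auto
  moreover have "integrable lborel (\<lambda>x. norm x powr (real CARD('n) * \<alpha>) * exp (real CARD('n) * u x))"
    unfolding rhs[unfolded N_def] using \<rho>i by simp
  moreover have "(LINT x|lborel. norm x powr (real CARD('n) * \<alpha>) * exp (real CARD('n) * u x)) = \<Lambda>"
    unfolding rhs[unfolded N_def] using \<rho>1 by simp
  ultimately show ?thesis unfolding P0_def by blast
qed

end
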